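(* Let $n\ge 2$ and let $\ell=2^{k}m$ be a positive integer with $k\ge 0$ and $m$ odd. Then \[B_{n}/B_{n}[\ell]\cong \begin{cases} \Gamma_{n-1}/\Gamma_{n-1}[\ell] &\text{for } n=2,3,\\ B_n/B_n[2^k] \times\Gamma_{n-1}/\Gamma_{n-1}[m] &\text{for } n\geq 4.\end{cases}\] Moreover, for $n\ge 4$, the group $B_n/B_n[2^k]$ is trivial for $k=0$, is isomorphic to the symmetric group $S_n$ for $k=1$, and for $k\ge 2$ it is the non-split extension of $S_n$ by $\Gamma_{n-1}[2]/\Gamma_{n-1}[2^k]$ given by the preimage of $S_n\le \Gamma_{n-1}/\Gamma_{n-1}[2]$ in $\Gamma_{n-1}/\Gamma_{n-1}[2^k]$ under the quotient map $\Gamma_{n-1}/\Gamma_{n-1}[2^k]\to\Gamma_{n-1}/\Gamma_{n-1}[2]$.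
   Context: $B_n$ is the braid group on $n$ strands with Artin generators $\sigma_1,\dots,\sigma_{n-1}$. The integral Burau representation $\rho\colon B_n\to \mathrm{GL}_n(\mathbb{Z})$ is the unreduced Burau representation at $t=-1$: $\rho(\sigma_i)$ is the block diagonal matrix with blocks $I_{i-1}$, $\begin{pmatrix}2&-1\\1&0\end{pmatrix}$, $I_{n-i-1}$. For $\ell\ge1$, $B_n[\ell]=\{b\in B_n\mid \rho(b)\equiv I_n \bmod \ell\}$. Equip $\mathbb{Z}^n$ (standard basis $e_1,\dots,e_n$) with the alternating bilinear form $\langle e_i,e_j\rangle=(-1)^{i+j+1}$ for $i<j$, $0$ for $i=j$, $(-1)^{i+j}$ for $i>j$. Let $v_n=e_1+\dots+e_n$ and $w_n=e_1-e_2+\dots+(-1)^{n-1}e_n$. Define \[\Gamma_{n-1}=\{A\in \mathrm{GL}_n(\mathbb{Z})\mid \langle Av,Aw\rangle=\langle v,w\rangle\ \forall v,w\in\mathbb{Z}^n,\ Av_n=v_n,\ w_n^TA=w_n^T\},\] \[\Gamma_{n-1}[\ell]=\{A\in\Gamma_{n-1}\mid A\equiv I_n \bmod \ell\}.\] (Up to isomorphism compatible with the congruence subgroups, $\Gamma_{2g}$ is $\mathrm{Sp}_{2g}(\mathbb{Z})$ and $\Gamma_{2g-1}$ is the stabilizer $[\mathrm{Sp}_{2g}(\mathbb{Z})]_{e_1}$ of the first standard basis vector.) The image of $\rho$ lies in $\Gamma_{n-1}$. The inclusion $S_n\le\Gamma_{n-1}/\Gamma_{n-1}[2]$ (for $n\ge4$)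 is the one whose image is the image of $B_n$ in $\Gamma_{n-1}/\Gamma_{n-1}[2]$ under $\rho$; by Arnol'd, $B_n[2]$ is the pure braid group, so this image is $B_n/B_n[2]\cong S_n$. *)

theory Defs
  imports "HOL-Algebra.Sym_Groups" "HOL-Algebra.Elementary_Groups" "HOL-Number_Theory.Cong"
    "Jordan_Normal_Form.Matrix"
begin

text \<open>
  The braid group on \<open>n\<close> strands, by Artin's presentation. A word is a list of letters; the letter
  \<open>(i, True)\<close> stands for \<open>\<sigma>\<^sub>i\<close> and \<open>(i, False)\<close> for its inverse, with \<open>1 \<le> i \<le> n - 1\<close>. The group
  consists of the classes of words modulo the congruence generated by free cancellation and the
  braid relations.
\<close>

definition braid_words :: "nat \<Rightarrow> (nat \<times> bool) list set" where
  "braid_words n = lists ({1..<n} \<times> UNIV)"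

inductive braid_eq :: "nat \<Rightarrow> (nat \<times> bool) list \<Rightarrow> (nat \<times> bool) list \<Rightarrow> bool" for n :: nat where
  refl: "w \<in> braid_words n \<Longrightarrow> braid_eq n w w"
| sym: "braid_eq n u v \<Longrightarrow> braid_eq n v u"
| trans: "braid_eq n u v \<Longrightarrow> braid_eq n v w \<Longrightarrow> braid_eq n u w"
| congr: "braid_eq n u v \<Longrightarrow> a \<in> braid_words n \<Longrightarrow> b \<in> braid_words n \<Longrightarrow>
    braid_eq n (a @ u @ b) (a @ v @ b)"
| cancel: "i \<in> {1..<n} \<Longrightarrow> braid_eq n [(i, s), (i, \<not> s)] []"
| commute: "i \<in> {1..<n} \<Longrightarrow> j \<in> {1..<n} \<Longrightarrow> i + 2 \<le> j \<Longrightarrow>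
    braid_eq n [(i, True), (j, True)] [(j, True), (i, True)]"
| braid: "i \<in> {1..<n} \<Longrightarrow> Suc i \<in> {1..<n} \<Longrightarrow>
    braid_eq n [(i, True), (Suc i, True), (i, True)] [(Suc i, True), (i, True), (Suc i, True)]"

definition braid_rel :: "nat \<Rightarrow> ((nat \<times> bool) list \<times> (nat \<times> bool) list) set" where
  "braid_rel n = {(u, v). braid_eq n u v}"

definition braid_group :: "nat \<Rightarrow> (nat \<times> bool) list set monoid" where
  "braid_group n =
     \<lparr>carrier = braid_words n // braid_rel n,
      mult = (\<lambda>X Y. \<Union>u\<in>X. \<Union>v\<in>Y. braid_rel n `` {u @ v}),
      one = braid_rel n `` {[]}\<rparr>"


definition GL_int :: "nat \<Rightarrow> int mat monoid" where
  "GL_int n = units_of (ring_mat TYPE(int) n ())"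

definition burau_sigma :: "nat \<Rightarrow> nat \<Rightarrow> int mat" where
  "burau_sigma n i =
     diag_block_mat [1\<^sub>m (i - 1), mat_of_rows_list 2 [[2, -1], [1, 0]], 1\<^sub>m (n - i - 1)]"

fun burau_letter :: "nat \<Rightarrow> nat \<times> bool \<Rightarrow> int mat" where
  "burau_letter n (i, s) =
     (if s then burau_sigma n i else inv\<^bsub>GL_int n\<^esub> (burau_sigma n i))"

definition burau_word :: "nat \<Rightarrow> (nat \<times> bool) list \<Rightarrow> int mat" where
  "burau_word n w = foldr (\<lambda>x A. burau_letter n x * A) w (1\<^sub>m n)"

text \<open>
  The map \<open>burau_word n\<close> is constant on each class \<open>X\<close> of words, so \<open>burau_word n ` X\<close> is a singleton.
\<close>

definition burau :: "nat \<Rightarrow> (nat \<times> bool) list set \<Rightarrow> int mat" where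
  "burau n X = the_elem (burau_word n ` X)"

definition cong_one_mat :: "nat \<Rightarrow> nat \<Rightarrow> int mat \<Rightarrow> bool" where
  "cong_one_mat n l A \<longleftrightarrow> (\<forall>i<n. \<forall>j<n. [A $$ (i, j) = 1\<^sub>m n $$ (i, j)] (mod int l))"

definition braid_level :: "nat \<Rightarrow> nat \<Rightarrow> (nat \<times> bool) list set set" where
  "braid_level n l = {b \<in> carrier (braid_group n). cong_one_mat n l (burau n b)}"


text \<open>
  Vector and matrix indices start at 0 rather than 1. This does not change the parity of \<open>i + j\<close>,
  and it turns the signs \<open>(-1)\<^sup>i\<^sup>-\<^sup>1\<close> in \<open>alt_vec\<close> into \<open>(-1)\<^sup>i\<close>.
\<close>

definition form_coeff :: "nat \<Rightarrow> nat \<Rightarrow> int" where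
  "form_coeff i j = (if i < j then (-1) ^ (i + j + 1) else if i = j then 0 else (-1) ^ (i + j))"

definition alt_form :: "nat \<Rightarrow> int vec \<Rightarrow> int vec \<Rightarrow> int" where
  "alt_form n v w = (\<Sum>i<n. \<Sum>j<n. v $ i * w $ j * form_coeff i j)"

definition ones_vec :: "nat \<Rightarrow> int vec" where
  "ones_vec n = vec n (\<lambda>i. 1)"

definition alt_vec :: "nat \<Rightarrow> int vec" where
  "alt_vec n = vec n (\<lambda>i. (-1) ^ i)"

text \<open>
  \<open>Gamma n\<close> is the group \<open>\<Gamma>\<^sub>n\<^sub>-\<^sub>1\<close>: the argument is the size \<open>n\<close> of the matrices.
\<close>

definition Gamma :: "nat \<Rightarrow> int mat monoid" where
  "Gamma n = (GL_int n)
     \<lparr>carrier := {A \<in> carrier (GL_int n).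
        (\<forall>v\<in>carrier_vec n. \<forall>w\<in>carrier_vec n. alt_form n (A *\<^sub>v v) (A *\<^sub>v w) = alt_form n v w) \<and>
        A *\<^sub>v ones_vec n = ones_vec n \<and>
        mat_of_row (alt_vec n) * A = mat_of_row (alt_vec n)}\<rparr>"

definition Gamma_level :: "nat \<Rightarrow> nat \<Rightarrow> int mat set" where
  "Gamma_level n l = {A \<in> carrier (Gamma n). cong_one_mat n l A}"

abbreviation braid_quot :: "nat \<Rightarrow> nat \<Rightarrow> (nat \<times> bool) list set set monoid" where
  "braid_quot n l \<equiv> braid_group n Mod braid_level n l"

abbreviation Gamma_quot :: "nat \<Rightarrow> nat \<Rightarrow> int mat set monoid" where
  "Gamma_quot n l \<equiv> Gamma n Mod Gamma_level n l"

text \<open>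
  For \<open>d\<close> dividing \<open>l\<close>, the product of the subset \<open>\<Gamma>\<^sub>n\<^sub>-\<^sub>1[d]\<close> with the coset \<open>\<Gamma>\<^sub>n\<^sub>-\<^sub>1[l] A\<close> is the coset
  \<open>\<Gamma>\<^sub>n\<^sub>-\<^sub>1[d] A\<close>, so \<open>Gamma_reduce n d\<close> is the quotient map \<open>\<Gamma>\<^sub>n\<^sub>-\<^sub>1/\<Gamma>\<^sub>n\<^sub>-\<^sub>1[l] \<rightarrow> \<Gamma>\<^sub>n\<^sub>-\<^sub>1/\<Gamma>\<^sub>n\<^sub>-\<^sub>1[d]\<close>. Likewise
  \<open>burau_quot n l\<close> is the homomorphism \<open>B\<^sub>n/B\<^sub>n[l] \<rightarrow> \<Gamma>\<^sub>n\<^sub>-\<^sub>1/\<Gamma>\<^sub>n\<^sub>-\<^sub>1[l]\<close> induced by \<open>burau n\<close>.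
\<close>

definition Gamma_reduce :: "nat \<Rightarrow> nat \<Rightarrow> int mat set \<Rightarrow> int mat set" where
  "Gamma_reduce n d X = Gamma_level n d <#>\<^bsub>Gamma n\<^esub> X"

definition burau_quot :: "nat \<Rightarrow> nat \<Rightarrow> (nat \<times> bool) list set set \<Rightarrow> int mat set" where
  "burau_quot n l X = Gamma_level n l <#>\<^bsub>Gamma n\<^esub> (burau n ` X)"

definition Sn_embedding :: "nat \<Rightarrow> ((nat \<Rightarrow> nat) \<Rightarrow> int mat set) \<Rightarrow> bool" where
  "Sn_embedding n \<iota> \<longleftrightarrow>
     \<iota> \<in> mon (sym_group n) (Gamma_quot n 2) \<and>
     \<iota> ` carrier (sym_group n) =
       (\<lambda>b. Gamma_level n 2 #>\<^bsub>Gamma n\<^esub> burau n b) ` carrier (braid_group n)"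

definition Sn_preimage :: "nat \<Rightarrow> ((nat \<Rightarrow> nat) \<Rightarrow> int mat set) \<Rightarrow> nat \<Rightarrow> int mat set monoid" where
  "Sn_preimage n \<iota> l = (Gamma_quot n l)
     \<lparr>carrier := {X \<in> carrier (Gamma_quot n l).
        Gamma_reduce n 2 X \<in> \<iota> ` carrier (sym_group n)}\<rparr>"

definition Sn_projection :: "nat \<Rightarrow> ((nat \<Rightarrow> nat) \<Rightarrow> int mat set) \<Rightarrow> int mat set \<Rightarrow> (nat \<Rightarrow> nat)" where
  "Sn_projection n \<iota> X = inv_into (carrier (sym_group n)) \<iota> (Gamma_reduce n 2 X)"


definition group_extension ::
  "('a, 'k) monoid_scheme \<Rightarrow> ('b, 'e) monoid_scheme \<Rightarrow> ('c, 'q) monoid_scheme \<Rightarrow>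
     ('a \<Rightarrow> 'b) \<Rightarrow> ('b \<Rightarrow> 'c) \<Rightarrow> bool" where
  "group_extension K E Q i p \<longleftrightarrow>
     group K \<and> group E \<and> group Q \<and> i \<in> mon K E \<and> p \<in> epi E Q \<and>
     i ` carrier K = kernel E Q p"

definition splits :: "('b, 'e) monoid_scheme \<Rightarrow> ('c, 'q) monoid_scheme \<Rightarrow> ('b \<Rightarrow> 'c) \<Rightarrow> bool" where
  "splits E Q p \<longleftrightarrow> (\<exists>s\<in>hom Q E. \<forall>x\<in>carrier Q. p (s x) = x)"

end

theory Submission
  imports Defs
begin

text \<open>
  Write \<open>c\<^sub>i = e\<^sub>i + e\<^sub>i\<^sub>+\<^sub>1\<close> and let \<open>T\<^sub>u x = x + \<langle>x, u\<rangle> u\<close> be the transvection along \<open>u\<close>.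
  With indices from 0, the matrix of \<open>\<sigma>\<^sub>i\<^sub>+\<^sub>1\<close> is the transvection along \<open>c\<^sub>i\<close>, and the full twist on
  four adjacent strands gives the square of the transvection along \<open>c\<^sub>i + c\<^sub>i\<^sub>+\<^sub>2\<close>; conjugation then gives the square of the transvection
  along every \<open>c\<^sub>i + c\<^sub>j\<close>.

  Modulo an odd prime these elements generate the transvections along all vectors of the lattice
  \<open>w\<^sub>n\<^sup>T x = 0\<close>, and the latter generate \<open>\<Gamma>\<^sub>n\<^sub>-\<^sub>1\<close> modulo the prime by moving \<open>A c\<^sub>0, A c\<^sub>1, \<dots>\<close> back to
  \<open>c\<^sub>0, c\<^sub>1, \<dots>\<close> one after the other. For \<open>p\<close> dividing \<open>N\<close>, an element \<open>1 + N X\<close> of level \<open>N\<close> is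
  determined modulo \<open>N p\<close> by the symmetric matrix modulo \<open>p\<close> of \<open>\<langle>X x, y\<rangle>\<close>, and symmetric matrices are
  spanned by the squares of \<open>c\<^sub>i\<close> and \<open>c\<^sub>i + c\<^sub>j\<close>. Since exponents of transvections can be prescribed
  modulo coprime numbers, the braid image maps onto \<open>\<Gamma>\<^sub>n\<^sub>-\<^sub>1\<close> modulo every odd number, even after
  imposing triviality modulo \<open>2\<^sup>k\<close>, and it contains the level 2 subgroup up to level \<open>2\<^sup>k\<close>. Modulo 2 the
  representation is by permutation matrices.
\<close>

section \<open>The alternating form and transvections\<close>

text \<open>The obstacle is the prime 2. For \<open>n \<ge> 4\<close> only squares of transvections
  along \<open>c_i + c_j\<close> with non-adjacent \<open>i, j\<close> are available, and modulo 2
  the image consists of permutation matrices. A square does no harm modulo \<open>N\<close> prime to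
  2, where the exponent 2 is invertible, nor on levels \<open>2 ^ k\<close> with
  \<open>k \<ge> 1\<close>, where the exponents wanted are already even.

  Surjectivity modulo an odd \<open>m\<close> alone would not give a direct product. So the
  approximating braid is required from the start to be trivial modulo a second number
  \<open>K\<close>; with \<open>K = 2 ^ k\<close> this is surjectivity onto the product.

  Lifting from \<open>N\<close> to \<open>N p\<close> by symmetric matrices needs \<open>p\<close>
  to divide \<open>N\<close>, so that terms of order \<open>N^2\<close> vanish. A prime not yet
  dividing \<open>N\<close> is brought in by the prime case, with the braid trivial modulo
  \<open>N\<close>.

  The form degenerates differently for the two parities of \<open>n\<close>: \<open>v_n\<close>
  pairs to zero with everything for odd \<open>n\<close>, while for even \<open>n\<close> it lies in
  the lattice and pairs to zero with it. This is why the last vector \<open>c_{n-2}\<close>, and the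
  maps that fix the whole lattice, need a distinction of parity.\<close>

definition transv :: "nat \<Rightarrow> int \<Rightarrow> int vec \<Rightarrow> int mat" where
  "transv n t u = mat n n (\<lambda>(i, j). (if i = j then 1 else 0) + t * u $ i * alt_form n (unit_vec n j) u)"

definition wlat :: "nat \<Rightarrow> int vec set" where
  "wlat n = {u \<in> carrier_vec n. alt_vec n \<bullet> u = 0}"

definition cvec :: "nat \<Rightarrow> nat \<Rightarrow> int vec" where
  "cvec n i = vec n (\<lambda>k. if k = i \<or> k = Suc i then 1 else 0)"

text \<open>Pairing with \<open>c_j\<close> takes the difference of two adjacent coordinates, so a
  partial sum \<open>e_0 + ... + e_i\<close> pairs to 1 with \<open>c_i\<close> and to 0 with the
  others. The last one, \<open>i = n - 1\<close>, is \<open>ones_vec n\<close>.\<close>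

definition fvec :: "nat \<Rightarrow> nat \<Rightarrow> int vec" where
  "fvec n i = vec n (\<lambda>k. if k \<le> i then 1 else 0)"

lemma alt_form_add_left [simp]:
  "x \<in> carrier_vec n \<Longrightarrow> y \<in> carrier_vec n \<Longrightarrow> alt_form n (x + y) z = alt_form n x z + alt_form n y z"
  by (simp add: alt_form_def ring_distribs sum.distrib)

lemma alt_form_add_right [simp]:
  "x \<in> carrier_vec n \<Longrightarrow> y \<in> carrier_vec n \<Longrightarrow> alt_form n z (x + y) = alt_form n z x + alt_form n z y"
  by (simp add: alt_form_def ring_distribs sum.distrib)

lemma alt_form_smult_left [simp]:
  "x \<in> carrier_vec n \<Longrightarrow> alt_form n (a \<cdot>\<^sub>v x) y = a * alt_form n x y"
  by (simp add: alt_form_def sum_distrib_left ac_simps)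

lemma alt_form_smult_right [simp]:
  "y \<in> carrier_vec n \<Longrightarrow> alt_form n x (a \<cdot>\<^sub>v y) = a * alt_form n x y"
  by (simp add: alt_form_def sum_distrib_left ac_simps)

lemma alt_form_minus_left [simp]:
  "x \<in> carrier_vec n \<Longrightarrow> y \<in> carrier_vec n \<Longrightarrow> alt_form n (x - y) z = alt_form n x z - alt_form n y z"
  by (simp add: alt_form_def algebra_simps sum_subtractf)

lemma alt_form_minus_right [simp]:
  "x \<in> carrier_vec n \<Longrightarrow> y \<in> carrier_vec n \<Longrightarrow> alt_form n z (x - y) = alt_form n z x - alt_form n z y"
  by (simp add: alt_form_def algebra_simps sum_subtractf)

lemma form_coeff_swap: "form_coeff i j = - form_coeff j i"
  by (auto simp: form_coeff_def add.commute)

lemma alt_form_swap: "alt_form n x y = - alt_form n y x"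
proof -
  have "alt_form n x y = (\<Sum>j<n. \<Sum>i<n. x $ i * y $ j * form_coeff i j)"
    unfolding alt_form_def by (rule sum.swap)
  also have "\<dots> = (\<Sum>j<n. \<Sum>i<n. - (y $ j * x $ i * form_coeff j i))"
    by (rule sum.cong[OF HOL.refl], rule sum.cong[OF HOL.refl]) (subst form_coeff_swap, simp add: mult.commute)
  also have "\<dots> = - alt_form n y x" by (simp add: alt_form_def sum_negf)
  finally show ?thesis .
qed

lemma alt_form_self [simp]: "alt_form n x x = 0"
  by (rule equal_neg_zero[THEN iffD1, OF alt_form_swap])

lemma wlat_carrier [dest]: "u \<in> wlat n \<Longrightarrow> u \<in> carrier_vec n"
  by (simp add: wlat_def)

lemma alt_vec_carrier [simp]: "alt_vec n \<in> carrier_vec n"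
  by (simp add: alt_vec_def)

lemma ones_vec_carrier [simp]: "ones_vec n \<in> carrier_vec n"
  by (simp add: ones_vec_def)

lemma cvec_carrier [simp]: "cvec n i \<in> carrier_vec n"
  by (simp add: cvec_def)

lemma fvec_carrier [simp]: "fvec n i \<in> carrier_vec n"
  by (simp add: fvec_def)

lemma dim_special_vec [simp]:
  "dim_vec (ones_vec n) = n" "dim_vec (alt_vec n) = n" "dim_vec (cvec n i) = n" "dim_vec (fvec n i) = n"
  by (simp_all add: ones_vec_def alt_vec_def cvec_def fvec_def)

lemma index_special_vec [simp]:
  assumes "k < n"
  shows "ones_vec n $ k = 1" "alt_vec n $ k = (-1) ^ k"
    "cvec n i $ k = (if k = i \<or> k = Suc i then 1 else 0)" "fvec n i $ k = (if k \<le> i then 1 else 0)"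
  using assms by (simp_all add: ones_vec_def alt_vec_def cvec_def fvec_def)

lemma wlat_add: "u \<in> wlat n \<Longrightarrow> w \<in> wlat n \<Longrightarrow> u + w \<in> wlat n"
  using scalar_prod_add_distrib[of "alt_vec n" n u w] by (auto simp: wlat_def)

lemma wlat_smult: "u \<in> wlat n \<Longrightarrow> a \<cdot>\<^sub>v u \<in> wlat n"
  by (auto simp: wlat_def)

lemma wlat_minus: "u \<in> wlat n \<Longrightarrow> w \<in> wlat n \<Longrightarrow> u - w \<in> wlat n"
  using scalar_prod_minus_distrib[of "alt_vec n" n u w] by (auto simp: wlat_def)

lemma alt_vec_scalar_prod: "x \<in> carrier_vec n \<Longrightarrow> alt_vec n \<bullet> x = (\<Sum>i<n. (-1) ^ i * x $ i)"
  by (auto simp: scalar_prod_def alt_vec_def lessThan_atLeast0)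

lemma sum_lessThan_two:
  fixes f :: "nat \<Rightarrow> int"
  assumes "Suc i < n" "\<And>k. k < n \<Longrightarrow> k \<noteq> i \<Longrightarrow> k \<noteq> Suc i \<Longrightarrow> f k = 0"
  shows "(\<Sum>k<n. f k) = f i + f (Suc i)"
proof -
  have "(\<Sum>k<n. f k) = (\<Sum>k\<in>{i, Suc i}. f k)"
    by (rule sum.mono_neutral_right) (use assms in auto)
  then show ?thesis by simp
qed

text \<open>The coefficients of \<open>e_i\<close> and \<open>e_{i+1}\<close> in a row of the form
  have opposite signs and cancel, except in the rows \<open>i\<close> and \<open>i + 1\<close>
  themselves.\<close>

lemma alt_form_cvec:
  assumes "Suc i < n"
  shows "alt_form n x (cvec n i) = x $ i - x $ Suc i"
proof -
  have inner: "(\<Sum>j<n. x $ k * cvec n i $ j * form_coeff k j) =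
      x $ k * (form_coeff k i + form_coeff k (Suc i))" for k
    by (subst sum_lessThan_two[OF assms]) (use assms in \<open>auto simp: cvec_def ring_distribs\<close>)
  have "alt_form n x (cvec n i) = (\<Sum>k<n. x $ k * (form_coeff k i + form_coeff k (Suc i)))"
    unfolding alt_form_def inner ..
  also have "\<dots> = x $ i - x $ Suc i"
    by (subst sum_lessThan_two[OF assms]) (use assms in \<open>auto simp: form_coeff_def\<close>)
  finally show ?thesis .
qed

lemma cvec_wlat [simp]: "Suc i < n \<Longrightarrow> cvec n i \<in> wlat n"
  unfolding wlat_def mem_Collect_eq
  by (subst alt_vec_scalar_prod) (auto simp: cvec_def sum_lessThan_two[of i n])

text \<open>Rows of the form alternate in sign, so their partial sums take only the values 0 and
  plus or minus 1, the parity being shifted by the zero on the diagonal. For even \<open>n\<close>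
  the form thus represents \<open>w_n^T\<close> by \<open>ones_vec n\<close>; for odd
  \<open>n\<close> that vector is in the radical.\<close>

lemma alt_form_ones:
  assumes "x \<in> carrier_vec n"
  shows "alt_form n x (ones_vec n) = (if even n then alt_vec n \<bullet> x else 0)"
proof -
  have partial: "(\<Sum>j<m. form_coeff i j) =
      (if m \<le> i then if even m then 0 else (-1) ^ i else if even m then (-1) ^ i else 0)" for i m
  proof (induction m)
    case (Suc m)
    then show ?case
      by (cases "even m"; cases "even i"; cases i m rule: linorder_cases) (simp_all add: form_coeff_def)
  qed simp
  have row: "(\<Sum>j<n. form_coeff i j) = (if even n then (-1) ^ i else 0)" if "i < n" for i
    using that by (simp add: partial)
  have "alt_form n x (ones_vec n) = (\<Sum>i<n. x $ i * (\<Sum>j<n. form_coeff i j))"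
    by (simp add: alt_form_def ones_vec_def sum_distrib_left)
  also have "\<dots> = (\<Sum>i<n. x $ i * (if even n then (-1) ^ i else 0))"
    by (intro sum.cong HOL.refl) (simp add: row)
  also have "\<dots> = (if even n then alt_vec n \<bullet> x else 0)"
    using assms by (auto simp: alt_vec_scalar_prod ac_simps)
  finally show ?thesis .
qed

lemma mat_eq_by_action:
  assumes "A \<in> carrier_mat n m" "B \<in> carrier_mat n m"
    "\<And>x. x \<in> carrier_vec m \<Longrightarrow> A *\<^sub>v x = (B *\<^sub>v x :: int vec)"
  shows "A = B"
proof (rule eq_matI)
  fix i j assume ij: "i < dim_row B" "j < dim_col B"
  have entry: "(C *\<^sub>v unit_vec m j) $ i = C $$ (i, j)" if "C \<in> carrier_mat n m" for C :: "int mat"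
    using ij assms that by auto
  show "A $$ (i, j) = B $$ (i, j)"
    using entry[OF assms(1)] entry[OF assms(2)] assms(3)[of "unit_vec m j"] by simp
qed (use assms in auto)

lemma alt_form_expand_left:
  assumes "x \<in> carrier_vec n"
  shows "alt_form n x u = (\<Sum>j<n. x $ j * alt_form n (unit_vec n j) u)"
proof -
  have "alt_form n (unit_vec n j) u = (\<Sum>l<n. u $ l * form_coeff j l)" if "j < n" for j
  proof -
    have "alt_form n (unit_vec n j) u = (\<Sum>i<n. if i = j then \<Sum>l<n. u $ l * form_coeff j l else 0)"
      unfolding alt_form_def by (intro sum.cong HOL.refl) (use that in auto)
    then show ?thesis using that by simp
  qed
  then show ?thesis by (simp add: alt_form_def sum_distrib_left ac_simps)
qed

lemma transv_carrier [simp]: "transv n t u \<in> carrier_mat n n"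
  by (simp add: transv_def)

lemma transv_action:
  assumes "x \<in> carrier_vec n" "u \<in> carrier_vec n"
  shows "transv n t u *\<^sub>v x = x + (t * alt_form n x u) \<cdot>\<^sub>v u"
proof (rule eq_vecI)
  fix i assume i: "i < dim_vec (x + (t * alt_form n x u) \<cdot>\<^sub>v u)"
  then have "i < n" using assms by auto
  then have "(transv n t u *\<^sub>v x) $ i =
      (\<Sum>j<n. ((if i = j then 1 else 0) + t * u $ i * alt_form n (unit_vec n j) u) * x $ j)"
    using assms by (auto simp: transv_def scalar_prod_def lessThan_atLeast0)
  also have "\<dots> = (\<Sum>j<n. if i = j then x $ j else 0) + t * u $ i * (\<Sum>j<n. x $ j * alt_form n (unit_vec n j) u)"
    unfolding sum_distrib_left sum.distrib[symmetric] by (rule sum.cong) (auto simp: algebra_simps)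
  also have "\<dots> = x $ i + t * u $ i * alt_form n x u"
    using \<open>i < n\<close> assms by (simp add: alt_form_expand_left[of x])
  finally show "(transv n t u *\<^sub>v x) $ i = (x + (t * alt_form n x u) \<cdot>\<^sub>v u) $ i"
    using \<open>i < n\<close> assms by simp
qed (use assms in \<open>auto simp: transv_def\<close>)

lemma transv_zero [simp]: "transv n 0 u = 1\<^sub>m n"
  by (auto simp: transv_def one_mat_def)

text \<open>Since \<open>u\<close> is orthogonal to itself, \<open>t\<close> behaves as an exponent.
  This is what allows exponents to be chosen by congruences later on.\<close>

lemma transv_mult:
  assumes "u \<in> carrier_vec n"
  shows "transv n s u * transv n t u = transv n (s + t) u"
proof (rule mat_eq_by_action[OF mult_carrier_mat[OF transv_carrier transv_carrier] transv_carrier])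
  fix x :: "int vec" assume "x \<in> carrier_vec n"
  then show "(transv n s u * transv n t u) *\<^sub>v x = transv n (s + t) u *\<^sub>v x"
    using assms
    by (auto simp: assoc_mult_mat_vec[OF transv_carrier transv_carrier] transv_action ring_distribs intro!: eq_vecI)
qed

lemma mat_of_row_fix_iff:
  assumes "A \<in> carrier_mat n n" "w \<in> carrier_vec n"
  shows "mat_of_row w * A = mat_of_row w \<longleftrightarrow> (\<forall>x\<in>carrier_vec n. w \<bullet> (A *\<^sub>v x) = w \<bullet> (x :: int vec))"
proof -
  have act: "(mat_of_row w *\<^sub>v y) $ 0 = w \<bullet> y" if "y \<in> carrier_vec n" for y
    using assms that by (simp add: mat_of_row_def scalar_prod_def row_def)
  have act': "((mat_of_row w * A) *\<^sub>v x) $ 0 = w \<bullet> (A *\<^sub>v x)" if "x \<in> carrier_vec n" for x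
    using assms that by (subst assoc_mult_mat_vec) (auto simp: act)
  show ?thesis
  proof
    assume "mat_of_row w * A = mat_of_row w"
    then show "\<forall>x\<in>carrier_vec n. w \<bullet> (A *\<^sub>v x) = w \<bullet> x" using act act' by metis
  next
    assume R: "\<forall>x\<in>carrier_vec n. w \<bullet> (A *\<^sub>v x) = w \<bullet> x"
    show "mat_of_row w * A = mat_of_row w"
    proof (rule mat_eq_by_action)
      fix x :: "int vec" assume x: "x \<in> carrier_vec n"
      have "((mat_of_row w * A) *\<^sub>v x) $ 0 = (mat_of_row w *\<^sub>v x) $ 0"
        using R act act' x by simp
      then show "(mat_of_row w * A) *\<^sub>v x = mat_of_row w *\<^sub>v x"
        using assms by (intro eq_vecI) (auto simp: mat_of_row_def)
    qed (use assms in auto)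
  qed
qed

section \<open>The isometry group inside the general linear group\<close>

lemma carrier_GL_int:
  "carrier (GL_int n) = {A \<in> carrier_mat n n. \<exists>B\<in>carrier_mat n n. A * B = 1\<^sub>m n \<and> B * A = 1\<^sub>m n}"
  by (auto simp: GL_int_def units_of_def Units_def ring_mat_simps)

lemma group_GL_int: "group (GL_int n)"
proof -
  interpret ring "ring_mat TYPE(int) n ()" by (rule ring_mat)
  show ?thesis unfolding GL_int_def by (rule units_group)
qed

lemma GL_int_simps [simp]:
  "mult (GL_int n) = (*)" "one (GL_int n) = 1\<^sub>m n"
  by (simp_all add: GL_int_def units_of_def ring_mat_simps)

lemma Gamma_simps [simp]:
  "mult (Gamma n) = (*)" "one (Gamma n) = 1\<^sub>m n"
  by (simp_all add: Gamma_def)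

lemma in_Gamma_iff:
  "A \<in> carrier (Gamma n) \<longleftrightarrow> A \<in> carrier (GL_int n) \<and>
     (\<forall>v\<in>carrier_vec n. \<forall>w\<in>carrier_vec n. alt_form n (A *\<^sub>v v) (A *\<^sub>v w) = alt_form n v w) \<and>
     A *\<^sub>v ones_vec n = ones_vec n \<and> (\<forall>x\<in>carrier_vec n. alt_vec n \<bullet> (A *\<^sub>v x) = alt_vec n \<bullet> x)"
  using mat_of_row_fix_iff[of A n "alt_vec n"] by (auto simp: Gamma_def carrier_GL_int)

lemma Gamma_carrier_mat [dest]: "A \<in> carrier (Gamma n) \<Longrightarrow> A \<in> carrier_mat n n"
  by (auto simp: in_Gamma_iff carrier_GL_int)

lemma Gamma_form:
  "A \<in> carrier (Gamma n) \<Longrightarrow> x \<in> carrier_vec n \<Longrightarrow> y \<in> carrier_vec n \<Longrightarrow>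
    alt_form n (A *\<^sub>v x) (A *\<^sub>v y) = alt_form n x y"
  by (auto simp: in_Gamma_iff)

lemma Gamma_ones: "A \<in> carrier (Gamma n) \<Longrightarrow> A *\<^sub>v ones_vec n = ones_vec n"
  by (auto simp: in_Gamma_iff)

lemma Gamma_alt: "A \<in> carrier (Gamma n) \<Longrightarrow> x \<in> carrier_vec n \<Longrightarrow> alt_vec n \<bullet> (A *\<^sub>v x) = alt_vec n \<bullet> x"
  by (auto simp: in_Gamma_iff)

lemma Gamma_wlat: "A \<in> carrier (Gamma n) \<Longrightarrow> x \<in> wlat n \<Longrightarrow> A *\<^sub>v x \<in> wlat n"
  by (auto simp: wlat_def Gamma_alt)

lemma subgroup_Gamma: "subgroup (carrier (Gamma n)) (GL_int n)"
proof -
  interpret group "GL_int n" by (rule group_GL_int)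
  show ?thesis
  proof (rule subgroupI)
    have "1\<^sub>m n \<in> carrier (Gamma n)"
      by (auto simp: in_Gamma_iff carrier_GL_int)
    then show "carrier (Gamma n) \<noteq> {}" by blast
  next
    fix A assume A: "A \<in> carrier (Gamma n)"
    then have AG: "A \<in> carrier (GL_int n)" by (simp add: in_Gamma_iff)
    define B where "B = inv\<^bsub>GL_int n\<^esub> A"
    have BG: "B \<in> carrier (GL_int n)" using AG by (simp add: B_def)
    have AB: "A * B = 1\<^sub>m n" "B * A = 1\<^sub>m n"
      using r_inv[OF AG] l_inv[OF AG] by (simp_all add: B_def)
    have Bc: "B \<in> carrier_mat n n" and Ac: "A \<in> carrier_mat n n"
      using BG AG by (auto simp: carrier_GL_int)
    have ABx: "A *\<^sub>v (B *\<^sub>v x) = x" "B *\<^sub>v (A *\<^sub>v x) = x" if "x \<in> carrier_vec n" for x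
      using that AB Ac Bc by (metis assoc_mult_mat_vec one_mult_mat_vec)+
    have Bx: "B *\<^sub>v x \<in> carrier_vec n" if "x \<in> carrier_vec n" for x using that Bc by auto
    show "inv\<^bsub>GL_int n\<^esub> A \<in> carrier (Gamma n)"
      unfolding B_def[symmetric] in_Gamma_iff
      using BG Gamma_form[OF A Bx Bx] Gamma_alt[OF A Bx] ABx Gamma_ones[OF A]
      by (metis ones_vec_carrier)
  next
    fix A B assume A: "A \<in> carrier (Gamma n)" and B: "B \<in> carrier (Gamma n)"
    have AB: "(A * B) *\<^sub>v x = A *\<^sub>v (B *\<^sub>v x)" if "x \<in> carrier_vec n" for x
      using that A B by (meson Gamma_carrier_mat assoc_mult_mat_vec)
    have Bx: "B *\<^sub>v x \<in> carrier_vec n" if "x \<in> carrier_vec n" for x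
      using that B by (meson Gamma_carrier_mat mult_mat_vec_carrier)
    have "A * B \<in> carrier (GL_int n)"
      using m_closed[of A B] A B by (simp add: in_Gamma_iff)
    then show "A \<otimes>\<^bsub>GL_int n\<^esub> B \<in> carrier (Gamma n)"
      by (simp add: in_Gamma_iff[of "A * B"] AB Bx Gamma_form[OF A] Gamma_form[OF B]
        Gamma_alt[OF A] Gamma_alt[OF B] Gamma_ones[OF A] Gamma_ones[OF B])
  qed (auto simp: in_Gamma_iff)
qed

lemma group_Gamma: "group (Gamma n)"
proof -
  have "group ((GL_int n)\<lparr>carrier := carrier (Gamma n)\<rparr>)"
    by (rule group.subgroup_imp_group[OF group_GL_int subgroup_Gamma])
  then show ?thesis by (simp add: Gamma_def)
qed

text \<open>Membership in \<open>wlat n\<close> enters twice: it gives invariance of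
  \<open>w_n^T\<close> directly, and by \<open>alt_form_ones\<close> it makes \<open>u\<close>
  orthogonal to \<open>v_n\<close>, which is therefore fixed. The form is preserved because it is
  alternating.\<close>

lemma transv_Gamma:
  assumes "u \<in> wlat n"
  shows "transv n t u \<in> carrier (Gamma n)"
proof -
  have u: "u \<in> carrier_vec n" using assms by auto
  have "transv n t u \<in> carrier (GL_int n)"
    using transv_mult[OF u, of t "-t"] transv_mult[OF u, of "-t" t]
    by (auto simp: carrier_GL_int intro!: bexI[of _ "transv n (-t) u"])
  moreover have "alt_form n (ones_vec n) u = 0"
    using assms u by (subst alt_form_swap) (simp add: alt_form_ones wlat_def)
  then have "ones_vec n + (t * alt_form n (ones_vec n) u) \<cdot>\<^sub>v u = ones_vec n"
    using u by (intro eq_vecI) auto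
  moreover have "alt_form n (x + (t * alt_form n x u) \<cdot>\<^sub>v u) (y + (t * alt_form n y u) \<cdot>\<^sub>v u) = alt_form n x y"
    if "x \<in> carrier_vec n" "y \<in> carrier_vec n" for x y
    using that u alt_form_swap[of n u y] by (simp add: algebra_simps)
  moreover have "alt_vec n \<bullet> (x + a \<cdot>\<^sub>v u) = alt_vec n \<bullet> x" if "x \<in> carrier_vec n" for x a
    using that assms by (subst scalar_prod_add_distrib[of _ n]) (auto simp: wlat_def)
  ultimately show ?thesis using u by (auto simp: in_Gamma_iff transv_action)
qed

declare wlat_carrier [simp] Gamma_carrier_mat [simp]

section \<open>Congruences and congruence-closed subgroups\<close>

lemma cvec_pair:
  assumes "Suc i < n" "Suc j < n"
  shows "alt_form n (cvec n i) (cvec n j) = (if j = Suc i then 1 else if i = Suc j then -1 else 0)"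
  using assms by (auto simp: alt_form_cvec)

interpretation Gamma: group "Gamma n" for n by (rule group_Gamma)

lemma Gamma_mult [simp]: "A \<in> carrier (Gamma n) \<Longrightarrow> B \<in> carrier (Gamma n) \<Longrightarrow> A * B \<in> carrier (Gamma n)"
  using Gamma.m_closed[of A n B] by simp

lemma Gamma_one [simp]: "1\<^sub>m n \<in> carrier (Gamma n)"
  using Gamma.one_closed[of n] by simp

lemma Gamma_inv_mult [simp]:
  "A \<in> carrier (Gamma n) \<Longrightarrow> inv\<^bsub>Gamma n\<^esub> A * A = 1\<^sub>m n"
  "A \<in> carrier (Gamma n) \<Longrightarrow> A * inv\<^bsub>Gamma n\<^esub> A = 1\<^sub>m n"
  using Gamma.l_inv[of A n] Gamma.r_inv[of A n] by simp_all

lemma Gamma_assoc: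
  "A \<in> carrier (Gamma n) \<Longrightarrow> B \<in> carrier (Gamma n) \<Longrightarrow> C \<in> carrier (Gamma n) \<Longrightarrow> A * B * C = A * (B * C)"
  using Gamma.m_assoc[of A n B C] by simp

lemma Gamma_act [simp]:
  "A \<in> carrier (Gamma n) \<Longrightarrow> x \<in> carrier_vec n \<Longrightarrow> A *\<^sub>v x \<in> carrier_vec n"
  by (meson Gamma_carrier_mat mult_mat_vec_carrier)

lemma Gamma_act_mult:
  "A \<in> carrier (Gamma n) \<Longrightarrow> B \<in> carrier (Gamma n) \<Longrightarrow> x \<in> carrier_vec n \<Longrightarrow>
    (A * B) *\<^sub>v x = A *\<^sub>v (B *\<^sub>v x)"
  by (meson Gamma_carrier_mat assoc_mult_mat_vec)

lemma Gamma_act_inv: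
  assumes "A \<in> carrier (Gamma n)" "x \<in> carrier_vec n"
  shows "inv\<^bsub>Gamma n\<^esub> A *\<^sub>v (A *\<^sub>v x) = x" "A *\<^sub>v (inv\<^bsub>Gamma n\<^esub> A *\<^sub>v x) = x"
  using Gamma_act_mult[of "inv\<^bsub>Gamma n\<^esub> A" n A x] Gamma_act_mult[of A n "inv\<^bsub>Gamma n\<^esub> A" x] assms by simp_all

lemma Gamma_eqI:
  assumes "A \<in> carrier (Gamma n)" "B \<in> carrier (Gamma n)"
    "\<And>x. x \<in> carrier_vec n \<Longrightarrow> A *\<^sub>v x = B *\<^sub>v x"
  shows "A = B"
  using assms by (intro mat_eq_by_action[of A n n B]) auto

lemma transv_inv:
  assumes "u \<in> wlat n"
  shows "inv\<^bsub>Gamma n\<^esub> (transv n t u) = transv n (-t) u"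
  using assms by (intro Gamma.inv_equality) (auto simp: transv_mult transv_Gamma)

lemma Gamma_act_add:
  "A \<in> carrier (Gamma n) \<Longrightarrow> x \<in> carrier_vec n \<Longrightarrow> y \<in> carrier_vec n \<Longrightarrow>
    A *\<^sub>v (x + y) = A *\<^sub>v x + A *\<^sub>v y"
  by (rule mult_add_distrib_mat_vec) auto

lemma Gamma_act_smult:
  assumes "A \<in> carrier (Gamma n)" "x \<in> carrier_vec n"
  shows "A *\<^sub>v (a \<cdot>\<^sub>v x) = a \<cdot>\<^sub>v (A *\<^sub>v x)"
  using assms Gamma_carrier_mat[OF assms(1)] by (intro eq_vecI) auto

lemma transv_conj:
  assumes "A \<in> carrier (Gamma n)" "u \<in> wlat n"
  shows "A * transv n t u * inv\<^bsub>Gamma n\<^esub> A = transv n t (A *\<^sub>v u)"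
proof (rule Gamma_eqI)
  fix x :: "int vec" assume x: "x \<in> carrier_vec n"
  define y where "y = inv\<^bsub>Gamma n\<^esub> A *\<^sub>v x"
  have y: "y \<in> carrier_vec n" "x = A *\<^sub>v y" using assms x by (auto simp: y_def Gamma_act_inv)
  have "alt_form n x (A *\<^sub>v u) = alt_form n y u" using y assms by (simp add: Gamma_form)
  then show "(A * transv n t u * inv\<^bsub>Gamma n\<^esub> A) *\<^sub>v x = transv n t (A *\<^sub>v u) *\<^sub>v x"
    using assms x y
    by (simp add: Gamma_act_mult[of _ n] transv_Gamma transv_action y_def[symmetric]
      Gamma_act_add[of _ n] Gamma_act_smult[of _ n] Gamma_act_inv[of _ n])
qed (use assms in \<open>auto simp: transv_Gamma Gamma_wlat\<close>)

text \<open>A transvection is quadratic in its vector, so a multiple of \<open>u\<close> only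
  contributes a power of the transvection along \<open>u\<close>.\<close>

lemma transv_smult:
  assumes "u \<in> carrier_vec n"
  shows "transv n t (a \<cdot>\<^sub>v u) = transv n (t * a\<^sup>2) u"
  using assms by (intro mat_eq_by_action[of _ n n])
    (auto simp: transv_action power2_eq_square intro!: eq_vecI)

definition vcong :: "nat \<Rightarrow> int \<Rightarrow> int vec \<Rightarrow> int vec \<Rightarrow> bool" where
  "vcong n N x y \<longleftrightarrow> (\<forall>i<n. [x $ i = y $ i] (mod N))"

text \<open>Congruence is tested on the action on vectors, in which all later computations are done;
  \<open>cong_one_mat_iff\<close> relates it to entries. The modulus is an integer so that
  \<open>N = 0\<close> can stand for equality.\<close>

definition mcong :: "nat \<Rightarrow> int \<Rightarrow> int mat \<Rightarrow> int mat \<Rightarrow> bool" where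
  "mcong n N A B \<longleftrightarrow> (\<forall>x\<in>carrier_vec n. vcong n N (A *\<^sub>v x) (B *\<^sub>v x))"

lemma vcong_refl [simp]: "vcong n N x x"
  by (simp add: vcong_def)

lemma vcong_sym: "vcong n N x y \<Longrightarrow> vcong n N y x"
  by (simp add: vcong_def cong_sym)

lemma vcong_trans [trans]: "vcong n N x y \<Longrightarrow> vcong n N y z \<Longrightarrow> vcong n N x z"
  by (metis vcong_def cong_trans)

lemma vcong_add:
  assumes "vcong n N x x'" "vcong n N y y'" "y \<in> carrier_vec n" "y' \<in> carrier_vec n"
  shows "vcong n N (x + y) (x' + y')"
  using assms by (simp add: vcong_def cong_add)

lemma vcong_smult:
  assumes "vcong n N x y" "[a = b] (mod N)" "x \<in> carrier_vec n" "y \<in> carrier_vec n"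
  shows "vcong n N (a \<cdot>\<^sub>v x) (b \<cdot>\<^sub>v y)"
  using assms by (simp add: vcong_def cong_mult)

lemma alt_form_vcong:
  assumes "vcong n N x x'" "vcong n N y y'"
  shows "[alt_form n x y = alt_form n x' y'] (mod N)"
  unfolding alt_form_def by (intro cong_sum cong_mult cong_refl) (use assms in \<open>auto simp: vcong_def\<close>)

lemma mult_vec_vcong:
  assumes "A \<in> carrier_mat n n" "vcong n N x y" "x \<in> carrier_vec n" "y \<in> carrier_vec n"
  shows "vcong n N (A *\<^sub>v x) (A *\<^sub>v y)"
proof -
  have "[row A i \<bullet> x = row A i \<bullet> y] (mod N)" if "i < n" for i
    unfolding scalar_prod_def using assms that
    by (auto simp: vcong_def intro!: cong_sum cong_mult)
  then show ?thesis using assms by (auto simp: vcong_def)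
qed

lemma mcong_refl [simp]: "mcong n N A A"
  by (simp add: mcong_def)

lemma mcong_sym: "mcong n N A B \<Longrightarrow> mcong n N B A"
  by (simp add: mcong_def vcong_sym)

lemma mcong_trans [trans]: "mcong n N A B \<Longrightarrow> mcong n N B C \<Longrightarrow> mcong n N A C"
  unfolding mcong_def by (blast intro: vcong_trans)

lemma mcong_dvd: "mcong n N A B \<Longrightarrow> M dvd N \<Longrightarrow> mcong n M A B"
  unfolding mcong_def vcong_def by (blast intro: cong_dvd_modulus)

lemma mcong_coprime:
  "mcong n N A B \<Longrightarrow> mcong n M A B \<Longrightarrow> coprime N M \<Longrightarrow> mcong n (N * M) A B"
  unfolding mcong_def vcong_def by (auto intro: coprime_cong_mult)

lemma mcong_mult:
  assumes "mcong n N A A'" "mcong n N B B'"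
    "A \<in> carrier (Gamma n)" "A' \<in> carrier (Gamma n)" "B \<in> carrier (Gamma n)" "B' \<in> carrier (Gamma n)"
  shows "mcong n N (A * B) (A' * B')"
  unfolding mcong_def
proof
  fix x :: "int vec" assume x: "x \<in> carrier_vec n"
  have "vcong n N (A *\<^sub>v (B *\<^sub>v x)) (A *\<^sub>v (B' *\<^sub>v x))"
    by (rule mult_vec_vcong) (use assms x in \<open>auto simp: mcong_def\<close>)
  also have "vcong n N \<dots> (A' *\<^sub>v (B' *\<^sub>v x))"
    using assms x by (simp add: mcong_def)
  finally show "vcong n N ((A * B) *\<^sub>v x) ((A' * B') *\<^sub>v x)"
    using assms x by (simp add: Gamma_act_mult[of _ n])
qed

lemma mcong_inv:
  assumes "mcong n N A B" "A \<in> carrier (Gamma n)" "B \<in> carrier (Gamma n)"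
  shows "mcong n N (inv\<^bsub>Gamma n\<^esub> A) (inv\<^bsub>Gamma n\<^esub> B)"
proof -
  have "mcong n N (inv\<^bsub>Gamma n\<^esub> A * (A * inv\<^bsub>Gamma n\<^esub> B)) (inv\<^bsub>Gamma n\<^esub> A * (B * inv\<^bsub>Gamma n\<^esub> B))"
    by (intro mcong_mult assms mcong_refl) (use assms in auto)
  then show ?thesis
    using assms Gamma.inv_closed[OF assms(2)] Gamma.inv_closed[OF assms(3)]
    by (simp add: Gamma_assoc[of _ n, symmetric] mcong_sym left_mult_one_mat[OF Gamma_carrier_mat]
      right_mult_one_mat[OF Gamma_carrier_mat])
qed

lemma transv_mcong:
  assumes "vcong n N u u'" "[t = t'] (mod N)" "u \<in> carrier_vec n" "u' \<in> carrier_vec n"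
  shows "mcong n N (transv n t u) (transv n t' u')"
  unfolding mcong_def
  using assms by (auto simp: transv_action intro!: vcong_add vcong_smult cong_mult alt_form_vcong)

lemma cong_one_mat_iff:
  assumes "A \<in> carrier_mat n n"
  shows "cong_one_mat n l A \<longleftrightarrow> mcong n (int l) A (1\<^sub>m n)"
proof
  assume R: "cong_one_mat n l A"
  show "mcong n (int l) A (1\<^sub>m n)"
    unfolding mcong_def vcong_def
  proof (intro ballI allI impI)
    fix x :: "int vec" and i assume "x \<in> carrier_vec n" "i < n"
    have "[row A i $ j = row (1\<^sub>m n) i $ j] (mod int l)" if "j < n" for j
      using R[unfolded cong_one_mat_def, rule_format, OF \<open>i < n\<close> that] assms that \<open>i < n\<close>
      by (cases "i = j") simp_all
    then have "[row A i \<bullet> x = row (1\<^sub>m n) i \<bullet> x] (mod int l)"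
      unfolding scalar_prod_def using \<open>x \<in> carrier_vec n\<close>
      by (intro cong_sum cong_mult cong_refl) auto
    then show "[(A *\<^sub>v x) $ i = (1\<^sub>m n *\<^sub>v x) $ i] (mod int l)"
      using assms \<open>i < n\<close> \<open>x \<in> carrier_vec n\<close> by simp
  qed
next
  assume R: "mcong n (int l) A (1\<^sub>m n)"
  show "cong_one_mat n l A"
    unfolding cong_one_mat_def
  proof (intro allI impI)
    fix i j assume "i < n" "j < n"
    then show "[A $$ (i, j) = 1\<^sub>m n $$ (i, j)] (mod int l)"
      using assms R[unfolded mcong_def vcong_def, rule_format, of "unit_vec n j" i] by simp
  qed
qed

text \<open>Such an \<open>H\<close> is the full preimage of a subgroup of the quotient modulo
  \<open>N\<close>. Generation modulo \<open>N\<close> is proved as a statement about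
  \<open>H\<close>, without computing in the quotient.\<close>

locale cong_subgroup =
  fixes n :: nat and N :: int and H :: "int mat set"
  assumes subgroup: "subgroup H (Gamma n)"
    and closed: "A \<in> carrier (Gamma n) \<Longrightarrow> B \<in> H \<Longrightarrow> mcong n N A B \<Longrightarrow> A \<in> H"
begin

lemma H_Gamma [simp]: "A \<in> H \<Longrightarrow> A \<in> carrier (Gamma n)"
  using subgroup.mem_carrier[OF subgroup] .

lemma H_mult: "A \<in> H \<Longrightarrow> B \<in> H \<Longrightarrow> A * B \<in> H"
  using subgroup.m_closed[OF subgroup, of A B] by simp

lemma H_one [simp]: "1\<^sub>m n \<in> H"
  using subgroup.one_closed[OF subgroup] by simp

lemma H_inv: "A \<in> H \<Longrightarrow> inv\<^bsub>Gamma n\<^esub> A \<in> H"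
  using subgroup.m_inv_closed[OF subgroup] .

lemma H_cancel_left:
  assumes "A \<in> H" "A * B \<in> H" "B \<in> carrier (Gamma n)"
  shows "B \<in> H"
proof -
  have "inv\<^bsub>Gamma n\<^esub> A * (A * B) = B"
    using assms by (simp add: Gamma_assoc[of _ n, symmetric] left_mult_one_mat[OF Gamma_carrier_mat])
  then show ?thesis using H_mult[OF H_inv[OF assms(1)] assms(2)] by simp
qed

lemma transv_pow:
  assumes "u \<in> wlat n" "transv n s u \<in> H"
  shows "transv n (k * s) u \<in> H"
proof -
  have nat: "transv n (int m * s) u \<in> H" for m
  proof (induction m)
    case (Suc m)
    then show ?case using H_mult[OF assms(2) Suc] assms(1) by (simp add: transv_mult algebra_simps)
  qed simp
  show ?thesis
  proof (cases "k \<ge> 0")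
    case True then show ?thesis using nat[of "nat k"] by simp
  next
    case False
    then show ?thesis using H_inv[OF nat[of "nat (-k)"]] assms(1) by (simp add: transv_inv)
  qed
qed

text \<open>Generation becomes a question about vectors: \<open>U\<close> is stable under
  \<open>H\<close>, under scalars and under congruence modulo \<open>N\<close>, and the task is to
  show that it is the whole lattice. Closure under addition is the difficult point.\<close>

definition U :: "int vec set" where
  "U = {u \<in> wlat n. transv n 1 u \<in> H}"

lemma U_I: "u \<in> wlat n \<Longrightarrow> transv n 1 u \<in> H \<Longrightarrow> u \<in> U"
  by (simp add: U_def)

lemma U_wlat [simp]: "u \<in> U \<Longrightarrow> u \<in> wlat n"
  by (simp add: U_def)

lemma U_carrier [simp]: "u \<in> U \<Longrightarrow> u \<in> carrier_vec n"
  by (rule wlat_carrier[OF U_wlat])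

lemma U_transv:
  assumes "u \<in> U"
  shows "transv n t u \<in> H"
proof -
  have "transv n 1 u \<in> H" using assms unfolding U_def by blast
  from transv_pow[OF U_wlat[OF assms] this, of t] show ?thesis by simp
qed

lemma U_smult: "u \<in> U \<Longrightarrow> a \<cdot>\<^sub>v u \<in> U"
  using U_transv[of u "a\<^sup>2"] by (intro U_I) (simp_all add: wlat_smult transv_smult)

lemma U_act:
  assumes "A \<in> H" "u \<in> U"
  shows "A *\<^sub>v u \<in> U"
proof (rule U_I)
  show "A *\<^sub>v u \<in> wlat n" using assms by (simp add: Gamma_wlat)
  show "transv n 1 (A *\<^sub>v u) \<in> H"
    using H_mult[OF H_mult[OF assms(1) U_transv[OF assms(2), of 1]] H_inv[OF assms(1)]] assms
    by (simp add: transv_conj)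
qed

lemma U_cong:
  assumes "u \<in> U" "u' \<in> wlat n" "vcong n N u u'"
  shows "u' \<in> U"
proof (rule U_I[OF assms(2)])
  have "mcong n N (transv n 1 u') (transv n 1 u)"
    using assms by (intro mcong_sym[OF transv_mcong]) auto
  then show "transv n 1 u' \<in> H"
    using assms by (intro closed[OF transv_Gamma U_transv])
qed

lemma U_zero:
  assumes "u \<in> wlat n" "vcong n N u (0\<^sub>v n)"
  shows "u \<in> U"
proof (rule U_cong[of "0\<^sub>v n"])
  have wlat: "0\<^sub>v n \<in> wlat n" unfolding wlat_def by simp
  have "0\<^sub>v n = 0 \<cdot>\<^sub>v (0\<^sub>v n :: int vec)" by (intro eq_vecI) auto
  then have "transv n 1 (0\<^sub>v n) = 1\<^sub>m n"
    using transv_smult[of "0\<^sub>v n" n 1 0] by simp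
  then show "0\<^sub>v n \<in> U" using wlat by (intro U_I) simp_all
qed (use assms vcong_sym in auto)

text \<open>For pairwise orthogonal vectors the maps \<open>q_u x = \<langle>x, u\<rangle> u\<close>
  compose to zero, so the product of the transvections \<open>1 + q_u\<close> just adds the
  \<open>q_u\<close>. As \<open>q\<close> is quadratic, its value at \<open>u + v + w\<close> is the
  sum of its values at the three pair sums minus those at \<open>u\<close>, \<open>v\<close>,
  \<open>w\<close>.\<close>

lemma U_sum3:
  assumes "u \<in> U" "v \<in> U" "w \<in> U" "u + v \<in> U" "u + w \<in> U" "v + w \<in> U"
    and orth: "alt_form n u v = 0" "alt_form n u w = 0" "alt_form n v w = 0"
  shows "u + v + w \<in> U"
proof -
  let ?T = "transv n 1" and ?S = "transv n (-1)"
  let ?P = "?T (u + v) * (?T (u + w) * (?T (v + w) * (?S u * (?S v * ?S w))))"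
  have uvw: "u + v + w \<in> wlat n" using assms by (simp add: wlat_add)
  have orth': "alt_form n v u = 0" "alt_form n w u = 0" "alt_form n w v = 0"
    using orth alt_form_swap[of n v u] alt_form_swap[of n w u] alt_form_swap[of n w v] by auto
  have P: "?P \<in> H" using assms by (intro H_mult U_transv) auto
  have "?P = ?T (u + v + w)"
  proof (rule Gamma_eqI)
    fix x :: "int vec" assume x: "x \<in> carrier_vec n"
    have dims: "dim_vec x = n" "dim_vec u = n" "dim_vec v = n" "dim_vec w = n"
      using x assms U_carrier by (meson carrier_vecD)+
    show "?P *\<^sub>v x = ?T (u + v + w) *\<^sub>v x"
      using x assms orth' uvw
      by (simp add: Gamma_act_mult[of _ n] transv_Gamma wlat_add transv_action)
        (intro eq_vecI, simp_all add: dims algebra_simps)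
  qed (use P uvw in \<open>auto simp: transv_Gamma\<close>)
  then show ?thesis using P uvw by (simp add: U_I)
qed

end

section \<open>Generation modulo a prime\<close>

lemma vec_supp_zero:
  fixes x :: "int vec"
  assumes "x \<in> wlat n" "0 < n" "\<forall>k<n. 0 < k \<longrightarrow> x $ k = 0"
  shows "x = 0\<^sub>v n"
proof -
  have "alt_vec n \<bullet> x = 0" using assms(1) unfolding wlat_def by blast
  then have "(\<Sum>k<n. (-1) ^ k * x $ k) = 0"
    using assms(1) by (simp add: alt_vec_scalar_prod)
  also have "(\<Sum>k<n. (-1) ^ k * x $ k) = (\<Sum>k<n. if k = 0 then x $ 0 else 0)"
    using assms by (intro sum.cong) auto
  finally have "x $ 0 = 0" using assms(2) by simp
  then have zero: "x $ k = 0" if "k < n" for k using assms(3) that by (cases k) auto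
  have "dim_vec x = n" by (rule carrier_vecD[OF wlat_carrier[OF assms(1)]])
  then show ?thesis using zero by (intro eq_vecI) simp_all
qed

text \<open>Step of the inductions on the support: a multiple of \<open>c_j\<close> clears the top
  coordinate. The last conclusion is the pairing that decides whether \<open>U_add\<close> can put
  the multiple back.\<close>

lemma wlat_reduce:
  assumes "x \<in> wlat n" "Suc j < n" "\<forall>k<n. Suc j < k \<longrightarrow> x $ k = 0"
  defines "y \<equiv> x - x $ Suc j \<cdot>\<^sub>v cvec n j"
  shows "y \<in> wlat n" "\<forall>k<n. j < k \<longrightarrow> y $ k = 0" "x = y + x $ Suc j \<cdot>\<^sub>v cvec n j"
    "alt_form n y (cvec n j) = x $ j - x $ Suc j"
proof -
  have x: "x \<in> carrier_vec n" using assms(1) by simp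
  show "y \<in> wlat n" using assms(1,2) unfolding y_def by (intro wlat_minus wlat_smult) auto
  have "y $ k = 0" if "k < n" "j < k" for k
    using that x assms(3) by (cases "k = Suc j") (auto simp: y_def)
  then show "\<forall>k<n. j < k \<longrightarrow> y $ k = 0" by blast
  show "x = y + x $ Suc j \<cdot>\<^sub>v cvec n j" using x by (auto simp: y_def)
  show "alt_form n y (cvec n j) = x $ j - x $ Suc j"
    using x assms(2) by (simp add: y_def alt_form_cvec)
qed

lemma wlat_induct:
  assumes "x \<in> wlat n" "0 < n" "P (0\<^sub>v n)"
    "\<And>x a i. x \<in> wlat n \<Longrightarrow> P x \<Longrightarrow> Suc i < n \<Longrightarrow> P (x + a \<cdot>\<^sub>v cvec n i)"
  shows "P x"
proof -
  have supp: "P x" if "j < n" "x \<in> wlat n" "\<forall>k<n. j < k \<longrightarrow> x $ k = 0" for x j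
    using that
  proof (induction j arbitrary: x)
    case 0
    have "x = 0\<^sub>v n" by (rule vec_supp_zero[OF 0(2,1,3)])
    show ?case unfolding \<open>x = 0\<^sub>v n\<close> by (rule assms(3))
  next
    case (Suc j)
    note red = wlat_reduce[OF Suc.prems(2,1,3)]
    let ?y = "x - x $ Suc j \<cdot>\<^sub>v cvec n j"
    have "P ?y" by (rule Suc.IH[OF Suc_lessD[OF Suc.prems(1)] red(1,2)])
    then have "P (?y + x $ Suc j \<cdot>\<^sub>v cvec n j)" by (rule assms(4)[OF red(1) _ Suc.prems(1)])
    then show ?case unfolding red(3)[symmetric] .
  qed
  show ?thesis by (rule supp[of "n - 1"]) (use assms(1,2) in auto)
qed

lemma alt_vec_fvec:
  assumes "q < n"
  shows "alt_vec n \<bullet> fvec n q = (if even q then 1 else 0)"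
proof -
  have "alt_vec n \<bullet> fvec n q = (\<Sum>k<n. if k \<le> q then (-1) ^ k else 0)"
    by (subst alt_vec_scalar_prod) (auto intro!: sum.cong)
  also have "\<dots> = (\<Sum>k\<le>q. (-1) ^ k)"
    using \<open>q < n\<close> by (intro sum.mono_neutral_cong_right) auto
  also have "\<dots> = (if even q then 1 else 0)" by (induction q) auto
  finally show ?thesis .
qed

lemma fvec_wlat: "odd q \<Longrightarrow> q < n \<Longrightarrow> fvec n q \<in> wlat n"
  unfolding wlat_def by (simp add: alt_vec_fvec)

lemma scalar_prod_vcong:
  assumes "vcong n N x y" "x \<in> carrier_vec n" "y \<in> carrier_vec n"
  shows "[w \<bullet> x = w \<bullet> y] (mod N)"
  using assms unfolding scalar_prod_def by (auto simp: vcong_def intro!: cong_sum cong_mult)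

text \<open>Here \<open>p\<close> may be 2. For \<open>n \<le> 3\<close> the last assumption is
  vacuous; for \<open>n \<ge> 4\<close> it is the one for which the braid image needs the exponent 2
  to be invertible modulo \<open>p\<close>.\<close>

locale cong_subgroup_prime = cong_subgroup n p H for n p H +
  assumes prime: "prime p"
    and cvec_U: "Suc i < n \<Longrightarrow> cvec n i \<in> U"
    and chain_U: "3 < n \<Longrightarrow> cvec n 0 + cvec n 2 \<in> U"
begin

lemma solve_mod:
  assumes "\<not> p dvd a"
  obtains t where "[t * a = b] (mod p)"
proof -
  have "coprime a p" using prime_imp_coprime[OF prime assms] by (simp add: ac_simps)
  then obtain s where "[a * s = 1] (mod p)" using cong_solve_coprime_int by blast
  then have "[b * (a * s) = b * 1] (mod p)" by (intro cong_mult cong_refl)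
  then have "[(b * s) * a = b] (mod p)" by (simp add: ac_simps)
  then show ?thesis using that by blast
qed

lemma abs_p [simp]: "\<bar>p\<bar> \<noteq> 1"
  using prime_gt_1_int[OF prime] by simp

text \<open>A power \<open>t\<close> of the transvection along \<open>w\<close> moves
  \<open>u\<close> to \<open>u + t \<langle>u, w\<rangle> w\<close>, and \<open>t\<close> can be
  solved for when the pairing is a unit modulo \<open>p\<close>.\<close>

lemma U_add:
  assumes "u \<in> U" "w \<in> U" "\<not> p dvd alt_form n u w"
  shows "u + b \<cdot>\<^sub>v w \<in> U"
proof -
  obtain t where t: "[t * alt_form n u w = b] (mod p)" using solve_mod assms(3) by blast
  have "transv n t w *\<^sub>v u \<in> U" using assms U_transv U_act by blast
  then have 1: "u + (t * alt_form n u w) \<cdot>\<^sub>v w \<in> U" using assms by (simp add: transv_action)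
  then show ?thesis
    by (rule U_cong) (use assms t in \<open>auto intro!: wlat_add wlat_smult vcong_add vcong_smult\<close>)
qed

text \<open>
  Induction on the support. A vector \<open>x\<close> supported on the first \<open>j + 2\<close> coordinates is handled by
  \<open>U_add\<close> unless it pairs trivially with \<open>c\<^sub>0, \<dots>, c\<^sub>j\<close> modulo \<open>p\<close>. In that case it is a multiple of
  \<open>c\<^sub>0 + c\<^sub>2 + \<dots> + c\<^sub>j\<close>, which is split into the three orthogonal parts \<open>c\<^sub>0\<close>, \<open>c\<^sub>2\<close>,
  \<open>c\<^sub>4 + \<dots> + c\<^sub>j\<close>; their pairwise sums are again handled by the other cases.
\<close>

lemma U_all:
  assumes "x \<in> wlat n" "0 < n"
  shows "x \<in> U"
proof -
  have supp: "x \<in> U" if "j < n" "x \<in> wlat n" "\<forall>k<n. j < k \<longrightarrow> x $ k = 0" for x j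
    using that
  proof (induction j arbitrary: x)
    case 0
    have "x = 0\<^sub>v n" by (rule vec_supp_zero[OF 0(2,1,3)])
    then have "vcong n p x (0\<^sub>v n)" by simp
    then show ?case by (rule U_zero[OF 0(2)])
  next
    case (Suc j)
    have jn: "Suc j < n" "j < n" using Suc.prems(1) by auto
    have top: "x \<in> U"
      if x: "x \<in> wlat n" "\<forall>k<n. Suc j < k \<longrightarrow> x $ k = 0"
        and nd: "\<not> p dvd x $ j - x $ Suc j" for x
    proof -
      note red = wlat_reduce[OF x(1) jn(1) x(2)]
      let ?y = "x - x $ Suc j \<cdot>\<^sub>v cvec n j"
      have "?y \<in> U" by (rule Suc.IH[OF jn(2) red(1,2)])
      moreover have "\<not> p dvd alt_form n ?y (cvec n j)" unfolding red(4) by (rule nd)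
      ultimately have "?y + x $ Suc j \<cdot>\<^sub>v cvec n j \<in> U" by (rule U_add[OF _ cvec_U[OF jn(1)]])
      then show ?thesis unfolding red(3)[symmetric] .
    qed
    have nonrad: "x \<in> U"
      if x: "x \<in> wlat n" "\<forall>k<n. Suc j < k \<longrightarrow> x $ k = 0"
        and i: "i \<le> j" "\<not> p dvd x $ i - x $ Suc i" for x i
    proof (cases "p dvd x $ j - x $ Suc j")
      case True
      then have ij: "i < j" using i by (cases "i = j") auto
      have xc: "x \<in> carrier_vec n" using x by simp
      \<comment> \<open>Detour through \<open>x + z\<close>: since \<open>z\<close> has entry 1 at
        \<open>j\<close> and 0 at \<open>j + 1\<close>, the sum has a nonzero top difference and
        falls under \<open>top\<close>. Then \<open>z\<close>, which is in \<open>U\<close> by its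
        smaller support and pairs nontrivially with \<open>x\<close>, is subtracted by
        \<open>U_add\<close>.\<close>
      obtain z where z: "z \<in> wlat n" "\<And>k. k < n \<Longrightarrow> j < k \<Longrightarrow> z $ k = 0" "z $ j = 1"
        "\<not> p dvd alt_form n x z"
      proof (cases "p dvd x $ (j - 1) - x $ j")
        case False
        then show ?thesis using ij jn
          by (intro that[of "cvec n (j - 1)"]) (auto simp: alt_form_cvec)
      next
        case True
        then have i': "Suc i < j" using i ij by (cases "Suc i = j") auto
        have "\<not> p dvd (x $ (j - 1) - x $ j) + (x $ i - x $ Suc i)"
          using True i(2) by (simp add: dvd_add_right_iff)
        then show ?thesis using i' jn
          by (intro that[of "cvec n (j - 1) + cvec n i"]) (auto simp: alt_form_cvec intro!: wlat_add)
      qed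
      have zU: "z \<in> U" using Suc.IH[of z] z jn by auto
      have zc: "z \<in> carrier_vec n" using z by simp
      have "\<not> p dvd (x $ j - x $ Suc j) + 1"
        using True by (simp add: dvd_add_right_iff)
      then have "\<not> p dvd (x + z) $ j - (x + z) $ Suc j"
        using z(2)[of "Suc j"] z(3) jn xc zc by (simp add: algebra_simps)
      then have "x + z \<in> U" using x z xc zc by (intro top) (auto intro!: wlat_add)
      then have "x + z + (-1) \<cdot>\<^sub>v z \<in> U" using zU z xc zc by (intro U_add) auto
      also have "x + z + (-1) \<cdot>\<^sub>v z = x" using xc zc by (intro eq_vecI) auto
      finally show ?thesis .
    qed (use top x in blast)
    have odd_fvec: "fvec n (Suc j) \<in> U" if "even j"
    proof -
      have f: "fvec n (Suc j) \<in> wlat n" using that jn by (intro fvec_wlat) auto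
      have "j = 0 \<or> j = 2 \<or> 4 \<le> j" using that by presburger
      then consider "j = 0" | "j = 2" | "4 \<le> j" by blast
      then show ?thesis
      proof cases
        case 1
        then have "fvec n (Suc j) = cvec n 0" by (intro eq_vecI) auto
        then show ?thesis using cvec_U jn 1 by simp
      next
        case 2
        then have "fvec n (Suc j) = cvec n 0 + cvec n 2" by (intro eq_vecI) auto
        then show ?thesis using chain_U jn 2 by simp
      next
        case 3
        let ?u = "cvec n 0" and ?v = "cvec n 2"
        define w where "w = fvec n (Suc j) - (?u + ?v)"
        have w: "w \<in> wlat n" unfolding w_def using f 3 jn by (intro wlat_minus wlat_add) auto
        then have wc: "w \<in> carrier_vec n" by simp
        have idx: "w $ k = (if 4 \<le> k \<and> k \<le> Suc j then 1 else 0)" if "k < n" for k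
          using that 3 by (auto simp: w_def)
        have n: "0 < n" "Suc 0 < n" "2 < n" "3 < n" "4 < n" using 3 jn by auto
        have "?u + ?v + w \<in> U"
        proof (rule U_sum3)
          \<comment> \<open>\<open>nonrad\<close> needs one jump between adjacent coordinates:
            \<open>w\<close> jumps from coordinate 3 to 4, the two sums with \<open>w\<close> from 1
            to 2.\<close>
          show "w \<in> U" using 3 n w by (intro nonrad[of _ 3]) (auto simp: idx)
          show "?u + w \<in> U" using 3 n w wc jn by (intro nonrad[of _ 1]) (auto simp: idx intro!: wlat_add)
          show "?v + w \<in> U" using 3 n w wc jn by (intro nonrad[of _ 1]) (auto simp: idx intro!: wlat_add)
          show "alt_form n ?u w = 0" "alt_form n ?v w = 0"
            using n idx by (simp_all add: alt_form_swap[of n _ w] alt_form_cvec)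
          show "alt_form n ?u ?v = 0" using n by (simp add: cvec_pair)
        qed (use n cvec_U chain_U in auto)
        also have "?u + ?v + w = fvec n (Suc j)" unfolding w_def by (intro eq_vecI) auto
        finally show ?thesis .
      qed
    qed
    show ?case
    proof (cases "\<exists>i\<le>j. \<not> p dvd x $ i - x $ Suc i")
      case True
      then show ?thesis using nonrad Suc.prems by blast
    next
      case False
      have const: "k \<le> Suc j \<Longrightarrow> [x $ k = x $ 0] (mod p)" for k
      proof (induction k)
        case (Suc k)
        then have "p dvd x $ k - x $ Suc k" using False by auto
        then have "[x $ Suc k = x $ k] (mod p)" by (simp add: cong_iff_dvd_diff dvd_diff_commute)
        then show ?case using Suc cong_trans by auto
      qed simp
      have vc: "vcong n p x (x $ 0 \<cdot>\<^sub>v fvec n (Suc j))"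
        unfolding vcong_def using const Suc.prems(3) by (auto simp: not_le)
      show ?thesis
      proof (cases "even j")
        case True
        show ?thesis
          by (rule U_cong[OF U_smult[OF odd_fvec[OF True]] Suc.prems(2) vcong_sym[OF vc]])
      next
        case False
        \<comment> \<open>For odd \<open>j\<close> the vector \<open>fvec n (Suc j)\<close> has
          alternating sum 1, so it lies outside the lattice and its coefficient must vanish modulo
          \<open>p\<close>.\<close>
        have "alt_vec n \<bullet> x = 0" using Suc.prems(2) unfolding wlat_def by blast
        with scalar_prod_vcong[OF vc, of "alt_vec n"] have "[0 = x $ 0] (mod p)"
          using Suc.prems jn False by (simp add: alt_vec_fvec)
        then have "vcong n p (x $ 0 \<cdot>\<^sub>v fvec n (Suc j)) (0\<^sub>v n)"
          by (auto simp: vcong_def cong_sym_eq)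
        then show ?thesis using U_zero[OF Suc.prems(2)] vcong_trans[OF vc] by blast
      qed
    qed
  qed
  show ?thesis by (rule supp[of "n - 1"]) (use assms in auto)
qed

text \<open>Take the transvection along \<open>x - z\<close> with exponent inverse to
  \<open>\<langle>x, z\<rangle>\<close>: it sends \<open>x\<close> to \<open>x - (x - z)\<close>. It
  fixes whatever is orthogonal to \<open>x - z\<close>.\<close>

lemma move:
  assumes "x \<in> wlat n" "z \<in> wlat n" "\<not> p dvd alt_form n x z"
  obtains B where "B \<in> H" "vcong n p (B *\<^sub>v x) z"
    "\<And>c. c \<in> carrier_vec n \<Longrightarrow> p dvd alt_form n c (x - z) \<Longrightarrow> vcong n p (B *\<^sub>v c) c"
proof -
  have c: "x \<in> carrier_vec n" "z \<in> carrier_vec n" using assms by auto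
  have "0 < n" using assms(3) by (cases "n = 0") (simp_all add: alt_form_def)
  obtain t where t: "[t * alt_form n x z = 1] (mod p)" using solve_mod assms(3) by blast
  have xz: "x - z \<in> U" using assms \<open>0 < n\<close> by (intro U_all wlat_minus)
  show thesis
  proof (rule that[of "transv n t (x - z)"])
    show "transv n t (x - z) \<in> H" using xz by (rule U_transv)
    have "[t * alt_form n x (x - z) = -1] (mod p)"
      using cong_minus_minus_iff[THEN iffD2, OF t] c by simp
    then have "vcong n p (x + (t * alt_form n x (x - z)) \<cdot>\<^sub>v (x - z)) (x + (-1) \<cdot>\<^sub>v (x - z))"
      using c by (intro vcong_add vcong_smult) auto
    moreover have "x + (-1) \<cdot>\<^sub>v (x - z) = z" using c by (intro eq_vecI) auto
    ultimately show "vcong n p (transv n t (x - z) *\<^sub>v x) z" using c by (simp add: transv_action)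
    fix v assume v: "v \<in> carrier_vec n" "p dvd alt_form n v (x - z)"
    then have "[t * alt_form n v (x - z) = 0] (mod p)" by (simp add: cong_0_iff)
    then have "vcong n p (v + (t * alt_form n v (x - z)) \<cdot>\<^sub>v (x - z)) (v + 0 \<cdot>\<^sub>v (x - z))"
      using c v by (intro vcong_add vcong_smult) auto
    moreover have "v + 0 \<cdot>\<^sub>v (x - z) = v" using c v by (intro eq_vecI) auto
    ultimately show "vcong n p (transv n t (x - z) *\<^sub>v v) v" using c v by (simp add: transv_action)
  qed
qed

lemma move_via:
  assumes x: "x \<in> wlat n" and y: "y \<in> wlat n" and s: "s \<in> wlat n"
    and nd: "\<not> p dvd alt_form n x s" "\<not> p dvd alt_form n y s"
  obtains B where "B \<in> H" "vcong n p (B *\<^sub>v x) y"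
    "\<And>c. c \<in> carrier_vec n \<Longrightarrow> [alt_form n c x = alt_form n c y] (mod p) \<Longrightarrow>
      p dvd alt_form n c s \<Longrightarrow> vcong n p (B *\<^sub>v c) c"
proof (cases "p dvd alt_form n x y")
  case False
  obtain B where "B \<in> H" "vcong n p (B *\<^sub>v x) y"
    "\<And>c. c \<in> carrier_vec n \<Longrightarrow> p dvd alt_form n c (x - y) \<Longrightarrow> vcong n p (B *\<^sub>v c) c"
    using move[OF x y False] by blast
  then show thesis using x y by (intro that[of B]) (auto simp: cong_iff_dvd_diff)
next
  case True
  have c: "x \<in> carrier_vec n" "y \<in> carrier_vec n" "s \<in> carrier_vec n" using x y s by auto
  let ?z = "y + s"
  have z: "?z \<in> wlat n" using y s by (rule wlat_add)
  have xz: "\<not> p dvd alt_form n x ?z" using True nd(1) c by (simp add: dvd_add_right_iff)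
  have zy: "\<not> p dvd alt_form n ?z y" using nd(2) c alt_form_swap[of n s y] by simp
  obtain B1 where B1: "B1 \<in> H" "vcong n p (B1 *\<^sub>v x) ?z"
    "\<And>c. c \<in> carrier_vec n \<Longrightarrow> p dvd alt_form n c (x - ?z) \<Longrightarrow> vcong n p (B1 *\<^sub>v c) c"
    using move[OF x z xz] by blast
  obtain B2 where B2: "B2 \<in> H" "vcong n p (B2 *\<^sub>v ?z) y"
    "\<And>c. c \<in> carrier_vec n \<Longrightarrow> p dvd alt_form n c (?z - y) \<Longrightarrow> vcong n p (B2 *\<^sub>v c) c"
    using move[OF z y zy] by blast
  have trans: "vcong n p ((B2 * B1) *\<^sub>v a) b'"
    if "a \<in> carrier_vec n" "b \<in> carrier_vec n" "vcong n p (B1 *\<^sub>v a) b" "vcong n p (B2 *\<^sub>v b) b'" for a b b'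
  proof -
    have "vcong n p (B2 *\<^sub>v (B1 *\<^sub>v a)) (B2 *\<^sub>v b)"
      by (rule mult_vec_vcong) (use that B1(1) B2(1) in \<open>auto intro: Gamma_act\<close>)
    with that show ?thesis using B1(1) B2(1) by (simp add: Gamma_act_mult[of _ n] vcong_trans)
  qed
  show thesis
  proof (rule that[of "B2 * B1"])
    show "B2 * B1 \<in> H" using B1 B2 H_mult by blast
    show "vcong n p ((B2 * B1) *\<^sub>v x) y" using trans[of x ?z y] B1 B2 c by simp
    fix v assume v: "v \<in> carrier_vec n" "[alt_form n v x = alt_form n v y] (mod p)" "p dvd alt_form n v s"
    have "alt_form n v (x - ?z) = (alt_form n v x - alt_form n v y) - alt_form n v s"
      using c v by simp
    then have "p dvd alt_form n v (x - ?z)" using v by (simp add: cong_iff_dvd_diff)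
    moreover have "p dvd alt_form n v (?z - y)" using v c by simp
    ultimately show "vcong n p ((B2 * B1) *\<^sub>v v) v" using trans[of v v v] B1 B2 v by blast
  qed
qed

text \<open>\<open>A c_j\<close> and \<open>c_j\<close> pair equally with the vectors
  \<open>c_i\<close>, \<open>i < j\<close>, already fixed, so \<open>move_via\<close> applies once
  there is an \<open>s\<close> orthogonal to those \<open>c_i\<close> and pairing nontrivially with
  both. Such an \<open>s\<close> is built from a vector \<open>r\<close> dual to \<open>c_j\<close>:
  the next \<open>c_{j+1}\<close>, or \<open>f_j\<close> for the last \<open>j\<close> if
  \<open>n\<close> is odd. For the last \<open>j\<close> and even \<open>n\<close> nothing has to be
  moved.\<close>

lemma fix_next:
  assumes A: "A \<in> carrier (Gamma n)" and j: "Suc j < n"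
    and fixed: "\<And>i. i < j \<Longrightarrow> vcong n p (A *\<^sub>v cvec n i) (cvec n i)"
  obtains B where "B \<in> H" "\<And>i. i \<le> j \<Longrightarrow> vcong n p ((B * A) *\<^sub>v cvec n i) (cvec n i)"
proof (cases "Suc (Suc j) < n \<or> odd n")
  case True
  obtain r where r: "r \<in> wlat n" "\<And>i. i < j \<Longrightarrow> alt_form n (cvec n i) r = 0"
    "\<not> p dvd alt_form n (cvec n j) r"
  proof (cases "Suc (Suc j) < n")
    case True
    then show thesis by (intro that[of "cvec n (Suc j)"]) (auto simp: cvec_pair)
  next
    case False
    then have n: "n = Suc (Suc j)" using j by simp
    then have "odd j" using True by simp
    have pair: "alt_form n (cvec n i) (fvec n j) = (if i = j then -1 else 0)" if "i \<le> j" for i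
      unfolding alt_form_swap[of n "cvec n i"] using that n by (auto simp: alt_form_cvec)
    show thesis
    proof (rule that[of "fvec n j"])
      show "fvec n j \<in> wlat n" using \<open>odd j\<close> n by (simp add: fvec_wlat)
    qed (simp_all add: pair)
  qed
  let ?x = "A *\<^sub>v cvec n j" and ?y = "cvec n j" and ?r = "A *\<^sub>v r"
  have rc: "r \<in> carrier_vec n" "?r \<in> wlat n" using r A by (auto intro: Gamma_wlat)
  then have rc': "?r \<in> carrier_vec n" by simp
  have x: "?x \<in> wlat n" "?x \<in> carrier_vec n" and y: "?y \<in> wlat n" using A j by (auto intro: Gamma_wlat Gamma_act)
  have pair: "[alt_form n (cvec n i) (A *\<^sub>v b) = alt_form n (cvec n i) b] (mod p)"
    if "i < j" "b \<in> carrier_vec n" for i b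
    using alt_form_vcong[OF fixed[OF that(1)] vcong_refl, of "A *\<^sub>v b"] Gamma_form[OF A cvec_carrier that(2)]
    by (simp add: cong_sym_eq)
  have r': "p dvd alt_form n (cvec n i) ?r" if "i < j" for i
    using pair[OF that rc(1)] r(2)[OF that] by (simp add: cong_0_iff)
  have xr: "\<not> p dvd alt_form n ?x ?r" using r(3) Gamma_form[OF A] rc by simp
  \<comment> \<open>\<open>r\<close> pairs nontrivially with \<open>c_j\<close>, and
    \<open>A r\<close> with \<open>A c_j\<close>. If neither serves for both vectors, the two cross
    pairings vanish modulo \<open>p\<close> and the sum \<open>r + A r\<close> does.\<close>
  obtain s where s: "s \<in> wlat n" "\<And>i. i < j \<Longrightarrow> p dvd alt_form n (cvec n i) s"
    "\<not> p dvd alt_form n ?x s" "\<not> p dvd alt_form n ?y s"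
  proof -
    consider "\<not> p dvd alt_form n ?x r" | "\<not> p dvd alt_form n ?y ?r"
      | "p dvd alt_form n ?x r" "p dvd alt_form n ?y ?r" by blast
    then show thesis
    proof cases
      case 1 then show thesis using r by (intro that[of r]) auto
    next
      case 2 then show thesis using xr r' rc by (intro that[of ?r]) auto
    next
      case 3
      then have "\<not> p dvd alt_form n ?x r + alt_form n ?x ?r" "\<not> p dvd alt_form n ?y r + alt_form n ?y ?r"
        using xr r(3) by (simp_all add: dvd_add_right_iff dvd_add_left_iff)
      then show thesis using r rc rc' r' by (intro that[of "r + ?r"]) (auto intro!: wlat_add)
    qed
  qed
  obtain B where B: "B \<in> H" "vcong n p (B *\<^sub>v ?x) ?y"
    "\<And>c. c \<in> carrier_vec n \<Longrightarrow> [alt_form n c ?x = alt_form n c ?y] (mod p) \<Longrightarrow>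
      p dvd alt_form n c s \<Longrightarrow> vcong n p (B *\<^sub>v c) c"
    using move_via[OF x(1) y s(1,3,4)] by blast
  show thesis
  proof (rule that[OF B(1)])
    fix i assume i: "i \<le> j"
    show "vcong n p ((B * A) *\<^sub>v cvec n i) (cvec n i)"
    proof (cases "i = j")
      case True
      then show ?thesis using B A by (simp add: Gamma_act_mult[of _ n])
    next
      case False
      then have "i < j" using i by simp
      then have "vcong n p (B *\<^sub>v (A *\<^sub>v cvec n i)) (B *\<^sub>v cvec n i)"
        using A B(1) fixed by (intro mult_vec_vcong) (auto intro: Gamma_act)
      also have "vcong n p \<dots> (cvec n i)"
        using \<open>i < j\<close> s(2) pair by (intro B(3)) auto
      finally show ?thesis using A B(1) by (simp add: Gamma_act_mult[of _ n])
    qed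
  qed
next
  case False
  then have nj: "n = Suc (Suc j)" using j by simp
  then have n: "n = Suc (Suc j)" "even j" using False by simp_all
  \<comment> \<open>For even \<open>n\<close> the vectors \<open>c_0, c_2, ..., c_{n-2}\<close> add
    up to \<open>v_n\<close>, which \<open>A\<close> fixes. Hence the last \<open>c_j\<close> is
    fixed along with the partial sums \<open>f_1, f_3, ...\<close> of the earlier ones.\<close>
  have f: "vcong n p (A *\<^sub>v fvec n (Suc (2 * m))) (fvec n (Suc (2 * m)))" if "2 * m < j" for m
    using that
  proof (induction m)
    case 0
    have "fvec n (Suc 0) = cvec n 0" by (intro eq_vecI) auto
    then show ?case using fixed[of 0] 0 by simp
  next
    case (Suc m)
    have e: "fvec n (Suc (2 * Suc m)) = fvec n (Suc (2 * m)) + cvec n (2 * Suc m)"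
      by (intro eq_vecI) auto
    show ?case
      unfolding e using Suc A fixed[of "2 * Suc m"]
      by (subst Gamma_act_add[OF A]) (auto intro!: vcong_add Gamma_act)
  qed
  have cj: "vcong n p (A *\<^sub>v cvec n j) (cvec n j)"
  proof (cases "j = 0")
    case True
    then have "cvec n j = ones_vec n" using n by (intro eq_vecI) auto
    then show ?thesis using A by (simp add: Gamma_ones)
  next
    case False
    obtain q where q: "j = 2 * q" using n(2) by (rule evenE)
    then obtain m where "q = Suc m" using False by (cases q) auto
    with q have m: "j = Suc (Suc (2 * m))" by simp
    let ?f = "fvec n (Suc (2 * m))"
    have e: "cvec n j = ones_vec n + (-1) \<cdot>\<^sub>v ?f" using n m by (intro eq_vecI) auto
    show ?thesis
      unfolding e using A f[of m] m
      by (subst Gamma_act_add[OF A])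
        (auto simp: Gamma_act_smult Gamma_ones intro!: vcong_add vcong_smult Gamma_act)
  qed
  show thesis
  proof (rule that[of "1\<^sub>m n"])
    fix i assume "i \<le> j"
    then show "vcong n p ((1\<^sub>m n * A) *\<^sub>v cvec n i) (cvec n i)"
      using cj fixed A by (cases "i = j") (auto simp: left_mult_one_mat[OF Gamma_carrier_mat])
  qed simp
qed

lemma fix_all:
  assumes "A \<in> carrier (Gamma n)" "j < n"
  shows "\<exists>B\<in>H. \<forall>i<j. vcong n p ((B * A) *\<^sub>v cvec n i) (cvec n i)"
  using assms(2)
proof (induction j)
  case (Suc j)
  then obtain B where B: "B \<in> H" "\<And>i. i < j \<Longrightarrow> vcong n p ((B * A) *\<^sub>v cvec n i) (cvec n i)"
    by auto
  have BA: "B * A \<in> carrier (Gamma n)" using B assms by simp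
  obtain C where C: "C \<in> H" "\<And>i. i \<le> j \<Longrightarrow> vcong n p ((C * (B * A)) *\<^sub>v cvec n i) (cvec n i)"
    using fix_next[OF BA Suc.prems B(2)] by blast
  have "C * (B * A) = (C * B) * A" using B C assms by (simp add: Gamma_assoc[of _ n])
  then show ?case using C B H_mult[OF C(1) B(1)] by (intro bexI[of _ "C * B"]) (auto simp: less_Suc_eq_le)
qed (auto intro: H_one)

text \<open>\<open>B\<close> fixes the lattice modulo \<open>p\<close>, so only
  \<open>y = B e_0 - e_0\<close> is left to determine. It pairs to zero with every
  \<open>c_i\<close>, hence is a multiple of \<open>v_n\<close>, and
  \<open>B x = x + y_0 (w_n^T x) v_n\<close> modulo \<open>p\<close>. For even \<open>n\<close> this
  is a transvection along \<open>v_n\<close>; for odd \<open>n\<close>, \<open>w_n^T y = 0\<close>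
  forces \<open>y_0 = 0\<close>.\<close>

lemma fixing_in_H:
  assumes B: "B \<in> carrier (Gamma n)" and n: "0 < n"
    and fixed: "\<And>i. Suc i < n \<Longrightarrow> vcong n p (B *\<^sub>v cvec n i) (cvec n i)"
  shows "B \<in> H"
proof -
  have L: "vcong n p (B *\<^sub>v x) x" if "x \<in> wlat n" for x
    using that n
  proof (rule wlat_induct)
    have "B *\<^sub>v 0\<^sub>v n = 0\<^sub>v n" using Gamma_carrier_mat[OF B] by (intro eq_vecI) auto
    then show "vcong n p (B *\<^sub>v 0\<^sub>v n) (0\<^sub>v n)" by simp
    fix x a i assume "x \<in> wlat n" "vcong n p (B *\<^sub>v x) x" "Suc i < n"
    then show "vcong n p (B *\<^sub>v (x + a \<cdot>\<^sub>v cvec n i)) (x + a \<cdot>\<^sub>v cvec n i)"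
      using B fixed by (simp add: Gamma_act_add[of _ n] Gamma_act_smult[of _ n])
        (auto intro!: vcong_add vcong_smult)
  qed
  define e where "e = fvec n 0"
  have e: "e \<in> carrier_vec n" "alt_vec n \<bullet> e = 1" using n by (simp_all add: e_def alt_vec_fvec)
  define y where "y = B *\<^sub>v e - e"
  have y: "y \<in> wlat n" unfolding wlat_def y_def
    using B e scalar_prod_minus_distrib[of "alt_vec n" n "B *\<^sub>v e" e] by (simp add: Gamma_act Gamma_alt)
  then have yc: "y \<in> carrier_vec n" by simp
  have step: "[y $ Suc i = y $ i] (mod p)" if "Suc i < n" for i
  proof -
    have "[alt_form n (B *\<^sub>v e) (B *\<^sub>v cvec n i) = alt_form n (B *\<^sub>v e) (cvec n i)] (mod p)"
      using fixed[OF that] by (intro alt_form_vcong) auto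
    then have "[alt_form n e (cvec n i) = alt_form n (B *\<^sub>v e) (cvec n i)] (mod p)"
      using B e by (simp add: Gamma_form)
    then have "[alt_form n y (cvec n i) = 0] (mod p)"
      unfolding y_def using B e by (simp add: Gamma_act cong_iff_dvd_diff dvd_diff_commute)
    then show ?thesis using that by (simp add: alt_form_cvec cong_iff_dvd_diff dvd_diff_commute)
  qed
  have "k < n \<Longrightarrow> [y $ k = y $ 0] (mod p)" for k
  proof (induction k)
    case (Suc k)
    then show ?case using cong_trans[OF step[of k]] by simp
  qed simp
  then have y0: "vcong n p y (y $ 0 \<cdot>\<^sub>v ones_vec n)" by (simp add: vcong_def)
  have action: "vcong n p (B *\<^sub>v x) (x + (y $ 0 * (alt_vec n \<bullet> x)) \<cdot>\<^sub>v ones_vec n)" if x: "x \<in> carrier_vec n" for x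
  proof -
    let ?a = "alt_vec n \<bullet> x"
    let ?l = "x - ?a \<cdot>\<^sub>v e"
    have l: "?l \<in> wlat n" unfolding wlat_def
      using x e scalar_prod_minus_distrib[of "alt_vec n" n x "?a \<cdot>\<^sub>v e"] by simp
    have "x = ?l + ?a \<cdot>\<^sub>v e" using x e by (intro eq_vecI) auto
    then have "B *\<^sub>v x = B *\<^sub>v ?l + ?a \<cdot>\<^sub>v (B *\<^sub>v e)"
      using B x e l Gamma_act_add[OF B, of ?l "?a \<cdot>\<^sub>v e"] by (simp add: Gamma_act_smult[of _ n])
    also have "B *\<^sub>v e = e + y" unfolding y_def using B e by (intro eq_vecI) (auto simp: Gamma_act)
    finally have "B *\<^sub>v x = B *\<^sub>v ?l + ?a \<cdot>\<^sub>v (e + y)" .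
    moreover have "vcong n p (B *\<^sub>v ?l + ?a \<cdot>\<^sub>v (e + y)) (?l + ?a \<cdot>\<^sub>v (e + y $ 0 \<cdot>\<^sub>v ones_vec n))"
      using e yc x y0 L[OF l] by (intro vcong_add vcong_smult) auto
    moreover have "?l + ?a \<cdot>\<^sub>v (e + y $ 0 \<cdot>\<^sub>v ones_vec n) = x + (y $ 0 * ?a) \<cdot>\<^sub>v ones_vec n"
      using e x by (intro eq_vecI) (auto simp: algebra_simps)
    ultimately show ?thesis by simp
  qed
  have ones: "ones_vec n = fvec n (n - 1)" by (intro eq_vecI) auto
  show ?thesis
  proof (cases "even n")
    case True
    have wl: "ones_vec n \<in> wlat n" unfolding ones using n True by (intro fvec_wlat) auto
    have "transv n (y $ 0) (ones_vec n) \<in> H" using wl n by (intro U_transv U_all)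
    moreover have "mcong n p B (transv n (y $ 0) (ones_vec n))"
      using action True by (simp add: mcong_def transv_action alt_form_ones)
    ultimately show ?thesis using closed[OF B] by blast
  next
    case False
    have "alt_vec n \<bullet> y = 0" using y unfolding wlat_def by blast
    with scalar_prod_vcong[OF y0, of "alt_vec n"] have "[0 = y $ 0] (mod p)"
      using yc n False by (simp add: ones alt_vec_fvec)
    then have y00: "[y $ 0 * (alt_vec n \<bullet> x) = 0] (mod p)" for x
      by (simp add: cong_sym_eq[of 0] cong_0_iff)
    have "mcong n p B (1\<^sub>m n)"
      unfolding mcong_def
    proof
      fix x :: "int vec" assume x: "x \<in> carrier_vec n"
      have "vcong n p (x + (y $ 0 * (alt_vec n \<bullet> x)) \<cdot>\<^sub>v ones_vec n) (x + 0 \<cdot>\<^sub>v ones_vec n)"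
        using y00 by (intro vcong_add vcong_smult) auto
      moreover have "x + 0 \<cdot>\<^sub>v ones_vec n = 1\<^sub>m n *\<^sub>v x" using x by (intro eq_vecI) auto
      ultimately show "vcong n p (B *\<^sub>v x) (1\<^sub>m n *\<^sub>v x)" using vcong_trans[OF action[OF x]] by metis
    qed
    then show ?thesis using closed[OF B H_one] by blast
  qed
qed

lemma Gamma_subset_H:
  assumes "0 < n"
  shows "carrier (Gamma n) \<subseteq> H"
proof
  fix A assume A: "A \<in> carrier (Gamma n)"
  obtain B where B: "B \<in> H" "\<forall>i<n - 1. vcong n p ((B * A) *\<^sub>v cvec n i) (cvec n i)"
    using fix_all[OF A, of "n - 1"] assms by auto
  have "B * A \<in> H" using A B assms by (intro fixing_in_H) auto
  then show "A \<in> H" using H_cancel_left B A by blast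
qed

end

section \<open>Lifting to prime powers\<close>

lemma fvec_induct:
  assumes "x \<in> carrier_vec n" "P (0\<^sub>v n)"
    "\<And>x a i. x \<in> carrier_vec n \<Longrightarrow> P x \<Longrightarrow> i < n \<Longrightarrow> P (x + a \<cdot>\<^sub>v fvec n i)"
  shows "P x"
proof -
  have supp: "P x" if "j \<le> n" "x \<in> carrier_vec n" "\<forall>k<n. j \<le> k \<longrightarrow> x $ k = 0" for x j
    using that
  proof (induction j arbitrary: x)
    case 0
    then have "x = 0\<^sub>v n" by (intro eq_vecI) auto
    show ?case unfolding \<open>x = 0\<^sub>v n\<close> by (rule assms(2))
  next
    case (Suc j)
    let ?y = "x - x $ j \<cdot>\<^sub>v fvec n j"
    have y: "?y \<in> carrier_vec n" using Suc.prems(2) by simp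
    have "?y $ k = 0" if "k < n" "j \<le> k" for k
      using that Suc.prems by (cases "k = j") auto
    then have "\<forall>k<n. j \<le> k \<longrightarrow> ?y $ k = 0" by blast
    then have "P ?y" by (rule Suc.IH[OF Suc_leD[OF Suc.prems(1)] y])
    then have "P (?y + x $ j \<cdot>\<^sub>v fvec n j)"
      by (rule assms(3)[OF y _ Suc_le_lessD[OF Suc.prems(1)]])
    moreover have "?y + x $ j \<cdot>\<^sub>v fvec n j = x" using Suc.prems(2) by (intro eq_vecI) auto
    ultimately show ?case by (simp only:)
  qed
  show ?thesis by (rule supp[of n]) (use assms(1) in auto)
qed

lemma alt_form_fvec_cvec:
  assumes "Suc j < n" "i < n"
  shows "alt_form n (fvec n i) (cvec n j) = (if i = j then 1 else 0)"
    "alt_form n (cvec n j) (fvec n i) = (if i = j then -1 else 0)"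
  unfolding alt_form_swap[of n "cvec n j"] using assms by (auto simp: alt_form_cvec)

text \<open>The vectors \<open>fvec n j\<close> are dual to the basis \<open>cvec n j\<close> of the lattice \<open>wlat n\<close>.\<close>

lemma wlat_expand:
  assumes "y \<in> wlat n" "r < n"
  shows "y $ r = (\<Sum>j<n - 1. alt_form n (fvec n j) y * cvec n j $ r)"
proof -
  have "\<forall>r<n. y $ r = (\<Sum>j<n - 1. alt_form n (fvec n j) y * cvec n j $ r)"
    using assms(1)
  proof (rule wlat_induct)
    show "\<forall>r<n. 0\<^sub>v n $ r = (\<Sum>j<n - 1. alt_form n (fvec n j) (0\<^sub>v n) * cvec n j $ r)"
      by (simp add: alt_form_def)
    fix x a i
    assume x: "x \<in> wlat n" "\<forall>r<n. x $ r = (\<Sum>j<n - 1. alt_form n (fvec n j) x * cvec n j $ r)"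
      and i: "Suc i < n"
    show "\<forall>r<n. (x + a \<cdot>\<^sub>v cvec n i) $ r =
        (\<Sum>j<n - 1. alt_form n (fvec n j) (x + a \<cdot>\<^sub>v cvec n i) * cvec n j $ r)"
    proof (intro allI impI)
      fix r assume r: "r < n"
      have "(\<Sum>j<n - 1. alt_form n (fvec n j) (cvec n i) * cvec n j $ r)
          = (\<Sum>j<n - 1. if j = i then cvec n i $ r else 0)"
        using i by (intro sum.cong) (auto simp: alt_form_fvec_cvec)
      also have "\<dots> = cvec n i $ r" using i by simp
      finally have c: "(\<Sum>j<n - 1. alt_form n (fvec n j) (cvec n i) * cvec n j $ r) = cvec n i $ r" .
      have xc: "x \<in> carrier_vec n" using x by simp
      have "(\<Sum>j<n - 1. alt_form n (fvec n j) (x + a \<cdot>\<^sub>v cvec n i) * cvec n j $ r) =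
        (\<Sum>j<n - 1. alt_form n (fvec n j) x * cvec n j $ r) +
        a * (\<Sum>j<n - 1. alt_form n (fvec n j) (cvec n i) * cvec n j $ r)"
        unfolding sum_distrib_left sum.distrib[symmetric] using xc
        by (intro sum.cong HOL.refl) (simp add: algebra_simps del: index_special_vec)
      then show "(x + a \<cdot>\<^sub>v cvec n i) $ r =
        (\<Sum>j<n - 1. alt_form n (fvec n j) (x + a \<cdot>\<^sub>v cvec n i) * cvec n j $ r)"
        unfolding c using x(2) r xc by (simp del: index_special_vec)
    qed
  qed (use assms(2) in auto)
  then show ?thesis using assms(2) by blast
qed

text \<open>Coordinate \<open>r\<close> of \<open>X x\<close>, where \<open>X\<close> sends
  \<open>x\<close> to the sum of \<open>a i j \<langle>x, c_i\<rangle> c_j\<close>. By duality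
  \<open>X f_i\<close> is the combination of the \<open>c_j\<close> with coefficients
  \<open>a i j\<close>, and \<open>X\<close> kills \<open>v_n\<close>.\<close>

definition bilin_act :: "nat \<Rightarrow> (nat \<Rightarrow> nat \<Rightarrow> int) \<Rightarrow> int vec \<Rightarrow> nat \<Rightarrow> int" where
  "bilin_act n a x r = (\<Sum>i<n - 1. \<Sum>j<n - 1. a i j * alt_form n x (cvec n i) * cvec n j $ r)"

lemma bilin_act_add: "bilin_act n (\<lambda>i j. a i j + b i j) x r = bilin_act n a x r + bilin_act n b x r"
  by (simp add: bilin_act_def algebra_simps sum.distrib del: index_special_vec)

lemma bilin_act_cong:
  assumes "\<And>i j. Suc i < n \<Longrightarrow> Suc j < n \<Longrightarrow> [a i j = b i j] (mod N)" "vcong n N x y"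
  shows "[bilin_act n a x r = bilin_act n b y r] (mod N)"
  unfolding bilin_act_def
  by (intro cong_sum cong_mult cong_refl alt_form_vcong assms) auto

text \<open>Since \<open>p\<close> divides \<open>N\<close>, the product of \<open>1 + N X\<close>
  and \<open>1 + N Y\<close> is \<open>1 + N (X + Y)\<close> modulo \<open>N p\<close>:
  multiplication becomes addition of coefficients modulo \<open>p\<close>.\<close>

locale cong_subgroup_power = cong_subgroup n "N * p" H for n N p H +
  assumes N_nonzero: "N \<noteq> 0" and p_dvd: "p dvd N"
    and cvec_pow: "Suc i < n \<Longrightarrow> transv n N (cvec n i) \<in> H"
    and pair_pow: "i < j \<Longrightarrow> Suc j < n \<Longrightarrow> transv n N (cvec n i + cvec n j) \<in> H"
begin

text \<open>The coefficient arrays realized by \<open>H\<close>. By \<open>M_cong\<close> only the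
  entries with both indices below \<open>n - 1\<close> matter, and these only modulo
  \<open>p\<close>.\<close>

definition M :: "(nat \<Rightarrow> nat \<Rightarrow> int) set" where
  "M = {a. \<exists>B\<in>H. \<forall>x\<in>carrier_vec n. \<forall>r<n.
    [(B *\<^sub>v x) $ r = x $ r + N * bilin_act n a x r] (mod (N * p))}"

lemma M_cong:
  assumes "a \<in> M" "\<And>i j. Suc i < n \<Longrightarrow> Suc j < n \<Longrightarrow> [a i j = b i j] (mod p)"
  shows "b \<in> M"
proof -
  have "[x $ r + N * bilin_act n a x r = x $ r + N * bilin_act n b x r] (mod (N * p))" for x r
  proof -
    have "[bilin_act n a x r = bilin_act n b x r] (mod p)"
      by (rule bilin_act_cong[OF assms(2) vcong_refl])
    then have "N * p dvd N * (bilin_act n a x r - bilin_act n b x r)"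
      by (simp add: cong_iff_dvd_diff)
    then show ?thesis by (simp add: cong_iff_dvd_diff right_diff_distrib)
  qed
  then show ?thesis using assms(1) unfolding M_def by (blast intro: cong_trans)
qed

text \<open>\<open>B x\<close> differs from \<open>x\<close> by a multiple of \<open>N\<close>, so
  replacing one by the other inside the term \<open>N * bilin_act n a\<close> costs a multiple of
  \<open>N * N\<close>, which \<open>N * p\<close> divides.\<close>

lemma M_add:
  assumes "a \<in> M" "b \<in> M"
  shows "(\<lambda>i j. a i j + b i j) \<in> M"
proof -
  obtain A where A: "A \<in> H"
    "\<And>x r. x \<in> carrier_vec n \<Longrightarrow> r < n \<Longrightarrow> [(A *\<^sub>v x) $ r = x $ r + N * bilin_act n a x r] (mod (N * p))"
    using assms(1) unfolding M_def by blast
  obtain B where B: "B \<in> H"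
    "\<And>x r. x \<in> carrier_vec n \<Longrightarrow> r < n \<Longrightarrow> [(B *\<^sub>v x) $ r = x $ r + N * bilin_act n b x r] (mod (N * p))"
    using assms(2) unfolding M_def by blast
  have "[((A * B) *\<^sub>v x) $ r = x $ r + N * bilin_act n (\<lambda>i j. a i j + b i j) x r] (mod (N * p))"
    if x: "x \<in> carrier_vec n" and r: "r < n" for x r
  proof -
    let ?w = "B *\<^sub>v x"
    have w: "?w \<in> carrier_vec n" by (rule Gamma_act[OF H_Gamma[OF B(1)] x])
    have "vcong n N ?w x"
      unfolding vcong_def
    proof (intro allI impI)
      fix i assume "i < n"
      have "[?w $ i = x $ i + N * bilin_act n b x i] (mod N)"
        by (rule cong_dvd_modulus[OF B(2)[OF x \<open>i < n\<close>]]) simp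
      also have "[x $ i + N * bilin_act n b x i = x $ i] (mod N)"
        by (simp add: cong_iff_dvd_diff)
      finally show "[?w $ i = x $ i] (mod N)" .
    qed
    then have "[bilin_act n a ?w r = bilin_act n a x r] (mod N)"
      by (intro bilin_act_cong) auto
    then have NN: "N * N dvd N * bilin_act n a ?w r - N * bilin_act n a x r"
      by (simp add: cong_iff_dvd_diff right_diff_distrib[symmetric])
    have "N * p dvd N * N" using p_dvd by simp
    then have 1: "[N * bilin_act n a ?w r = N * bilin_act n a x r] (mod (N * p))"
      unfolding cong_iff_dvd_diff by (rule dvd_trans[OF _ NN])
    have "[((A * B) *\<^sub>v x) $ r = ?w $ r + N * bilin_act n a ?w r] (mod (N * p))"
      using A(2)[OF w r] A(1) B(1) x by (simp add: Gamma_act_mult[of _ n])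
    also have "[?w $ r + N * bilin_act n a ?w r = (x $ r + N * bilin_act n b x r) + N * bilin_act n a x r] (mod (N * p))"
      by (intro cong_add B(2)[OF x r] 1)
    finally show ?thesis by (simp add: bilin_act_add algebra_simps)
  qed
  then show ?thesis unfolding M_def using H_mult[OF A(1) B(1)] by blast
qed

text \<open>Duality gives \<open>u\<close> as the sum of
  \<open>\<langle>f_i, u\<rangle> c_i\<close>, so \<open>\<langle>x, u\<rangle> u\<close> has the
  rank one array of products of these coefficients.\<close>

lemma M_transv:
  assumes u: "u \<in> wlat n" "transv n N u \<in> H"
  shows "(\<lambda>i j. t * alt_form n (fvec n i) u * alt_form n (fvec n j) u) \<in> M"
proof -
  have uc: "u \<in> carrier_vec n" using u by simp
  have act: "(transv n (t * N) u *\<^sub>v x) $ r =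
      x $ r + N * bilin_act n (\<lambda>i j. t * alt_form n (fvec n i) u * alt_form n (fvec n j) u) x r"
    if x: "x \<in> carrier_vec n" and r: "r < n" for x r
  proof -
    have xu: "alt_form n x u = (\<Sum>i<n - 1. alt_form n (fvec n i) u * alt_form n x (cvec n i))"
      using x
    proof (rule fvec_induct)
      fix x a l assume x: "x \<in> carrier_vec n" and l: "l < n"
        and eq: "alt_form n x u = (\<Sum>i<n - 1. alt_form n (fvec n i) u * alt_form n x (cvec n i))"
      have "alt_form n (fvec n l) u =
        (\<Sum>i<n - 1. alt_form n (fvec n i) u * alt_form n (fvec n l) (cvec n i))"
      proof (cases "l < n - 1")
        case True
        have "(\<Sum>i<n - 1. alt_form n (fvec n i) u * alt_form n (fvec n l) (cvec n i)) =
          (\<Sum>i<n - 1. if i = l then alt_form n (fvec n l) u else 0)"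
          using l by (intro sum.cong) (auto simp: alt_form_fvec_cvec)
        then show ?thesis using True by simp
      next
        case False
        \<comment> \<open>The index \<open>n - 1\<close> has no \<open>c_l\<close> dual to it; there
          both sides vanish because \<open>v_n\<close> is orthogonal to the lattice.\<close>
        then have "l = n - 1" using l by simp
        then have f: "fvec n l = ones_vec n" by (intro eq_vecI) auto
        have "alt_vec n \<bullet> u = 0" using u(1) unfolding wlat_def by blast
        then have "alt_form n (ones_vec n) u = 0"
          using uc by (simp add: alt_form_swap[of n "ones_vec n"] alt_form_ones)
        then show ?thesis unfolding f by (simp add: alt_form_cvec)
      qed
      then show "alt_form n (x + a \<cdot>\<^sub>v fvec n l) u =
        (\<Sum>i<n - 1. alt_form n (fvec n i) u * alt_form n (x + a \<cdot>\<^sub>v fvec n l) (cvec n i))"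
        using x eq by (simp add: algebra_simps sum.distrib sum_distrib_left)
    qed (simp add: alt_form_def)
    have "bilin_act n (\<lambda>i j. t * alt_form n (fvec n i) u * alt_form n (fvec n j) u) x r =
        t * alt_form n x u * u $ r"
      unfolding bilin_act_def xu wlat_expand[OF u(1) r]
      by (simp add: sum_distrib_left sum_distrib_right ac_simps del: index_special_vec)
    then show ?thesis using x r uc by (simp add: transv_action algebra_simps)
  qed
  show ?thesis
    unfolding M_def mem_Collect_eq
    by (intro bexI[of _ "transv n (t * N) u"] ballI allI impI transv_pow[OF u]) (simp only: act cong_refl)
qed

lemma M_diag:
  assumes "Suc k < n"
  shows "(\<lambda>i j. if i = k \<and> j = k then t else 0) \<in> M"
  by (rule M_cong[OF M_transv[OF cvec_wlat[OF assms] cvec_pow[OF assms], of t]])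
    (use assms in \<open>auto simp: alt_form_fvec_cvec\<close>)

text \<open>Polarization: remove the diagonal contributions of \<open>c_k\<close> and
  \<open>c_l\<close> from the array of \<open>c_k + c_l\<close>.\<close>

lemma M_offdiag:
  assumes "k < l" "Suc l < n"
  shows "(\<lambda>i j. if (i = k \<and> j = l) \<or> (i = l \<and> j = k) then t else 0) \<in> M"
proof -
  have "cvec n k + cvec n l \<in> wlat n" using assms by (intro wlat_add) auto
  from M_add[OF M_add[OF M_transv[OF this pair_pow[OF assms], of t] M_diag[of k "-t"]] M_diag[of l "-t"]]
  show ?thesis
    by (rule M_cong) (use assms in \<open>auto simp: alt_form_fvec_cvec\<close>)
qed

lemma M_symmetric:
  assumes "finite S" "\<And>k l. (k, l) \<in> S \<Longrightarrow> k \<le> l \<and> Suc l < n"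
  shows "(\<lambda>i j. if (min i j, max i j) \<in> S then a (min i j) (max i j) else 0) \<in> M"
  using assms
proof (induction S)
  case empty
  have "1\<^sub>m n \<in> H" by simp
  then show ?case unfolding M_def by (auto simp: bilin_act_def intro!: bexI[of _ "1\<^sub>m n"])
next
  case (insert s S)
  obtain k l where s: "s = (k, l)" by (cases s)
  then have kl: "k \<le> l" "Suc l < n" using insert by auto
  have "(\<lambda>i j. if (min i j, max i j) = (k, l) then a k l else 0) \<in> M"
  proof (cases "k = l")
    case True
    then show ?thesis using kl by (intro M_cong[OF M_diag[of k "a k l"]]) (auto simp: min_def max_def)
  next
    case False
    then show ?thesis using kl
      by (intro M_cong[OF M_offdiag[of k l "a k l"]]) (auto simp: min_def max_def)
  qed
  from M_add[OF this insert.IH] show ?case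
    by (rule M_cong) (use insert s in auto)
qed

text \<open>Write \<open>A = 1 + N X\<close> and \<open>y i = X f_i\<close>. Invariance of
  \<open>w_n^T\<close> puts \<open>y i\<close> into the lattice, invariance of \<open>v_n\<close>
  makes \<open>X\<close> kill it, and invariance of the form makes the array \<open>a\<close>
  symmetric modulo \<open>p\<close>; such arrays are in \<open>M\<close>.\<close>

lemma level_subset_H:
  assumes A: "A \<in> carrier (Gamma n)" "mcong n N A (1\<^sub>m n)"
  shows "A \<in> H"
proof -
  \<comment> \<open>The division is exact, because \<open>A\<close> is the identity modulo
    \<open>N\<close>.\<close>
  define y where "y i = vec n (\<lambda>k. (A *\<^sub>v fvec n i - fvec n i) $ k div N)" for i
  have yc: "y i \<in> carrier_vec n" for i by (simp add: y_def)
  have [simp]: "dim_vec (y i) = n" for i by (simp add: y_def)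
  have Af: "A *\<^sub>v fvec n i = fvec n i + N \<cdot>\<^sub>v y i" for i
  proof -
    have "N dvd (A *\<^sub>v fvec n i - fvec n i) $ k" if "k < n" for k
      using A(2)[unfolded mcong_def vcong_def, rule_format, OF fvec_carrier that] that
      by (simp add: cong_iff_dvd_diff one_mult_mat_vec[OF fvec_carrier] del: index_special_vec)
    then show ?thesis using Gamma_act[OF A(1), of "fvec n i"] Gamma_carrier_mat[OF A(1)] unfolding y_def
      by (intro eq_vecI) (simp_all del: index_special_vec)
  qed
  have alt: "alt_vec n \<bullet> (N \<cdot>\<^sub>v y i) = 0" for i
  proof -
    have "alt_vec n \<bullet> (fvec n i + N \<cdot>\<^sub>v y i) = alt_vec n \<bullet> fvec n i"
      unfolding Af[symmetric] by (intro Gamma_alt[OF A(1)]) simp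
    then show ?thesis using scalar_prod_add_distrib[of "alt_vec n" n "fvec n i" "N \<cdot>\<^sub>v y i"] yc by simp
  qed
  have y: "y i \<in> wlat n" for i
    unfolding wlat_def using alt[of i] yc N_nonzero by simp
  define a where "a i j = alt_form n (fvec n j) (y i)" for i j
  have sym: "[a i j = a j i] (mod p)" for i j
  proof -
    have "alt_form n (fvec n i + N \<cdot>\<^sub>v y i) (fvec n j + N \<cdot>\<^sub>v y j) = alt_form n (fvec n i) (fvec n j)"
      unfolding Af[symmetric] by (intro Gamma_form[OF A(1)]) auto
    \<comment> \<open>The first order terms of the invariance of the form give the antisymmetric
      part of \<open>a\<close>; the second order term survives as a multiple of \<open>N\<close>,
      hence of \<open>p\<close>.\<close>
    then have "N * (alt_form n (fvec n i) (y j) - alt_form n (fvec n j) (y i) + N * alt_form n (y i) (y j)) = 0"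
      using yc alt_form_swap[of n "y i" "fvec n j"] by (simp add: algebra_simps)
    then have "a i j - a j i = N * alt_form n (y i) (y j)" using N_nonzero by (simp add: a_def)
    then show ?thesis using p_dvd by (simp add: cong_iff_dvd_diff)
  qed
  have act: "\<forall>r<n. (A *\<^sub>v x) $ r = x $ r + N * bilin_act n a x r" if "x \<in> carrier_vec n" for x
    using that
  proof (rule fvec_induct)
    have "A *\<^sub>v 0\<^sub>v n = 0\<^sub>v n" using Gamma_carrier_mat[OF A(1)] by (intro eq_vecI) auto
    then show "\<forall>r<n. (A *\<^sub>v 0\<^sub>v n) $ r = 0\<^sub>v n $ r + N * bilin_act n a (0\<^sub>v n) r"
      by (simp add: bilin_act_def alt_form_def)
    fix x t l assume x: "x \<in> carrier_vec n" and l: "l < n"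
      and eq: "\<forall>r<n. (A *\<^sub>v x) $ r = x $ r + N * bilin_act n a x r"
    show "\<forall>r<n. (A *\<^sub>v (x + t \<cdot>\<^sub>v fvec n l)) $ r =
        (x + t \<cdot>\<^sub>v fvec n l) $ r + N * bilin_act n a (x + t \<cdot>\<^sub>v fvec n l) r"
    proof (intro allI impI)
      fix r assume r: "r < n"
      have lin: "bilin_act n a (x + t \<cdot>\<^sub>v fvec n l) r = bilin_act n a x r + t * bilin_act n a (fvec n l) r"
        unfolding bilin_act_def using x
        by (simp add: algebra_simps sum.distrib sum_distrib_left del: index_special_vec)
      have "y l $ r = bilin_act n a (fvec n l) r"
      proof (cases "l < n - 1")
        case True
        have "bilin_act n a (fvec n l) r =
          (\<Sum>i<n - 1. if i = l then \<Sum>j<n - 1. a l j * cvec n j $ r else 0)"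
          unfolding bilin_act_def using l
          by (intro sum.cong) (auto simp: alt_form_fvec_cvec simp del: index_special_vec)
        then show ?thesis using True wlat_expand[OF y r, of l] by (simp add: a_def del: index_special_vec)
      next
        case False
        then have "l = n - 1" using l by simp
        then have f: "fvec n l = ones_vec n" by (intro eq_vecI) auto
        have "fvec n l + N \<cdot>\<^sub>v y l = fvec n l"
          using Gamma_ones[OF A(1)] unfolding f[symmetric] Af .
        then have "(fvec n l + N \<cdot>\<^sub>v y l) $ r = fvec n l $ r" by simp
        then have "y l $ r = 0" using r yc[of l] N_nonzero by (simp add: y_def)
        then show ?thesis unfolding f bilin_act_def by (simp add: alt_form_cvec)
      qed
      then have "(A *\<^sub>v fvec n l) $ r = fvec n l $ r + N * bilin_act n a (fvec n l) r"
        unfolding Af using r yc[of l] by (simp del: index_special_vec)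
      then show "(A *\<^sub>v (x + t \<cdot>\<^sub>v fvec n l)) $ r =
          (x + t \<cdot>\<^sub>v fvec n l) $ r + N * bilin_act n a (x + t \<cdot>\<^sub>v fvec n l) r"
        using eq r x unfolding lin
        by (simp add: carrier_matD[OF Gamma_carrier_mat[OF A(1)]] Gamma_act_add[OF A(1)] Gamma_act_smult[OF A(1)] algebra_simps del: index_special_vec)
    qed
  qed
  let ?S = "{(k, l). k \<le> l \<and> Suc l < n}"
  have "finite ?S" by (rule finite_subset[of _ "{..<n} \<times> {..<n}"]) auto
  then have "(\<lambda>i j. if (min i j, max i j) \<in> ?S then a (min i j) (max i j) else 0) \<in> M"
    by (rule M_symmetric) auto
  then have "a \<in> M"
    by (rule M_cong) (use sym in \<open>auto simp: min_def max_def\<close>)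
  then obtain B where B: "B \<in> H" "\<forall>x\<in>carrier_vec n. \<forall>r<n.
    [(B *\<^sub>v x) $ r = x $ r + N * bilin_act n a x r] (mod (N * p))" unfolding M_def by blast
  then have "mcong n (N * p) A B"
    unfolding mcong_def vcong_def using act by (simp add: cong_sym_eq)
  then show ?thesis using closed[OF A(1) B(1)] by blast
qed

end

section \<open>The image of the Burau representation\<close>

text \<open>The block sends \<open>(x_i, x_{i+1})\<close> to \<open>(2 x_i - x_{i+1}, x_i)\<close>,
  which adds \<open>x_i - x_{i+1}\<close> to both coordinates. The shift by one is that between the
  numbering of the \<sigma> and of the coordinates.\<close>

lemma burau_sigma_transv:
  assumes "Suc i < n"
  shows "burau_sigma n (Suc i) = transv n 1 (cvec n i)"
proof (rule eq_matI)
  have dims: "dim_row (burau_sigma n (Suc i)) = n" "dim_col (burau_sigma n (Suc i)) = n"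
    using assms by (simp_all add: burau_sigma_def dim_diag_block_mat mat_of_rows_list_def)
  then show "dim_row (burau_sigma n (Suc i)) = dim_row (transv n 1 (cvec n i))"
    "dim_col (burau_sigma n (Suc i)) = dim_col (transv n 1 (cvec n i))"
    by (simp_all add: transv_def)
  fix r c assume "r < dim_row (transv n 1 (cvec n i))" "c < dim_col (transv n 1 (cvec n i))"
  then have rc: "r < n" "c < n" by (simp_all add: transv_def)
  obtain q where n: "n = Suc (Suc (i + q))" using assms less_iff_Suc_add by auto
  have sigma: "burau_sigma n (Suc i) $$ (r, c) =
    (if r < i then (if c < i then 1\<^sub>m i $$ (r, c) else 0)
     else if c < i then 0
     else if r - i < 2 then (if c - i < 2 then [[2, -1], [1, 0]] ! (r - i) ! (c - i) else 0)
     else if c - i < 2 then 0 else 1\<^sub>m (n - i - 2) $$ (r - i - 2, c - i - 2))"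
    using rc
    by (simp add: n burau_sigma_def Let_def index_mat_four_block mat_of_rows_list_def diff_less_mono less_diff_conv2)
  have transv: "transv n 1 (cvec n i) $$ (r, c) = (if r = c then 1 else 0) +
    (if r = i \<or> r = Suc i then 1 else 0) * ((if c = i then 1 else 0) - (if c = Suc i then 1 else 0))"
    using rc assms by (simp add: transv_def alt_form_cvec)
  have r_cases: "r < i \<or> r = i \<or> r = Suc i \<or> Suc i < r" by linarith
  have c_cases: "c < i \<or> c = i \<or> c = Suc i \<or> Suc i < c" by linarith
  show "burau_sigma n (Suc i) $$ (r, c) = transv n 1 (cvec n i) $$ (r, c)"
    unfolding sigma transv using r_cases c_cases rc
    by (elim disjE) (simp_all add: one_mat_def, linarith+)?
qed

lemma burau_letter_transv:
  assumes "i \<in> {1..<n}"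
  shows "burau_letter n (i, s) = transv n (if s then 1 else - 1) (cvec n (i - 1))"
proof -
  interpret GL: group "GL_int n" by (rule group_GL_int)
  have i: "Suc (i - 1) < n" "Suc (i - 1) = i" using assms by auto
  have sig: "burau_sigma n i = transv n 1 (cvec n (i - 1))"
    using burau_sigma_transv[OF i(1)] i(2) by simp
  have GL: "transv n t (cvec n (i - 1)) \<in> carrier (GL_int n)" for t
    using transv_Gamma[OF cvec_wlat[OF i(1)]] by (simp add: in_Gamma_iff)
  have "inv\<^bsub>GL_int n\<^esub> (transv n 1 (cvec n (i - 1))) = transv n (-1) (cvec n (i - 1))"
    using GL by (intro GL.inv_equality) (simp_all add: transv_mult)
  then show ?thesis using sig by (simp add: burau_letter.simps)
qed

declare burau_letter.simps [simp del]

lemma burau_letter_Gamma: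
  assumes "x \<in> {1..<n} \<times> UNIV"
  shows "burau_letter n x \<in> carrier (Gamma n)"
proof -
  obtain i s where x: "x = (i, s)" "i \<in> {1..<n}" using assms by (cases x) auto
  then have "Suc (i - 1) < n" by auto
  then show ?thesis
    unfolding x(1) burau_letter_transv[OF x(2)] by (intro transv_Gamma cvec_wlat)
qed

lemma burau_word_simps [simp]:
  "burau_word n [] = 1\<^sub>m n" "burau_word n (x # w) = burau_letter n x * burau_word n w"
  by (simp_all add: burau_word_def)

lemma burau_word_Gamma: "w \<in> braid_words n \<Longrightarrow> burau_word n w \<in> carrier (Gamma n)"
proof (induction w)
  case (Cons x w)
  then show ?case using burau_letter_Gamma[of x n] by (auto simp: braid_words_def)
qed simp

lemma burau_word_append:
  assumes "u \<in> braid_words n" "v \<in> braid_words n"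
  shows "burau_word n (u @ v) = burau_word n u * burau_word n v"
  using assms(1)
proof (induction u)
  case Nil
  then show ?case using left_mult_one_mat[OF Gamma_carrier_mat[OF burau_word_Gamma[OF assms(2)]]] by simp
next
  case (Cons x u)
  then have "x \<in> {1..<n} \<times> UNIV" "u \<in> braid_words n" by (auto simp: braid_words_def)
  then show ?case using Cons.IH Gamma_assoc[of _ n] burau_letter_Gamma burau_word_Gamma assms(2) by simp
qed

text \<open>Taken over words, so that the image can be studied before the braid relations are known
  to hold for the matrices.\<close>

definition braid_image :: "nat \<Rightarrow> int mat set" where
  "braid_image n = burau_word n ` braid_words n"

lemma braid_image_subgroup: "subgroup (braid_image n) (Gamma n)"
proof (rule Gamma.subgroupI)
  have nil: "[] \<in> braid_words n" by (simp add: braid_words_def)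
  show "braid_image n \<subseteq> carrier (Gamma n)" by (auto simp: braid_image_def burau_word_Gamma)
  show "braid_image n \<noteq> {}" using nil by (auto simp: braid_image_def)
  fix A B assume "A \<in> braid_image n" "B \<in> braid_image n"
  then obtain u v where uv: "u \<in> braid_words n" "v \<in> braid_words n"
    "A = burau_word n u" "B = burau_word n v" by (auto simp: braid_image_def)
  then have "u @ v \<in> braid_words n" by (simp add: braid_words_def)
  then show "A \<otimes>\<^bsub>Gamma n\<^esub> B \<in> braid_image n"
    using uv by (simp add: braid_image_def burau_word_append[symmetric])
next
  fix A assume "A \<in> braid_image n"
  then obtain w where w: "w \<in> braid_words n" "A = burau_word n w" by (auto simp: braid_image_def)
  have "\<exists>v\<in>braid_words n. burau_word n v = inv\<^bsub>Gamma n\<^esub> (burau_word n w)"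
    using w(1)
  proof (induction w)
    case Nil
    then show ?case using Gamma.inv_one[of n] by (auto simp: braid_words_def intro!: bexI[of _ "[]"])
  next
    case (Cons x w)
    obtain i s where x: "x = (i, s)" by (cases x)
    then have i: "i \<in> {1..<n}" and w: "w \<in> braid_words n" using Cons.prems by (auto simp: braid_words_def)
    obtain v where v: "v \<in> braid_words n" "burau_word n v = inv\<^bsub>Gamma n\<^esub> (burau_word n w)"
      using Cons.IH w by blast
    have i': "Suc (i - 1) < n" using i by auto
    have flip: "burau_letter n (i, \<not> s) = inv\<^bsub>Gamma n\<^esub> (burau_letter n (i, s))"
      using cvec_wlat[OF i'] by (simp add: burau_letter_transv[OF i] transv_inv)
    have letter: "[(i, \<not> s)] \<in> braid_words n" using i by (simp add: braid_words_def)
    have lG: "burau_letter n (i, s) \<in> carrier (Gamma n)" "burau_letter n (i, \<not> s) \<in> carrier (Gamma n)"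
      using i burau_letter_Gamma by blast+
    have "burau_word n (v @ [(i, \<not> s)]) = burau_word n v * burau_letter n (i, \<not> s)"
      using burau_word_append[OF v(1) letter] right_mult_one_mat[OF Gamma_carrier_mat[OF lG(2)]]
      by simp
    also have "\<dots> = inv\<^bsub>Gamma n\<^esub> (burau_letter n (i, s) * burau_word n w)"
      using Gamma.inv_mult_group[OF lG(1) burau_word_Gamma[OF w]] unfolding v(2) flip by simp
    finally have "burau_word n (v @ [(i, \<not> s)]) = inv\<^bsub>Gamma n\<^esub> (burau_word n (x # w))"
      by (simp add: x)
    moreover have "v @ [(i, \<not> s)] \<in> braid_words n" using v(1) letter by (simp add: braid_words_def)
    ultimately show ?case by blast
  qed
  then show "inv\<^bsub>Gamma n\<^esub> A \<in> braid_image n" unfolding w(2) braid_image_def by force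
qed

lemma mcong_zero:
  assumes "A \<in> carrier (Gamma n)" "B \<in> carrier (Gamma n)" "mcong n 0 A B"
  shows "A = B"
proof (rule Gamma_eqI[OF assms(1,2)])
  fix x :: "int vec" assume x: "x \<in> carrier_vec n"
  then have "(A *\<^sub>v x) $ i = (B *\<^sub>v x) $ i" if "i < n" for i
    using assms(3) that by (simp add: mcong_def vcong_def)
  moreover have "dim_vec (A *\<^sub>v x) = n" "dim_vec (B *\<^sub>v x) = n"
    using Gamma_act[OF assms(1) x] Gamma_act[OF assms(2) x] by (simp_all only: carrier_vecD)
  ultimately show "A *\<^sub>v x = B *\<^sub>v x" by (intro eq_vecI) (simp_all only:)
qed

text \<open>Congruence modulo 0 is equality, so the closure condition is automatic and the lemmas of
  the locale become available for the image itself.\<close>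

lemma cong_subgroup_braid_image: "cong_subgroup n 0 (braid_image n)"
proof (rule cong_subgroup.intro[OF braid_image_subgroup])
  fix A B assume "A \<in> carrier (Gamma n)" "B \<in> braid_image n" "mcong n 0 A B"
  then show "A \<in> braid_image n"
    using mcong_zero subgroup.mem_carrier[OF braid_image_subgroup] by metis
qed

interpretation G: cong_subgroup n 0 "braid_image n" for n
  by (rule cong_subgroup_braid_image)

lemma cvec_braid_image: "Suc i < n \<Longrightarrow> transv n t (cvec n i) \<in> braid_image n"
proof -
  assume i: "Suc i < n"
  have "burau_word n [(Suc i, True)] \<in> braid_image n"
    unfolding braid_image_def using i by (intro imageI) (simp add: braid_words_def)
  moreover have "burau_word n [(Suc i, True)] = transv n 1 (cvec n i)"
    using i right_mult_one_mat[OF transv_carrier] burau_letter_transv[of "Suc i" n True] by simp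
  ultimately have "transv n 1 (cvec n i) \<in> braid_image n" by simp
  from G.transv_pow[OF cvec_wlat[OF i] this, of t] show ?thesis by simp
qed

lemma (in cong_subgroup) transv_act:
  assumes "A \<in> H" "u \<in> wlat n" "transv n t u \<in> H"
  shows "transv n t (A *\<^sub>v u) \<in> H"
  using H_mult[OF H_mult[OF assms(1,3)] H_inv[OF assms(1)]] assms by (simp add: transv_conj)

text \<open>\<open>c_i + c_{i+1}\<close> is in the braid orbit of \<open>c_{i+1}\<close>, so every
  exponent occurs, not only even ones.\<close>

lemma adjacent_braid_image:
  assumes "Suc (Suc i) < n"
  shows "transv n t (cvec n i + cvec n (Suc i)) \<in> braid_image n"
proof -
  have "transv n (-1) (cvec n i) *\<^sub>v cvec n (Suc i) = cvec n i + cvec n (Suc i)"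
    using assms by (auto simp: transv_action cvec_pair intro!: eq_vecI)
  then show ?thesis
    using G.transv_act[OF cvec_braid_image[of i n "-1"] cvec_wlat cvec_braid_image[of "Suc i" n t]] assms
    by simp
qed

text \<open>The left-hand side is the image of the full twist on four adjacent strands.\<close>

lemma full_twist:
  assumes "i + 3 < n"
  defines "D \<equiv> transv n 1 (cvec n i) * (transv n 1 (cvec n (i + 1)) * transv n 1 (cvec n (i + 2)))"
  shows "D * (D * (D * D)) = transv n 2 (cvec n i + cvec n (i + 2))"
proof (rule Gamma_eqI)
  have T: "transv n 1 (cvec n k) \<in> carrier (Gamma n)" if "k \<le> i + 2" for k
    using that assms(1) by (intro transv_Gamma cvec_wlat) auto
  have D: "D \<in> carrier (Gamma n)" unfolding D_def using T by simp
  then show "D * (D * (D * D)) \<in> carrier (Gamma n)" by simp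
  have u: "cvec n i + cvec n (i + 2) \<in> wlat n" using assms(1) by (intro wlat_add) auto
  then show "transv n 2 (cvec n i + cvec n (i + 2)) \<in> carrier (Gamma n)" by (rule transv_Gamma)
  have Tx: "(transv n 1 (cvec n k) *\<^sub>v x) $ r =
      (if r = k then 2 * x $ k - x $ Suc k else if r = Suc k then x $ k else x $ r)"
    if "x \<in> carrier_vec n" "k \<le> i + 2" "r < n" for x k r
    using that assms(1) by (simp add: transv_action alt_form_cvec)
  \<comment> \<open>On the four coordinates \<open>D\<close> is a shift with one new entry on top,
    so its fourth power is computed by running a linear recurrence four times.\<close>
  have Dx: "(D *\<^sub>v x) $ r = (if r = i then 2 * x $ i - 2 * x $ (i + 1) + 2 * x $ (i + 2) - x $ (i + 3)
      else if r \<in> {i + 1, i + 2, i + 3} then x $ (r - 1) else x $ r)"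
    if "x \<in> carrier_vec n" "r < n" for x r
    using that T assms(1) by (auto simp: D_def Gamma_act_mult[of _ n] Gamma_act[of _ n] Tx numeral_3_eq_3)
  fix x :: "int vec" assume x: "x \<in> carrier_vec n"
  have Dc: "D *\<^sub>v y \<in> carrier_vec n" if "y \<in> carrier_vec n" for y using D that by (rule Gamma_act)
  show "(D * (D * (D * D))) *\<^sub>v x = transv n 2 (cvec n i + cvec n (i + 2)) *\<^sub>v x"
  proof (rule eq_vecI)
    fix r assume "r < dim_vec (transv n 2 (cvec n i + cvec n (i + 2)) *\<^sub>v x)"
    then have r: "r < n" by (simp add: transv_def)
    have "(D *\<^sub>v (D *\<^sub>v (D *\<^sub>v (D *\<^sub>v x)))) $ r =
        x $ r + 2 * (x $ i - x $ (i + 1) + x $ (i + 2) - x $ (i + 3)) * (if i \<le> r \<and> r \<le> i + 3 then 1 else 0)"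
    proof -
      consider "r = i" | "r = i + 1" | "r = i + 2" | "r = i + 3" | "r < i \<or> i + 3 < r" by linarith
      then show ?thesis using assms(1) r by cases (simp_all add: Dx Dc x)
    qed
    then show "(D * (D * (D * D)) *\<^sub>v x) $ r = (transv n 2 (cvec n i + cvec n (i + 2)) *\<^sub>v x) $ r"
      using x r u assms(1) D
      by (auto simp: Gamma_act_mult[of _ n] transv_action alt_form_cvec numeral_3_eq_3)
  qed (use D x in \<open>simp_all add: transv_def carrier_matD[OF Gamma_carrier_mat[OF D]]\<close>)
qed

text \<open>Induction on the distance: adjacent indices, then the full twist for distance 2. Beyond
  that the transvections along \<open>c_{j+1}\<close> and \<open>c_j\<close>, applied in this order,
  carry \<open>c_i + c_j\<close> to \<open>c_i + c_{j+1}\<close> and leave the part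
  \<open>c_i\<close> alone.\<close>

lemma pair_braid_image:
  assumes "i < j" "Suc j < n"
  shows "transv n 2 (cvec n i + cvec n j) \<in> braid_image n"
  using assms
proof (induction j)
  case (Suc j)
  consider "i = j" | "Suc i = j" | "Suc i < j" using Suc.prems(1) by linarith
  then show ?case
  proof cases
    case 1
    then show ?thesis using adjacent_braid_image Suc.prems(2) by blast
  next
    case 2
    have i: "i + 3 < n" using 2 Suc.prems(2) by simp
    let ?D = "transv n 1 (cvec n i) * (transv n 1 (cvec n (i + 1)) * transv n 1 (cvec n (i + 2)))"
    have D: "?D \<in> braid_image n" by (intro G.H_mult cvec_braid_image) (use i in auto)
    have "?D * (?D * (?D * ?D)) \<in> braid_image n" by (intro G.H_mult D)
    then have "transv n 2 (cvec n i + cvec n (i + 2)) \<in> braid_image n" unfolding full_twist[OF i] .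
    moreover have "i + 2 = Suc j" using 2 by simp
    ultimately show ?thesis by (simp only:)
  next
    case 3
    let ?S = "transv n 1 (cvec n j) * transv n 1 (cvec n (Suc j))"
    have n: "Suc i < n" "Suc j < n" using 3 Suc.prems by auto
    have S: "?S \<in> braid_image n" using Suc.prems n by (intro G.H_mult cvec_braid_image) auto
    have ST: "transv n 1 (cvec n j) \<in> carrier (Gamma n)" "transv n 1 (cvec n (Suc j)) \<in> carrier (Gamma n)"
      using n Suc.prems by (auto intro!: transv_Gamma cvec_wlat)
    have "transv n 1 (cvec n (Suc j)) *\<^sub>v (cvec n i + cvec n j) = cvec n i + cvec n j + cvec n (Suc j)"
      using 3 n Suc.prems by (auto simp: transv_action cvec_pair intro!: eq_vecI)
    moreover have "transv n 1 (cvec n j) *\<^sub>v (cvec n i + cvec n j + cvec n (Suc j)) = cvec n i + cvec n (Suc j)"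
      using 3 n Suc.prems by (auto simp: transv_action cvec_pair intro!: eq_vecI)
    ultimately have "?S *\<^sub>v (cvec n i + cvec n j) = cvec n i + cvec n (Suc j)"
      using ST by (simp add: Gamma_act_mult[of _ n])
    moreover have "transv n 2 (cvec n i + cvec n j) \<in> braid_image n"
      using Suc.IH 3 n by simp
    moreover have "cvec n i + cvec n j \<in> wlat n" using n by (intro wlat_add) auto
    ultimately show ?thesis using G.transv_act[OF S] by metis
  qed
qed simp

text \<open>The matrices that agree modulo \<open>N\<close> with the image of a braid that is
  trivial modulo \<open>K\<close>. The value \<open>K = 1\<close> imposes nothing.\<close>

definition approx :: "nat \<Rightarrow> int \<Rightarrow> int \<Rightarrow> int mat set" where
  "approx n N K = {A \<in> carrier (Gamma n). \<exists>B\<in>braid_image n. mcong n N A B \<and> mcong n K B (1\<^sub>m n)}"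

lemma approx_I:
  "A \<in> carrier (Gamma n) \<Longrightarrow> B \<in> braid_image n \<Longrightarrow> mcong n N A B \<Longrightarrow> mcong n K B (1\<^sub>m n) \<Longrightarrow> A \<in> approx n N K"
  by (auto simp: approx_def)

lemma cong_subgroup_approx: "cong_subgroup n N (approx n N K)"
proof (rule cong_subgroup.intro)
  show "subgroup (approx n N K) (Gamma n)"
  proof (rule Gamma.subgroupI)
    show "approx n N K \<subseteq> carrier (Gamma n)" by (auto simp: approx_def)
    have "1\<^sub>m n \<in> approx n N K" by (rule approx_I[of _ _ "1\<^sub>m n"]) auto
    then show "approx n N K \<noteq> {}" by blast
    fix A assume "A \<in> approx n N K"
    then obtain A' where A: "A \<in> carrier (Gamma n)" "A' \<in> braid_image n" "mcong n N A A'" "mcong n K A' (1\<^sub>m n)"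
      by (auto simp: approx_def)
    have "mcong n K (inv\<^bsub>Gamma n\<^esub> A') (inv\<^bsub>Gamma n\<^esub> (1\<^sub>m n))"
      using A by (intro mcong_inv) auto
    then have K: "mcong n K (inv\<^bsub>Gamma n\<^esub> A') (1\<^sub>m n)" using Gamma.inv_one[of n] by simp
    show "inv\<^bsub>Gamma n\<^esub> A \<in> approx n N K"
      by (rule approx_I[OF _ G.H_inv[OF A(2)] mcong_inv K]) (use A in auto)
    fix B assume "B \<in> approx n N K"
    then obtain B' where B: "B \<in> carrier (Gamma n)" "B' \<in> braid_image n" "mcong n N B B'" "mcong n K B' (1\<^sub>m n)"
      by (auto simp: approx_def)
    have "mcong n K (A' * B') (1\<^sub>m n * 1\<^sub>m n)" using A B by (intro mcong_mult) auto
    then have K: "mcong n K (A' * B') (1\<^sub>m n)" by simp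
    have "A * B \<in> approx n N K"
      by (rule approx_I[OF _ G.H_mult[OF A(2) B(2)] mcong_mult K]) (use A B in auto)
    then show "A \<otimes>\<^bsub>Gamma n\<^esub> B \<in> approx n N K" by simp
  qed
  fix A B assume "A \<in> carrier (Gamma n)" "B \<in> approx n N K" "mcong n N A B"
  then show "A \<in> approx n N K" by (auto simp: approx_def intro: mcong_trans)
qed

interpretation approx: cong_subgroup n N "approx n N K" for n N K
  by (rule cong_subgroup_approx)

text \<open>If the braid image has the \<open>q\<close>-th power of a transvection, one multiple of
  \<open>q\<close> as exponent can match \<open>t\<close> modulo \<open>N\<close> and vanish modulo
  \<open>K\<close>.\<close>

lemma transv_approx:
  assumes "u \<in> wlat n" "transv n q u \<in> braid_image n" "[q * s = t] (mod N)" "K dvd q * s"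
  shows "transv n t u \<in> approx n N K"
proof (rule approx_I[of _ _ "transv n (q * s) u"])
  show "transv n t u \<in> carrier (Gamma n)" using assms(1) by (rule transv_Gamma)
  show "transv n (q * s) u \<in> braid_image n"
    using G.transv_pow[OF assms(1,2), of s] by (simp add: mult.commute)
  show "mcong n N (transv n t u) (transv n (q * s) u)"
    using assms by (intro transv_mcong) (auto simp: cong_sym_eq)
  have "mcong n K (transv n (q * s) u) (transv n 0 u)"
    using assms by (intro transv_mcong) (auto simp: cong_0_iff)
  then show "mcong n K (transv n (q * s) u) (1\<^sub>m n)" by simp
qed

lemma crt_multiple:
  assumes "coprime N (q * K)"
  obtains s :: int where "[q * s = t] (mod N)" "K dvd q * s"
proof -
  obtain x where "[q * K * x = 1] (mod N)"
    using assms cong_solve_coprime_int coprime_commute by blast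
  then have "[q * K * x * t = 1 * t] (mod N)" by (intro cong_mult cong_refl)
  then show thesis by (intro that[of "K * x * t"]) (simp_all add: ac_simps)
qed

text \<open>
  For \<open>n \<le> 3\<close> the only pair is \<open>c\<^sub>0, c\<^sub>1\<close>, and \<open>c\<^sub>0 + c\<^sub>1\<close> lies in the braid orbit of \<open>c\<^sub>1\<close>. For
  \<open>n \<ge> 4\<close> the transvection along \<open>c\<^sub>0 + c\<^sub>2\<close> is not a permutation matrix modulo 2, so only its
  square is in the braid image.
\<close>

definition pair_exp :: "nat \<Rightarrow> int" where
  "pair_exp n = (if n \<le> 3 then 1 else 2)"

lemma pair_exp_braid_image:
  assumes "i < j" "Suc j < n"
  shows "transv n (pair_exp n) (cvec n i + cvec n j) \<in> braid_image n"
proof (cases "n \<le> 3")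
  case True
  then have "j = Suc i" using assms by simp
  then show ?thesis using adjacent_braid_image assms by simp
next
  case False
  then show ?thesis using pair_braid_image[OF assms] by (simp add: pair_exp_def)
qed

lemma pair_wlat: "i < j \<Longrightarrow> Suc j < n \<Longrightarrow> cvec n i + cvec n j \<in> wlat n"
  by (intro wlat_add cvec_wlat) auto

lemma approx_prime:
  assumes "prime p" "coprime p (pair_exp n * K)" "0 < n"
  shows "carrier (Gamma n) \<subseteq> approx n p K"
proof -
  have pK: "coprime p (1 * K)" using assms(2) by simp
  have "cong_subgroup_prime n p (approx n p K)"
  proof
    show "prime p" by fact
  next
    fix i assume i: "Suc i < n"
    obtain s where "[1 * s = 1] (mod p)" "K dvd 1 * s" using crt_multiple[OF pK, of 1] by metis
    then show "cvec n i \<in> approx.U n p K"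
      using i by (intro approx.U_I transv_approx[of _ _ 1 s] cvec_braid_image) auto
  next
    assume n: "3 < n"
    obtain s where s: "[pair_exp n * s = 1] (mod p)" "K dvd pair_exp n * s"
      using crt_multiple[OF assms(2), of 1] by metis
    have "cvec n 0 + cvec n 2 \<in> wlat n" using n by (intro pair_wlat) auto
    then show "cvec n 0 + cvec n 2 \<in> approx.U n p K"
      using n s by (intro approx.U_I transv_approx[of _ _ "pair_exp n" s] pair_exp_braid_image) auto
  qed
  then show ?thesis using cong_subgroup_prime.Gamma_subset_H assms(3) by blast
qed

text \<open>The condition on exponents is stated as solvability because it is met in two ways: by
  the Chinese remainder theorem if \<open>N\<close> is prime to \<open>pair_exp n * K\<close>, and
  by plain divisibility if \<open>N\<close> is a power of 2 and \<open>K = 1\<close>.\<close>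

lemma approx_power:
  assumes "N \<noteq> 0" "p dvd N"
    and "\<exists>s. [pair_exp n * s = N] (mod (N * p)) \<and> K dvd pair_exp n * s"
    and "A \<in> carrier (Gamma n)" "mcong n N A (1\<^sub>m n)"
  shows "A \<in> approx n (N * p) K"
proof -
  obtain s where s: "[pair_exp n * s = N] (mod (N * p))" "K dvd pair_exp n * s" using assms(3) by blast
  have "cong_subgroup_power n N p (approx n (N * p) K)"
  proof
    fix i assume i: "Suc i < n"
    then show "transv n N (cvec n i) \<in> approx n (N * p) K"
      using s by (intro transv_approx[of _ _ "pair_exp n" s] cvec_braid_image) auto
  next
    fix i j assume "i < j" "Suc j < n"
    then show "transv n N (cvec n i + cvec n j) \<in> approx n (N * p) K"
      using s by (intro transv_approx[of _ _ "pair_exp n" s] pair_exp_braid_image pair_wlat) auto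
  qed (use assms in auto)
  then show ?thesis using cong_subgroup_power.level_subset_H assms by blast
qed

lemma Gamma_quotient_cong:
  assumes "A \<in> carrier (Gamma n)" "B \<in> carrier (Gamma n)" "mcong n N A B"
  shows "mcong n N (inv\<^bsub>Gamma n\<^esub> B * A) (1\<^sub>m n)"
proof -
  have "mcong n N (inv\<^bsub>Gamma n\<^esub> B * A) (inv\<^bsub>Gamma n\<^esub> B * B)"
    using assms by (intro mcong_mult) auto
  then show ?thesis using assms by simp
qed

lemma Gamma_factor:
  assumes "A \<in> carrier (Gamma n)" "B \<in> carrier (Gamma n)"
  shows "B * (inv\<^bsub>Gamma n\<^esub> B * A) = A"
  using assms Gamma_assoc[of B n "inv\<^bsub>Gamma n\<^esub> B" A] by (simp add: left_mult_one_mat[OF Gamma_carrier_mat])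

text \<open>Dividing \<open>A\<close> by its approximation leaves an element of level
  \<open>N\<close>, so only such elements have to be lifted to the modulus
  \<open>N'\<close>.\<close>

lemma approx_step:
  assumes A: "A \<in> carrier (Gamma n)" "A \<in> approx n N K"
    and level: "\<And>C. C \<in> carrier (Gamma n) \<Longrightarrow> mcong n N C (1\<^sub>m n) \<Longrightarrow> C \<in> approx n N' K"
  shows "A \<in> approx n N' K"
proof -
  obtain B where B: "B \<in> braid_image n" "mcong n N A B" "mcong n K B (1\<^sub>m n)"
    using A(2) unfolding approx_def by blast
  then have BG: "B \<in> carrier (Gamma n)" by simp
  have quot: "inv\<^bsub>Gamma n\<^esub> B * A \<in> approx n N' K"
    using A BG B Gamma_quotient_cong by (intro level) auto
  have "B \<in> approx n N' K" using B BG by (intro approx_I[of _ _ B]) auto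
  from approx.H_mult[OF this quot] show ?thesis using Gamma_factor[OF A(1) BG] by simp
qed

text \<open>One prime factor \<open>p\<close> of \<open>N = p * M\<close> is removed at a time. If
  \<open>p\<close> divides \<open>M\<close>, the step from \<open>M\<close> to \<open>M * p\<close>
  is \<open>approx_power\<close>; otherwise the prime case is applied with triviality modulo
  \<open>K * M\<close>, which leaves the agreement modulo \<open>M\<close> intact.\<close>

theorem approx_coprime:
  assumes "0 < N" "coprime (int N) (pair_exp n * K)" "0 < n"
  shows "carrier (Gamma n) \<subseteq> approx n (int N) K"
  using assms(1,2)
proof (induction N arbitrary: K rule: less_induct)
  case (less N)
  show ?case
  proof (cases "N = 1")
    case True
    have "mcong n 1 A B" for A B by (simp add: mcong_def vcong_def)
    then show ?thesis using True by (auto intro!: approx_I[of _ _ "1\<^sub>m n"])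
  next
    case False
    then obtain p where p: "prime p" "p dvd N" using prime_factor_nat by blast
    then obtain M where M: "N = p * M" by auto
    have M0: "0 < M" "M < N" using M less.prems(1) prime_gt_1_nat[OF p(1)] by auto
    have copM: "coprime (int M) (pair_exp n * K)" and copp: "coprime (int p) (pair_exp n * K)"
      using less.prems(2) M by simp_all
    have pi: "prime (int p)" using p by simp
    show ?thesis
    proof
      fix A assume A: "A \<in> carrier (Gamma n)"
      have AM: "A \<in> approx n (int M) K" using less.IH[OF M0(2,1) copM] A by blast
      show "A \<in> approx n (int N) K"
      proof (rule approx_step[OF A AM])
        fix C assume C: "C \<in> carrier (Gamma n)" "mcong n (int M) C (1\<^sub>m n)"
        show "C \<in> approx n (int N) K"
        proof (cases "p dvd M")
          case True
          obtain s where "[pair_exp n * s = int M] (mod (int M * int p))" "K dvd pair_exp n * s"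
            using crt_multiple[of "int M * int p" "pair_exp n" K "int M"] less.prems(2) M
            by (auto simp: mult.commute)
          then have "C \<in> approx n (int M * int p) K"
            using C True M0 by (intro approx_power) auto
          then show ?thesis using M by (simp add: mult.commute)
        next
          case False
          have pM: "coprime (int p) (int M)" using False p(1) prime_imp_coprime by auto
          then have "coprime (int p) (pair_exp n * (K * int M))" using copp by simp
          then have "C \<in> approx n (int p) (K * int M)" using approx_prime[OF pi] assms(3) C by blast
          then obtain B where B: "B \<in> braid_image n" "mcong n (int p) C B" "mcong n (K * int M) B (1\<^sub>m n)"
            unfolding approx_def by blast
          have "mcong n (int M) C B"
            using mcong_trans[OF C(2) mcong_sym[OF mcong_dvd[OF B(3)]]] by simp
          then have "mcong n (int p * int M) C B" using B(2) pM by (intro mcong_coprime)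
          moreover have "mcong n K B (1\<^sub>m n)" using mcong_dvd[OF B(3)] by simp
          ultimately show ?thesis using M C B by (intro approx_I[of _ _ B]) auto
        qed
      qed
    qed
  qed
qed

text \<open>Starting at level 2 makes \<open>pair_exp n\<close> divide every exponent
  \<open>2 ^ k\<close> that is needed, so the squares of the transvections suffice.\<close>

theorem approx_two_power:
  assumes "A \<in> carrier (Gamma n)" "mcong n 2 A (1\<^sub>m n)" "1 \<le> k"
  shows "A \<in> approx n (2 ^ k) 1"
  using assms(3)
proof (induction k rule: dec_induct)
  case base
  have "mcong n 1 (1\<^sub>m n) (1\<^sub>m n)" by simp
  then show ?case using assms by (intro approx_I[of _ _ "1\<^sub>m n"]) auto
next
  case (step k)
  show ?case
  proof (rule approx_step[OF assms(1) step.IH])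
    fix C assume C: "C \<in> carrier (Gamma n)" "mcong n (2 ^ k) C (1\<^sub>m n)"
    have "pair_exp n dvd 2 ^ k" using step by (auto simp: pair_exp_def)
    then obtain s where s: "2 ^ k = pair_exp n * s" by (rule dvdE)
    have "\<exists>s. [pair_exp n * s = 2 ^ k] (mod (2 ^ k * 2)) \<and> 1 dvd pair_exp n * s"
      by (rule exI[of _ s]) (simp add: s[symmetric])
    then have "C \<in> approx n (2 ^ k * 2) 1"
      using C step by (intro approx_power) auto
    then show "C \<in> approx n (2 ^ Suc k) 1" by (simp add: mult.commute)
  qed
qed

section \<open>The braid group and its quotients\<close>

lemma transv_commute:
  assumes "u \<in> wlat n" "w \<in> wlat n" "alt_form n u w = 0"
  shows "transv n s u * transv n t w = transv n t w * transv n s u"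
proof (rule Gamma_eqI)
  fix x :: "int vec" assume x: "x \<in> carrier_vec n"
  have dims: "dim_vec x = n" "dim_vec u = n" "dim_vec w = n"
    using x wlat_carrier[OF assms(1)] wlat_carrier[OF assms(2)] by (simp_all only: carrier_vecD)
  have wu: "alt_form n w u = 0" using assms(3) alt_form_swap[of n w u] by simp
  show "(transv n s u * transv n t w) *\<^sub>v x = (transv n t w * transv n s u) *\<^sub>v x"
    using x assms wu
    by (simp add: Gamma_act_mult[of _ n] transv_Gamma transv_action)
      (intro eq_vecI, simp_all add: dims)
qed (use assms in \<open>auto simp: transv_Gamma\<close>)

lemma transv_braid:
  assumes "u \<in> wlat n" "w \<in> wlat n" "alt_form n u w = 1"
  shows "transv n 1 u * (transv n 1 w * transv n 1 u) = transv n 1 w * (transv n 1 u * transv n 1 w)"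
proof (rule Gamma_eqI)
  fix x :: "int vec" assume x: "x \<in> carrier_vec n"
  have dims: "dim_vec x = n" "dim_vec u = n" "dim_vec w = n"
    using x wlat_carrier[OF assms(1)] wlat_carrier[OF assms(2)] by (simp_all only: carrier_vecD)
  have wu: "alt_form n w u = -1" using assms(3) alt_form_swap[of n w u] by simp
  show "(transv n 1 u * (transv n 1 w * transv n 1 u)) *\<^sub>v x =
      (transv n 1 w * (transv n 1 u * transv n 1 w)) *\<^sub>v x"
    using x assms wu
    by (simp add: Gamma_act_mult[of _ n] transv_Gamma transv_action)
      (intro eq_vecI, simp_all add: dims algebra_simps)
qed (use assms in \<open>auto simp: transv_Gamma\<close>)

section \<open>The braid group and the Burau map on it\<close>

lemma braid_eq_words: "braid_eq n u v \<Longrightarrow> u \<in> braid_words n \<and> v \<in> braid_words n"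
  by (induction rule: braid_eq.induct) (auto simp: braid_words_def)

lemma burau_word_braid_eq: "braid_eq n u v \<Longrightarrow> burau_word n u = burau_word n v"
proof (induction rule: braid_eq.induct)
  case (congr u v a b)
  have "u \<in> braid_words n" "v \<in> braid_words n" using braid_eq_words[OF congr(1)] by auto
  moreover have "w @ b \<in> braid_words n" if "w \<in> braid_words n" for w
    using that congr by (simp add: braid_words_def)
  ultimately show ?case using congr by (simp add: burau_word_append)
next
  case (cancel i s)
  show ?case
    using cancel
    by (auto simp: burau_letter_transv right_mult_one_mat[OF transv_carrier] transv_mult[OF cvec_carrier])
next
  case (commute i j)
  then have ij: "Suc (i - 1) < n" "Suc (j - 1) < n" "alt_form n (cvec n (i - 1)) (cvec n (j - 1)) = 0"
    by (auto simp: cvec_pair)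
  then show ?case
    using commute transv_commute[OF cvec_wlat[OF ij(1)] cvec_wlat[OF ij(2)] ij(3), of 1 1]
    by (simp add: burau_letter_transv right_mult_one_mat[OF transv_carrier])
next
  case (braid i)
  then have i: "Suc (i - 1) < n" "Suc i < n" "alt_form n (cvec n (i - 1)) (cvec n i) = 1"
    by (auto simp: cvec_pair)
  then show ?case
    using braid transv_braid[OF cvec_wlat[OF i(1)] cvec_wlat[OF i(2)] i(3)]
    by (simp add: burau_letter_transv right_mult_one_mat[OF transv_carrier])
qed auto

abbreviation bcls :: "nat \<Rightarrow> (nat \<times> bool) list \<Rightarrow> (nat \<times> bool) list set" where
  "bcls n w \<equiv> braid_rel n `` {w}"

lemma equiv_braid_rel: "equiv (braid_words n) (braid_rel n)"
proof (rule equivI)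
  show "braid_rel n \<subseteq> braid_words n \<times> braid_words n"
    using braid_eq_words by (auto simp: braid_rel_def)
  show "refl_on (braid_words n) (braid_rel n)"
    by (auto simp: braid_rel_def intro!: refl_onI braid_eq.refl)
  show "Relation.sym (braid_rel n)"
    by (auto simp: braid_rel_def intro!: symI intro: braid_eq.sym)
  show "Relation.trans (braid_rel n)"
    unfolding braid_rel_def by (intro transI) (blast intro: braid_eq.trans)
qed

lemma bcls_eq_iff:
  "u \<in> braid_words n \<Longrightarrow> v \<in> braid_words n \<Longrightarrow> bcls n u = bcls n v \<longleftrightarrow> braid_eq n u v"
  by (simp add: eq_equiv_class_iff[OF equiv_braid_rel]) (simp add: braid_rel_def)

lemma bcls_self: "w \<in> braid_words n \<Longrightarrow> w \<in> bcls n w"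
  by (rule equiv_class_self[OF equiv_braid_rel])

lemma carrier_braid_group: "carrier (braid_group n) = bcls n ` braid_words n"
  by (auto simp: braid_group_def quotient_def)

lemma one_braid_group: "one (braid_group n) = bcls n []"
  by (simp add: braid_group_def)

lemma append_braid_words: "u \<in> braid_words n \<Longrightarrow> v \<in> braid_words n \<Longrightarrow> u @ v \<in> braid_words n"
  by (simp add: braid_words_def)

lemma braid_eq_append:
  assumes "braid_eq n u u'" "braid_eq n v v'"
  shows "braid_eq n (u @ v) (u' @ v')"
proof -
  have w: "u \<in> braid_words n" "u' \<in> braid_words n" "v \<in> braid_words n" "v' \<in> braid_words n"
    using assms braid_eq_words by blast+
  have nil: "[] \<in> braid_words n" by (simp add: braid_words_def)
  have "braid_eq n (u @ v) (u' @ v)" using braid_eq.congr[OF assms(1) nil w(3)] by simp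
  moreover have "braid_eq n (u' @ v) (u' @ v')" using braid_eq.congr[OF assms(2) w(2) nil] by simp
  ultimately show ?thesis by (rule braid_eq.trans)
qed

lemma mult_braid_group:
  assumes "u \<in> braid_words n" "v \<in> braid_words n"
  shows "bcls n u \<otimes>\<^bsub>braid_group n\<^esub> bcls n v = bcls n (u @ v)"
proof -
  have cong: "bcls n (u' @ v') = bcls n (u @ v)" if "u' \<in> bcls n u" "v' \<in> bcls n v" for u' v'
  proof -
    have "braid_eq n u u'" "braid_eq n v v'" using that by (auto simp: braid_rel_def)
    then have e: "braid_eq n (u @ v) (u' @ v')" by (rule braid_eq_append)
    show ?thesis using e braid_eq_words[OF e] braid_eq.sym[OF e] by (simp add: bcls_eq_iff)
  qed
  have "(\<Union>u'\<in>bcls n u. \<Union>v'\<in>bcls n v. bcls n (u' @ v')) = (\<Union>u'\<in>bcls n u. \<Union>v'\<in>bcls n v. bcls n (u @ v))"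
    by (intro SUP_cong HOL.refl cong)
  also have "\<dots> = bcls n (u @ v)"
    using bcls_self[OF assms(1)] bcls_self[OF assms(2)] by blast
  finally show ?thesis by (simp add: braid_group_def)
qed

lemma group_braid_group: "group (braid_group n)"
proof (rule groupI)
  have nil: "[] \<in> braid_words n" by (simp add: braid_words_def)
  show "one (braid_group n) \<in> carrier (braid_group n)"
    using nil by (auto simp: carrier_braid_group one_braid_group)
  fix X assume "X \<in> carrier (braid_group n)"
  then obtain u where u: "u \<in> braid_words n" "X = bcls n u" by (auto simp: carrier_braid_group)
  show "\<one>\<^bsub>braid_group n\<^esub> \<otimes>\<^bsub>braid_group n\<^esub> X = X"
    using u nil by (simp add: one_braid_group mult_braid_group)
  let ?inv = "rev (map (\<lambda>(i, s). (i, \<not> s)) u)"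
  have "?inv \<in> braid_words n \<and> braid_eq n (?inv @ u) []"
    using u(1)
  proof (induction u)
    case Nil
    then show ?case using braid_eq.refl[of "[]" n] by simp
  next
    case (Cons x u)
    obtain i s where x: "x = (i, s)" by (cases x)
    let ?v = "rev (map (\<lambda>(i, s). (i, \<not> s)) u)"
    have i: "i \<in> {1..<n}" and u: "u \<in> braid_words n" using Cons.prems x by (auto simp: braid_words_def)
    have v: "?v \<in> braid_words n" "braid_eq n (?v @ u) []" using Cons.IH u by auto
    have "braid_eq n (?v @ [(i, \<not> s), (i, \<not> \<not> s)] @ u) (?v @ [] @ u)"
      by (rule braid_eq.congr[OF braid_eq.cancel[OF i] v(1) u])
    then have "braid_eq n (?v @ [(i, \<not> s), (i, s)] @ u) (?v @ u)" by simp
    from braid_eq.trans[OF this v(2)] show ?case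
      using v(1) i by (simp add: x braid_words_def)
  qed
  then show "\<exists>Y\<in>carrier (braid_group n). Y \<otimes>\<^bsub>braid_group n\<^esub> X = \<one>\<^bsub>braid_group n\<^esub>"
    using u nil append_braid_words[of ?inv n u]
    by (intro bexI[of _ "bcls n ?inv"])
      (auto simp: carrier_braid_group one_braid_group mult_braid_group bcls_eq_iff)
  fix Y assume "Y \<in> carrier (braid_group n)"
  then obtain v where v: "v \<in> braid_words n" "Y = bcls n v" by (auto simp: carrier_braid_group)
  show "X \<otimes>\<^bsub>braid_group n\<^esub> Y \<in> carrier (braid_group n)"
    using u v by (simp add: mult_braid_group carrier_braid_group append_braid_words)
  fix Z assume "Z \<in> carrier (braid_group n)"
  then obtain w where "w \<in> braid_words n" "Z = bcls n w" by (auto simp: carrier_braid_group)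
  then show "X \<otimes>\<^bsub>braid_group n\<^esub> Y \<otimes>\<^bsub>braid_group n\<^esub> Z = X \<otimes>\<^bsub>braid_group n\<^esub> (Y \<otimes>\<^bsub>braid_group n\<^esub> Z)"
    using u v by (simp add: mult_braid_group append_braid_words)
qed

lemma burau_bcls:
  assumes "w \<in> braid_words n"
  shows "burau n (bcls n w) = burau_word n w"
proof -
  have const: "burau_word n v = burau_word n w" if "v \<in> bcls n w" for v
    using that burau_word_braid_eq[of n w v] by (simp add: braid_rel_def)
  have "burau_word n ` bcls n w = (\<lambda>_. burau_word n w) ` bcls n w"
    by (rule image_cong[OF HOL.refl const])
  also have "\<dots> = {burau_word n w}" by (rule image_constant[OF bcls_self[OF assms]])
  finally have "burau_word n ` bcls n w = {burau_word n w}" .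
  then show ?thesis by (simp add: burau_def)
qed

lemma burau_image: "burau n ` carrier (braid_group n) = braid_image n"
  unfolding carrier_braid_group braid_image_def image_image by (intro image_cong HOL.refl burau_bcls)

lemma burau_Gamma [simp]: "b \<in> carrier (braid_group n) \<Longrightarrow> burau n b \<in> carrier (Gamma n)"
  by (auto simp: carrier_braid_group burau_bcls burau_word_Gamma)

lemma burau_mult:
  "a \<in> carrier (braid_group n) \<Longrightarrow> b \<in> carrier (braid_group n) \<Longrightarrow>
    burau n (a \<otimes>\<^bsub>braid_group n\<^esub> b) = burau n a * burau n b"
  by (auto simp: carrier_braid_group mult_braid_group burau_bcls append_braid_words burau_word_append)

text \<open>These congruence classes are the cosets of \<open>Gamma_level n l\<close>, by
  \<open>Gamma_level_coset\<close>. With them, computation in the quotient is congruence of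
  representatives.\<close>

definition lcls :: "nat \<Rightarrow> nat \<Rightarrow> int mat \<Rightarrow> int mat set" where
  "lcls n l A = {C \<in> carrier (Gamma n). mcong n (int l) C A}"

lemma lcls_eq_iff:
  assumes "A \<in> carrier (Gamma n)" "B \<in> carrier (Gamma n)"
  shows "lcls n l A = lcls n l B \<longleftrightarrow> mcong n (int l) A B"
proof
  assume "lcls n l A = lcls n l B"
  moreover have "A \<in> lcls n l A" using assms by (simp add: lcls_def)
  ultimately show "mcong n (int l) A B" by (simp add: lcls_def)
next
  assume "mcong n (int l) A B"
  then show "lcls n l A = lcls n l B"
    unfolding lcls_def by (blast intro: mcong_trans mcong_sym)
qed

lemma Gamma_level_lcls: "Gamma_level n l = lcls n l (1\<^sub>m n)"
  by (auto simp: Gamma_level_def lcls_def cong_one_mat_iff)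

text \<open>Multiplying by the level subgroup fills a subset of a class up to the class, since any
  \<open>C\<close> in it is \<open>C B^{-1}\<close> times \<open>B\<close>. It serves for single
  cosets, for \<open>Gamma_reduce\<close> and for \<open>burau_quot\<close>.\<close>

lemma lcls_absorb:
  assumes "A \<in> carrier (Gamma n)" "S \<subseteq> lcls n d A" "B \<in> S"
  shows "Gamma_level n d <#>\<^bsub>Gamma n\<^esub> S = lcls n d A"
proof
  show "Gamma_level n d <#>\<^bsub>Gamma n\<^esub> S \<subseteq> lcls n d A"
  proof
    fix C assume "C \<in> Gamma_level n d <#>\<^bsub>Gamma n\<^esub> S"
    then obtain H D where HD: "H \<in> Gamma_level n d" "D \<in> S" "C = H * D"
      by (auto simp: set_mult_def)
    then have H: "H \<in> carrier (Gamma n)" "mcong n (int d) H (1\<^sub>m n)"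
      and D: "D \<in> carrier (Gamma n)" "mcong n (int d) D A"
      using assms(2) by (auto simp: Gamma_level_lcls lcls_def)
    have "mcong n (int d) (H * D) (1\<^sub>m n * A)" using H D assms(1) by (intro mcong_mult) auto
    then show "C \<in> lcls n d A"
      using H D HD(3) left_mult_one_mat[OF Gamma_carrier_mat[OF assms(1)]] by (simp add: lcls_def)
  qed
  show "lcls n d A \<subseteq> Gamma_level n d <#>\<^bsub>Gamma n\<^esub> S"
  proof
    fix C assume "C \<in> lcls n d A"
    then have C: "C \<in> carrier (Gamma n)" "mcong n (int d) C A" by (auto simp: lcls_def)
    have B: "B \<in> carrier (Gamma n)" "mcong n (int d) B A" using assms(2,3) by (auto simp: lcls_def)
    let ?H = "C * inv\<^bsub>Gamma n\<^esub> B"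
    have "mcong n (int d) ?H (B * inv\<^bsub>Gamma n\<^esub> B)"
      using C B mcong_trans[OF C(2) mcong_sym[OF B(2)]] by (intro mcong_mult) auto
    then have "?H \<in> Gamma_level n d" using C B by (simp add: Gamma_level_lcls lcls_def)
    moreover have "C = ?H * B"
      using C B Gamma_assoc[of C n "inv\<^bsub>Gamma n\<^esub> B" B] right_mult_one_mat[OF Gamma_carrier_mat[OF C(1)]]
      by simp
    ultimately show "C \<in> Gamma_level n d <#>\<^bsub>Gamma n\<^esub> S"
      unfolding set_mult_def using assms(3) by auto
  qed
qed

lemma Gamma_level_coset:
  assumes "A \<in> carrier (Gamma n)"
  shows "Gamma_level n l #>\<^bsub>Gamma n\<^esub> A = lcls n l A"
proof -
  have "Gamma_level n l #>\<^bsub>Gamma n\<^esub> A = Gamma_level n l <#>\<^bsub>Gamma n\<^esub> {A}"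
    by (simp add: r_coset_def set_mult_def)
  then show ?thesis using assms lcls_absorb[of A n "{A}" l A] by (simp add: lcls_def)
qed

lemma lcls_mult:
  assumes "A \<in> carrier (Gamma n)" "B \<in> carrier (Gamma n)"
  shows "lcls n l A <#>\<^bsub>Gamma n\<^esub> lcls n l B = lcls n l (A * B)"
proof
  show "lcls n l A <#>\<^bsub>Gamma n\<^esub> lcls n l B \<subseteq> lcls n l (A * B)"
    using assms by (auto simp: set_mult_def lcls_def intro!: mcong_mult)
  show "lcls n l (A * B) \<subseteq> lcls n l A <#>\<^bsub>Gamma n\<^esub> lcls n l B"
  proof
    fix C assume "C \<in> lcls n l (A * B)"
    then have C: "C \<in> carrier (Gamma n)" "mcong n (int l) C (A * B)" by (auto simp: lcls_def)
    let ?D = "inv\<^bsub>Gamma n\<^esub> A * C"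
    have "mcong n (int l) ?D (inv\<^bsub>Gamma n\<^esub> A * (A * B))" using C assms by (intro mcong_mult) auto
    then have "?D \<in> lcls n l B"
      using C assms Gamma_assoc[of "inv\<^bsub>Gamma n\<^esub> A" n A B] left_mult_one_mat[OF Gamma_carrier_mat[OF assms(2)]]
      by (simp add: lcls_def)
    moreover have "C = A * ?D" using Gamma_factor[OF C(1) assms(1)] by simp
    moreover have "A \<in> lcls n l A" using assms by (simp add: lcls_def)
    ultimately show "C \<in> lcls n l A <#>\<^bsub>Gamma n\<^esub> lcls n l B" unfolding set_mult_def by auto
  qed
qed

lemma Gamma_level_normal: "Gamma_level n l \<lhd> Gamma n"
  unfolding Gamma.normal_inv_iff
proof (intro conjI ballI)
  show "subgroup (Gamma_level n l) (Gamma n)"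
  proof (rule Gamma.subgroupI)
    show "Gamma_level n l \<subseteq> carrier (Gamma n)" by (auto simp: Gamma_level_def)
    have "1\<^sub>m n \<in> Gamma_level n l" by (simp add: Gamma_level_lcls lcls_def)
    then show "Gamma_level n l \<noteq> {}" by blast
    fix A assume A: "A \<in> Gamma_level n l"
    then have A': "A \<in> carrier (Gamma n)" "mcong n (int l) A (1\<^sub>m n)"
      by (auto simp: Gamma_level_lcls lcls_def)
    show "inv\<^bsub>Gamma n\<^esub> A \<in> Gamma_level n l"
      using A' mcong_inv[OF A'(2,1) Gamma_one] Gamma.inv_one[of n]
      by (simp add: Gamma_level_lcls lcls_def)
    fix B assume "B \<in> Gamma_level n l"
    then have B: "B \<in> carrier (Gamma n)" "mcong n (int l) B (1\<^sub>m n)"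
      by (auto simp: Gamma_level_lcls lcls_def)
    have "mcong n (int l) (A * B) (1\<^sub>m n * 1\<^sub>m n)" using A' B by (intro mcong_mult) auto
    then show "A \<otimes>\<^bsub>Gamma n\<^esub> B \<in> Gamma_level n l" using A' B by (simp add: Gamma_level_lcls lcls_def)
  qed
  fix A B assume A: "A \<in> carrier (Gamma n)" and "B \<in> Gamma_level n l"
  then have B: "B \<in> carrier (Gamma n)" "mcong n (int l) B (1\<^sub>m n)"
    by (auto simp: Gamma_level_lcls lcls_def)
  have "mcong n (int l) (A * B * inv\<^bsub>Gamma n\<^esub> A) (A * 1\<^sub>m n * inv\<^bsub>Gamma n\<^esub> A)"
    using A B by (intro mcong_mult) auto
  then show "A \<otimes>\<^bsub>Gamma n\<^esub> B \<otimes>\<^bsub>Gamma n\<^esub> inv\<^bsub>Gamma n\<^esub> A \<in> Gamma_level n l"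
    using A B right_mult_one_mat[OF Gamma_carrier_mat[OF A]] by (simp add: Gamma_level_lcls lcls_def)
qed

lemma group_Gamma_quot: "group (Gamma_quot n l)"
  by (rule normal.factorgroup_is_group[OF Gamma_level_normal])

lemma carrier_Gamma_quot: "carrier (Gamma_quot n l) = lcls n l ` carrier (Gamma n)"
  unfolding carrier_FactGroup by (intro image_cong HOL.refl Gamma_level_coset)

lemma lcls_burau_hom: "(\<lambda>b. lcls n l (burau n b)) \<in> hom (braid_group n) (Gamma_quot n l)"
  by (rule homI) (auto simp: carrier_Gamma_quot burau_mult lcls_mult)

lemma lcls_burau_kernel:
  "kernel (braid_group n) (Gamma_quot n l) (\<lambda>b. lcls n l (burau n b)) = braid_level n l"
proof -
  have "lcls n l (burau n b) = Gamma_level n l \<longleftrightarrow> cong_one_mat n l (burau n b)"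
    if "b \<in> carrier (braid_group n)" for b
    using that lcls_eq_iff[OF burau_Gamma[OF that] Gamma_one, of l]
    by (simp add: Gamma_level_lcls cong_one_mat_iff)
  then show ?thesis by (auto simp: kernel_def braid_level_def)
qed

lemma braid_level_normal: "braid_level n l \<lhd> braid_group n"
proof -
  have "group_hom (braid_group n) (Gamma_quot n l) (\<lambda>b. lcls n l (burau n b))"
    by (intro group_hom.intro group_hom_axioms.intro group_braid_group group_Gamma_quot lcls_burau_hom)
  from group_hom.normal_kernel[OF this] show ?thesis unfolding lcls_burau_kernel .
qed

text \<open>Common target of the isomorphism statements: each quotient of the braid group is
  identified with it by \<open>burau_quot_iso\<close>, and what remains is to recognize its
  carrier.\<close>

definition burau_image :: "nat \<Rightarrow> nat \<Rightarrow> int mat set monoid" where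
  "burau_image n l = (Gamma_quot n l)\<lparr>carrier := (\<lambda>b. lcls n l (burau n b)) ` carrier (braid_group n)\<rparr>"

lemma group_hom_burau: "group_hom (braid_group n) (burau_image n l) (\<lambda>b. lcls n l (burau n b))"
proof -
  interpret group_hom "braid_group n" "Gamma_quot n l" "\<lambda>b. lcls n l (burau n b)"
    by (intro group_hom.intro group_hom_axioms.intro group_braid_group group_Gamma_quot lcls_burau_hom)
  have "group (burau_image n l)"
    unfolding burau_image_def by (rule H.subgroup_imp_group[OF img_is_subgroup])
  moreover have "(\<lambda>b. lcls n l (burau n b)) \<in> hom (braid_group n) (burau_image n l)"
    using homh by (auto simp: hom_def burau_image_def)
  ultimately show ?thesis
    by (intro group_hom.intro group_hom_axioms.intro group_braid_group)
qed

lemma burau_quot_coset: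
  assumes b: "b \<in> carrier (braid_group n)"
  shows "burau_quot n l (braid_level n l #>\<^bsub>braid_group n\<^esub> b) = lcls n l (burau n b)"
    "c \<in> braid_level n l #>\<^bsub>braid_group n\<^esub> b \<Longrightarrow> lcls n l (burau n c) = lcls n l (burau n b)"
proof -
  have elem: "c \<in> carrier (braid_group n) \<and> mcong n (int l) (burau n c) (burau n b)"
    if "c \<in> braid_level n l #>\<^bsub>braid_group n\<^esub> b" for c
  proof -
    interpret group "braid_group n" by (rule group_braid_group)
    obtain a where a: "a \<in> braid_level n l" "c = a \<otimes>\<^bsub>braid_group n\<^esub> b"
      using \<open>c \<in> _\<close> by (auto simp: r_coset_def)
    then have a': "a \<in> carrier (braid_group n)" "mcong n (int l) (burau n a) (1\<^sub>m n)"
      by (auto simp: braid_level_def cong_one_mat_iff)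
    then have "mcong n (int l) (burau n a * burau n b) (1\<^sub>m n * burau n b)"
      using b by (intro mcong_mult) auto
    then show ?thesis
      using a a' b left_mult_one_mat[OF Gamma_carrier_mat[OF burau_Gamma[OF b]]] by (simp add: burau_mult)
  qed
  then show "lcls n l (burau n c) = lcls n l (burau n b)" if "c \<in> braid_level n l #>\<^bsub>braid_group n\<^esub> b"
    using that b by (simp add: lcls_eq_iff)
  have "b \<in> braid_level n l #>\<^bsub>braid_group n\<^esub> b"
    by (rule group.rcos_self[OF group_braid_group b normal_imp_subgroup[OF braid_level_normal]])
  then have mem: "burau n b \<in> burau n ` (braid_level n l #>\<^bsub>braid_group n\<^esub> b)" by (rule imageI)
  have "burau n ` (braid_level n l #>\<^bsub>braid_group n\<^esub> b) \<subseteq> lcls n l (burau n b)"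
    using elem by (auto simp: lcls_def)
  from lcls_absorb[OF burau_Gamma[OF b] this mem]
  show "burau_quot n l (braid_level n l #>\<^bsub>braid_group n\<^esub> b) = lcls n l (burau n b)"
    unfolding burau_quot_def .
qed

text \<open>The first isomorphism theorem provides an isomorphism defined by
  \<open>the_elem\<close>; on the coset of \<open>b\<close> it takes the class of
  \<open>burau n b\<close>, exactly as \<open>burau_quot\<close> does.\<close>

lemma burau_quot_iso: "burau_quot n l \<in> iso (braid_quot n l) (burau_image n l)"
proof -
  interpret group_hom "braid_group n" "burau_image n l" "\<lambda>b. lcls n l (burau n b)"
    by (rule group_hom_burau)
  have ker: "kernel (braid_group n) (burau_image n l) (\<lambda>b. lcls n l (burau n b)) = braid_level n l"
    using lcls_burau_kernel[of n l] by (simp add: kernel_def burau_image_def)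
  have iso: "(\<lambda>X. the_elem ((\<lambda>b. lcls n l (burau n b)) ` X)) \<in> iso (braid_quot n l) (burau_image n l)"
    using FactGroup_iso_set unfolding ker by (simp add: burau_image_def)
  have eq: "the_elem ((\<lambda>b. lcls n l (burau n b)) ` X) = burau_quot n l X"
    if X: "X \<in> carrier (braid_quot n l)" for X
  proof -
    obtain b where b: "b \<in> carrier (braid_group n)" "X = braid_level n l #>\<^bsub>braid_group n\<^esub> b"
      using X by (auto simp: carrier_FactGroup)
    have "b \<in> X" unfolding b(2)
      by (rule group.rcos_self[OF group_braid_group b(1) normal_imp_subgroup[OF braid_level_normal]])
    then have "(\<lambda>b. lcls n l (burau n b)) ` X = {lcls n l (burau n b)}"
      using burau_quot_coset(2)[OF b(1), of _ l] unfolding b(2) by blast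
    then show ?thesis using burau_quot_coset(1)[OF b(1)] b(2) by simp
  qed
  show ?thesis
    by (rule group.iso_eq[OF normal.factorgroup_is_group[OF braid_level_normal] iso]) (simp add: eq)
qed

section \<open>The symmetric group modulo 2 and the extension\<close>

text \<open>Modulo 2, \<open>A\<close> sends the basis vector numbered \<open>r\<close> to the one
  numbered \<open>p r\<close>; in this direction matrix products correspond to compositions in the
  same order. Permutations act on \<open>{1..n}\<close> while coordinates start at 0, hence the
  subtractions.\<close>

definition perm_cong :: "nat \<Rightarrow> int mat \<Rightarrow> (nat \<Rightarrow> nat) \<Rightarrow> bool" where
  "perm_cong n A p \<longleftrightarrow> (\<forall>x\<in>carrier_vec n. \<forall>r\<in>{1..n}. [(A *\<^sub>v x) $ (p r - 1) = x $ (r - 1)] (mod 2))"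

lemma permutes_index:
  fixes n :: nat
  assumes "p permutes {1..n}" "r \<in> {1..n}"
  shows "p r \<in> {1..n} \<and> p r - 1 < n"
proof -
  have "p r \<in> {1..n}" using permutes_in_image[OF assms(1)] assms(2) by blast
  then have "1 \<le> p r" "p r \<le> n" by simp_all
  then show ?thesis unfolding atLeastAtMost_iff by linarith
qed

lemma perm_cong_mult:
  assumes "A \<in> carrier (Gamma n)" "B \<in> carrier (Gamma n)" "q permutes {1..n}"
    "perm_cong n A p" "perm_cong n B q"
  shows "perm_cong n (A * B) (p \<circ> q)"
  unfolding perm_cong_def
proof (intro ballI)
  fix x :: "int vec" and r assume x: "x \<in> carrier_vec n" and r: "r \<in> {1..n}"
  have q: "q r \<in> {1..n}" using permutes_index[OF assms(3) r] by blast
  have "[(A *\<^sub>v (B *\<^sub>v x)) $ (p (q r) - 1) = (B *\<^sub>v x) $ (q r - 1)] (mod 2)"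
    using assms(4) q Gamma_act[OF assms(2) x] unfolding perm_cong_def by blast
  also have "[(B *\<^sub>v x) $ (q r - 1) = x $ (r - 1)] (mod 2)"
    using assms(5) x r unfolding perm_cong_def by blast
  finally show "[(A * B *\<^sub>v x) $ ((p \<circ> q) r - 1) = x $ (r - 1)] (mod 2)"
    using assms x by (simp add: Gamma_act_mult[of _ n])
qed

lemma perm_cong_mcong:
  assumes "perm_cong n A p" "p permutes {1..n}" "mcong n 2 B A"
  shows "perm_cong n B p"
  unfolding perm_cong_def
proof (intro ballI)
  fix x :: "int vec" and r assume x: "x \<in> carrier_vec n" and r: "r \<in> {1..n}"
  have "[(B *\<^sub>v x) $ (p r - 1) = (A *\<^sub>v x) $ (p r - 1)] (mod 2)"
    using assms(3) x permutes_index[OF assms(2) r] unfolding mcong_def vcong_def by blast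
  also have "[(A *\<^sub>v x) $ (p r - 1) = x $ (r - 1)] (mod 2)"
    using assms(1) x r unfolding perm_cong_def by blast
  finally show "[(B *\<^sub>v x) $ (p r - 1) = x $ (r - 1)] (mod 2)" .
qed

lemma mcong_perm_cong:
  assumes "perm_cong n A p" "perm_cong n B p" "p permutes {1..n}"
  shows "mcong n 2 A B"
  unfolding mcong_def vcong_def
proof (intro ballI allI impI)
  fix x :: "int vec" and i assume x: "x \<in> carrier_vec n" and i: "i < n"
  have "Suc i \<in> p ` {1..n}" using permutes_image[OF assms(3)] i by auto
  then obtain r where r: "r \<in> {1..n}" "p r - 1 = i" by force
  have "[(A *\<^sub>v x) $ i = x $ (r - 1)] (mod 2)" "[(B *\<^sub>v x) $ i = x $ (r - 1)] (mod 2)"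
    using assms(1,2) x r unfolding perm_cong_def by blast+
  then show "[(A *\<^sub>v x) $ i = (B *\<^sub>v x) $ i] (mod 2)" by (meson cong_sym cong_trans)
qed

lemma perm_cong_unique:
  assumes "perm_cong n A p" "perm_cong n A q" "p permutes {1..n}" "q permutes {1..n}"
  shows "p = q"
proof
  fix r
  show "p r = q r"
  proof (cases "r \<in> {1..n}")
    case True
    then have pr: "p r \<in> q ` {1..n}" using permutes_image[OF assms(4)] permutes_index[OF assms(3)] by simp
    then obtain s where s: "s \<in> {1..n}" "p r = q s" by blast
    let ?x = "unit_vec n (r - 1) :: int vec"
    have "[(A *\<^sub>v ?x) $ (q s - 1) = ?x $ (r - 1)] (mod 2)"
      using assms(1)[unfolded perm_cong_def, rule_format, OF unit_vec_carrier True] unfolding s(2) .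
    then have "[?x $ (r - 1) = ?x $ (s - 1)] (mod 2)"
      using assms(2)[unfolded perm_cong_def, rule_format, OF unit_vec_carrier s(1)]
      by (rule cong_trans[OF cong_sym])
    then have "r - 1 = s - 1" using True s(1) by (cases "r - 1 = s - 1") (auto simp: cong_def)
    moreover have "1 \<le> r" "1 \<le> s" using True s(1) by simp_all
    ultimately have "r = s" by linarith
    then show ?thesis using s(2) by simp
  next
    case False
    then show ?thesis using assms(3,4) by (simp add: permutes_def)
  qed
qed

lemma perm_cong_transv:
  assumes "Suc i < n"
  shows "perm_cong n (transv n 1 (cvec n i)) (Transposition.transpose (Suc i) (Suc (Suc i)))"
  unfolding perm_cong_def
proof (intro ballI)
  fix x :: "int vec" and r assume x: "x \<in> carrier_vec n" and r: "r \<in> {1..n}"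
  consider "r = Suc i" | "r = Suc (Suc i)" | "r \<noteq> Suc i" "r \<noteq> Suc (Suc i)" by blast
  then show "[(transv n 1 (cvec n i) *\<^sub>v x) $ (Transposition.transpose (Suc i) (Suc (Suc i)) r - 1)
      = x $ (r - 1)] (mod 2)"
  proof cases
    case 1
    then show ?thesis using x assms by (simp add: transv_action alt_form_cvec)
  next
    case 2
    have "[2 * x $ i - x $ Suc i = x $ Suc i] (mod 2)" by (simp add: cong_iff_dvd_diff)
    then show ?thesis using 2 x assms by (simp add: transv_action alt_form_cvec)
  next
    case 3
    then have "r - 1 \<noteq> i" "r - 1 \<noteq> Suc i" "r - 1 < n" using r by auto
    then show ?thesis using 3 x assms by (simp add: transv_action alt_form_cvec)
  qed
qed

lemma adjacent_permutes: "Suc i < n \<Longrightarrow> Transposition.transpose (Suc i) (Suc (Suc i)) permutes {1..n}"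
  by (rule permutes_swap_id) auto

lemma perm_cong_one: "perm_cong n (1\<^sub>m n) id"
  by (simp add: perm_cong_def)

lemma braid_image_perm:
  assumes "A \<in> braid_image n"
  obtains p where "p permutes {1..n}" "perm_cong n A p"
proof -
  obtain w where w: "w \<in> braid_words n" "A = burau_word n w" using assms by (auto simp: braid_image_def)
  have "\<exists>p. p permutes {1..n} \<and> perm_cong n (burau_word n w) p"
    using w(1)
  proof (induction w)
    case Nil
    show ?case unfolding burau_word_simps by (intro exI[of _ id] conjI permutes_id perm_cong_one)
  next
    case (Cons x w)
    obtain i s where x: "x = (i, s)" by (cases x)
    have i: "i \<in> {1..<n}" and w: "w \<in> braid_words n" using Cons.prems x by (auto simp: braid_words_def)
    then obtain p where p: "p permutes {1..n}" "perm_cong n (burau_word n w) p" using Cons.IH by blast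
    have i': "Suc (i - 1) < n" using i by auto
    let ?t = "Transposition.transpose (Suc (i - 1)) (Suc (Suc (i - 1)))"
    \<comment> \<open>A generator and its inverse agree modulo 2, as the exponents 1 and -1
      do.\<close>
    have "mcong n 2 (burau_letter n x) (transv n 1 (cvec n (i - 1)))"
      unfolding x burau_letter_transv[OF i] by (intro transv_mcong) (auto simp: cong_def)
    then have "perm_cong n (burau_letter n x) ?t"
      by (rule perm_cong_mcong[OF perm_cong_transv[OF i'] adjacent_permutes[OF i']])
    moreover have "burau_letter n x \<in> carrier (Gamma n)" using i x burau_letter_Gamma by blast
    ultimately have "perm_cong n (burau_word n (x # w)) (?t \<circ> p)"
      using perm_cong_mult[OF _ burau_word_Gamma[OF w] p(1) _ p(2)] by simp
    then show ?case using permutes_compose[OF p(1) adjacent_permutes[OF i']] by blast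
  qed
  then show thesis using that w by blast
qed

text \<open>Adjacent transpositions come from the generators, conjugation lengthens them to
  arbitrary transpositions, and these generate all permutations.\<close>

lemma perm_braid_image:
  assumes "p permutes {1..n}"
  obtains A where "A \<in> braid_image n" "perm_cong n A p"
proof -
  define P where "P p \<longleftrightarrow> p permutes {1..n} \<and> (\<exists>A\<in>braid_image n. perm_cong n A p)" for p
  have comp: "P (p \<circ> q)" if pq: "P p" "P q" for p q
  proof -
    obtain A where A: "A \<in> braid_image n" "perm_cong n A p" using pq(1) unfolding P_def by blast
    obtain B where B: "B \<in> braid_image n" "perm_cong n B q" using pq(2) unfolding P_def by blast
    have "perm_cong n (A * B) (p \<circ> q)"
      using A B pq unfolding P_def by (intro perm_cong_mult) auto
    moreover have "p \<circ> q permutes {1..n}" using pq permutes_compose unfolding P_def by blast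
    ultimately show ?thesis unfolding P_def using G.H_mult[OF A(1) B(1)] by blast
  qed
  have one: "P id" unfolding P_def using perm_cong_one[of n] G.H_one[of n] permutes_id by blast
  have adj: "P (Transposition.transpose i (Suc i))" if "1 \<le> i" "Suc i \<le> n" for i
  proof -
    have i: "Suc (i - 1) < n" "Suc (i - 1) = i" using that by auto
    show ?thesis
      using perm_cong_transv[OF i(1)] adjacent_permutes[OF i(1)] cvec_braid_image[OF i(1), of 1]
      unfolding P_def i(2) by blast
  qed
  have transp: "P (Transposition.transpose a (a + Suc d))" if "1 \<le> a" "a + Suc d \<le> n" for a d
    using that
  proof (induction d)
    case 0
    then show ?case using adj[of a] by simp
  next
    case (Suc d)
    let ?b = "a + Suc d"
    have "Transposition.transpose a (Suc ?b) =
        Transposition.transpose ?b (Suc ?b) \<circ> (Transposition.transpose a ?b \<circ> Transposition.transpose ?b (Suc ?b))"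
      by (auto simp: fun_eq_iff Transposition.transpose_def)
    moreover have "P (Transposition.transpose ?b (Suc ?b))" "P (Transposition.transpose a ?b)"
      using adj[of ?b] Suc by auto
    ultimately show ?case using comp by (metis add_Suc_right)
  qed
  have "P p"
    using assms finite_atLeastAtMost
  proof (induction rule: permutes_induct)
    case (swap a b p)
    have "P (Transposition.transpose a b)"
    proof (cases "a < b")
      case True
      then show ?thesis using transp[of a "b - Suc a"] swap.hyps by simp
    next
      case False
      then show ?thesis using transp[of b "a - Suc b"] swap.hyps by (simp add: transpose_commute)
    qed
    then show ?case using comp swap.IH by blast
  qed (rule one)
  then show thesis using that unfolding P_def by blast
qed

text \<open>The explicit embedding of the symmetric group that proves existence in the theorem.
  Describing the coset by \<open>perm_cong\<close> avoids choosing a representative.\<close>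

definition perm_coset :: "nat \<Rightarrow> (nat \<Rightarrow> nat) \<Rightarrow> int mat set" where
  "perm_coset n p = {A \<in> carrier (Gamma n). perm_cong n A p}"

lemma perm_coset_lcls:
  assumes "p permutes {1..n}" "perm_cong n A p"
  shows "perm_coset n p = lcls n 2 A"
  unfolding perm_coset_def lcls_def
  using mcong_perm_cong[OF _ assms(2,1)] perm_cong_mcong[OF assms(2,1)] by auto

lemma perm_coset_mon: "perm_coset n \<in> mon (sym_group n) (Gamma_quot n 2)"
  unfolding mon_def mem_Collect_eq
proof
  show "perm_coset n \<in> hom (sym_group n) (Gamma_quot n 2)"
  proof (rule homI)
    fix p assume "p \<in> carrier (sym_group n)"
    then have p: "p permutes {1..n}" by (simp add: sym_group_def)
    obtain A where A: "A \<in> braid_image n" "perm_cong n A p" using perm_braid_image[OF p] by blast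
    show "perm_coset n p \<in> carrier (Gamma_quot n 2)"
      unfolding perm_coset_lcls[OF p A(2)] carrier_Gamma_quot using A(1) by simp
    fix q assume "q \<in> carrier (sym_group n)"
    then have q: "q permutes {1..n}" by (simp add: sym_group_def)
    obtain B where B: "B \<in> braid_image n" "perm_cong n B q" using perm_braid_image[OF q] by blast
    have "perm_coset n (p \<circ> q) = lcls n 2 (A * B)"
      using A B q by (intro perm_coset_lcls permutes_compose[OF q p] perm_cong_mult) auto
    then show "perm_coset n (p \<otimes>\<^bsub>sym_group n\<^esub> q) = perm_coset n p \<otimes>\<^bsub>Gamma_quot n 2\<^esub> perm_coset n q"
      using A(1) B(1) by (simp add: sym_group_def perm_coset_lcls[OF p A(2)] perm_coset_lcls[OF q B(2)] lcls_mult)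
  qed
  show "inj_on (perm_coset n) (carrier (sym_group n))"
  proof (rule inj_onI)
    fix p q assume "p \<in> carrier (sym_group n)" "q \<in> carrier (sym_group n)" and eq: "perm_coset n p = perm_coset n q"
    then have p: "p permutes {1..n}" and q: "q permutes {1..n}" by (simp_all add: sym_group_def)
    obtain A where A: "A \<in> braid_image n" "perm_cong n A p" using perm_braid_image[OF p] by blast
    then have "A \<in> perm_coset n p" by (simp add: perm_coset_def)
    then have "A \<in> perm_coset n q" by (simp only: eq)
    then show "p = q" using perm_cong_unique[OF A(2) _ p q] unfolding perm_coset_def by blast
  qed
qed

lemma perm_coset_image:
  "perm_coset n ` carrier (sym_group n) = (\<lambda>b. lcls n 2 (burau n b)) ` carrier (braid_group n)"
proof -
  have "perm_coset n ` carrier (sym_group n) = lcls n 2 ` braid_image n"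
  proof (intro equalityI subsetI)
    fix X assume "X \<in> perm_coset n ` carrier (sym_group n)"
    then obtain p where p: "p permutes {1..n}" "X = perm_coset n p" by (auto simp: sym_group_def)
    obtain A where "A \<in> braid_image n" "perm_cong n A p" using perm_braid_image[OF p(1)] by blast
    then show "X \<in> lcls n 2 ` braid_image n" using perm_coset_lcls[OF p(1)] p(2) by blast
  next
    fix X assume "X \<in> lcls n 2 ` braid_image n"
    then obtain A where A: "A \<in> braid_image n" "X = lcls n 2 A" by blast
    obtain p where "p permutes {1..n}" "perm_cong n A p" using braid_image_perm[OF A(1)] by blast
    then show "X \<in> perm_coset n ` carrier (sym_group n)"
      using perm_coset_lcls[of p n A] A(2) by (auto simp: sym_group_def)
  qed
  then show ?thesis by (simp add: burau_image[symmetric] image_image)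
qed

lemma burau_cosets:
  "(\<lambda>b. Gamma_level n l #>\<^bsub>Gamma n\<^esub> burau n b) ` carrier (braid_group n)
    = (\<lambda>b. lcls n l (burau n b)) ` carrier (braid_group n)"
  by (intro image_cong HOL.refl Gamma_level_coset burau_Gamma)

lemma Sn_embedding_perm_coset: "Sn_embedding n (perm_coset n)"
  unfolding Sn_embedding_def burau_cosets using perm_coset_mon perm_coset_image by blast

lemma sym_group_iso: "sym_group n \<cong> burau_image n 2"
proof (rule is_isoI)
  show "perm_coset n \<in> iso (sym_group n) (burau_image n 2)"
    using perm_coset_mon[of n] perm_coset_image[of n]
    by (auto simp: iso_iff mon_def hom_def burau_image_def)
qed

lemma Gamma_reduce_lcls:
  assumes "A \<in> carrier (Gamma n)" "d dvd l"
  shows "Gamma_reduce n d (lcls n l A) = lcls n d A"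
  unfolding Gamma_reduce_def
proof (rule lcls_absorb[OF assms(1)])
  have "int d dvd int l" using assms(2) by simp
  then show "lcls n l A \<subseteq> lcls n d A" by (auto simp: lcls_def intro: mcong_dvd)
  show "A \<in> lcls n l A" using assms(1) by (simp add: lcls_def)
qed

text \<open>If the class of \<open>A\<close> modulo 2 comes from a braid \<open>b\<close>, then
  \<open>A\<close> divided by the image of \<open>b\<close> has level 2 and is approximated modulo
  \<open>2 ^ k\<close> by \<open>approx_two_power\<close>. Only the image of \<open>\<iota>\<close>
  matters, so the result holds for every embedding.\<close>

lemma Sn_preimage_eq:
  assumes "Sn_embedding n \<iota>" "1 \<le> k"
  shows "Sn_preimage n \<iota> (2 ^ k) = burau_image n (2 ^ k)"
proof -
  have img: "\<iota> ` carrier (sym_group n) = (\<lambda>b. lcls n 2 (burau n b)) ` carrier (braid_group n)"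
    using assms(1) unfolding Sn_embedding_def burau_cosets by blast
  have dvd: "2 dvd (2 ^ k :: nat)" using assms(2) by simp
  have "{X \<in> carrier (Gamma_quot n (2 ^ k)). Gamma_reduce n 2 X \<in> \<iota> ` carrier (sym_group n)} =
      (\<lambda>b. lcls n (2 ^ k) (burau n b)) ` carrier (braid_group n)"
  proof (intro equalityI subsetI)
    fix X assume "X \<in> {X \<in> carrier (Gamma_quot n (2 ^ k)). Gamma_reduce n 2 X \<in> \<iota> ` carrier (sym_group n)}"
    then obtain A b where A: "A \<in> carrier (Gamma n)" "X = lcls n (2 ^ k) A"
      and b: "b \<in> carrier (braid_group n)" "Gamma_reduce n 2 X = lcls n 2 (burau n b)"
      unfolding img carrier_Gamma_quot by blast
    have "lcls n 2 A = lcls n 2 (burau n b)" using Gamma_reduce_lcls[OF A(1) dvd] A(2) b(2) by simp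
    then have "mcong n 2 A (burau n b)" using lcls_eq_iff[OF A(1) burau_Gamma[OF b(1)], of 2] by simp
    then have q: "mcong n 2 (inv\<^bsub>Gamma n\<^esub> (burau n b) * A) (1\<^sub>m n)"
      by (rule Gamma_quotient_cong[OF A(1) burau_Gamma[OF b(1)]])
    have bG: "burau n b \<in> carrier (Gamma n)" using b(1) by simp
    have qG: "inv\<^bsub>Gamma n\<^esub> (burau n b) * A \<in> carrier (Gamma n)" using bG A(1) by simp
    have "inv\<^bsub>Gamma n\<^esub> (burau n b) * A \<in> approx n (2 ^ k) 1"
      by (rule approx_two_power[OF qG q assms(2)])
    moreover have "burau n b \<in> approx n (2 ^ k) 1"
    proof (rule approx_I[OF bG])
      show "burau n b \<in> braid_image n" using b(1) burau_image by blast
      show "mcong n 1 (burau n b) (1\<^sub>m n)" by (simp add: mcong_def vcong_def)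
    qed simp
    ultimately have "A \<in> approx n (2 ^ k) 1"
      using approx.H_mult[of "burau n b" n "2 ^ k" 1] Gamma_factor[OF A(1) bG] by metis
    then obtain B where B: "B \<in> braid_image n" "mcong n (2 ^ k) A B" unfolding approx_def by blast
    then obtain c where c: "c \<in> carrier (braid_group n)" "B = burau n c" using burau_image by blast
    have "X = lcls n (2 ^ k) (burau n c)"
      using B(2) A c lcls_eq_iff[OF A(1) burau_Gamma[OF c(1)], of "2 ^ k"] by simp
    then show "X \<in> (\<lambda>b. lcls n (2 ^ k) (burau n b)) ` carrier (braid_group n)" using c(1) by blast
  next
    fix X assume "X \<in> (\<lambda>b. lcls n (2 ^ k) (burau n b)) ` carrier (braid_group n)"
    then obtain b where b: "b \<in> carrier (braid_group n)" "X = lcls n (2 ^ k) (burau n b)" by blast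
    then show "X \<in> {X \<in> carrier (Gamma_quot n (2 ^ k)). Gamma_reduce n 2 X \<in> \<iota> ` carrier (sym_group n)}"
      unfolding img carrier_Gamma_quot using Gamma_reduce_lcls[OF burau_Gamma[OF b(1)] dvd] by auto
  qed
  then show ?thesis by (simp add: Sn_preimage_def burau_image_def)
qed

section \<open>Decomposition of the quotients of the braid group\<close>

lemma pair_exp_cases: "pair_exp n = 1 \<or> pair_exp n = 2"
  by (simp add: pair_exp_def)

text \<open>Approximate \<open>A B^{-1}\<close> modulo \<open>m\<close> by some \<open>E\<close> in
  the image that is trivial modulo \<open>2 ^ k\<close>, and take \<open>E B\<close>.\<close>

lemma braid_image_crt:
  assumes "odd m" "0 < n" "A \<in> carrier (Gamma n)" "B \<in> braid_image n"
  obtains C where "C \<in> braid_image n" "mcong n (2 ^ k) C B" "mcong n (int m) C A"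
proof -
  have BG: "B \<in> carrier (Gamma n)" using assms(4) by simp
  let ?D = "A * inv\<^bsub>Gamma n\<^esub> B"
  have D: "?D \<in> carrier (Gamma n)" using assms(3) BG by simp
  have "coprime (int m) (pair_exp n * 2 ^ k)" using assms(1) pair_exp_cases[of n] by auto
  moreover have "0 < m" using assms(1) by (rule odd_pos)
  ultimately have "?D \<in> approx n (int m) (2 ^ k)" using approx_coprime[of m n "2 ^ k"] assms(2) D by blast
  then obtain E where E: "E \<in> braid_image n" "mcong n (int m) ?D E" "mcong n (2 ^ k) E (1\<^sub>m n)"
    unfolding approx_def by blast
  have EG: "E \<in> carrier (Gamma n)" using E(1) by simp
  show thesis
  proof (rule that)
    show "E * B \<in> braid_image n" by (rule G.H_mult[OF E(1) assms(4)])
    have "mcong n (2 ^ k) (E * B) (1\<^sub>m n * B)" using E EG BG by (intro mcong_mult) auto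
    then show "mcong n (2 ^ k) (E * B) B" by (simp add: left_mult_one_mat[OF Gamma_carrier_mat[OF BG]])
    have "mcong n (int m) (E * B) (?D * B)" using E(2) EG BG D by (intro mcong_mult mcong_sym[of n "int m" ?D]) auto
    also have "?D * B = A"
      using Gamma_assoc[OF assms(3) _ BG, of "inv\<^bsub>Gamma n\<^esub> B"] BG
        right_mult_one_mat[OF Gamma_carrier_mat[OF assms(3)]] by simp
    finally show "mcong n (int m) (E * B) A" .
  qed
qed

text \<open>With \<open>pair_exp n = 1\<close> and \<open>K = 1\<close> the coprimality condition of
  \<open>approx_coprime\<close> holds for every \<open>l\<close>, even or odd.\<close>

lemma braid_quot_iso_small:
  assumes "n \<in> {2, 3}" "0 < l"
  shows "braid_quot n l \<cong> Gamma_quot n l"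
proof -
  have "pair_exp n = 1" using assms(1) by (auto simp: pair_exp_def)
  then have approx: "carrier (Gamma n) \<subseteq> approx n (int l) 1"
    using assms by (intro approx_coprime) auto
  have "carrier (Gamma_quot n l) \<subseteq> (\<lambda>b. lcls n l (burau n b)) ` carrier (braid_group n)"
  proof
    fix X assume "X \<in> carrier (Gamma_quot n l)"
    then obtain A where A: "A \<in> carrier (Gamma n)" "X = lcls n l A" by (auto simp: carrier_Gamma_quot)
    then obtain B where B: "B \<in> braid_image n" "mcong n (int l) A B" using approx unfolding approx_def by blast
    then obtain b where b: "b \<in> carrier (braid_group n)" "B = burau n b" using burau_image by blast
    then have "X = lcls n l (burau n b)"
      using A B lcls_eq_iff[OF A(1) burau_Gamma[OF b(1)]] by simp
    then show "X \<in> (\<lambda>b. lcls n l (burau n b)) ` carrier (braid_group n)" using b(1) by blast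
  qed
  then have "(\<lambda>b. lcls n l (burau n b)) ` carrier (braid_group n) = carrier (Gamma_quot n l)"
    by (auto simp: carrier_Gamma_quot)
  then have "burau_image n l = Gamma_quot n l" by (simp add: burau_image_def)
  then show ?thesis using is_isoI[OF burau_quot_iso[of n l]] by simp
qed

lemma braid_level_iff:
  "b \<in> carrier (braid_group n) \<Longrightarrow> b \<in> braid_level n l \<longleftrightarrow> mcong n (int l) (burau n b) (1\<^sub>m n)"
  by (simp add: braid_level_def cong_one_mat_iff)

lemma braid_level_carrier: "b \<in> braid_level n l \<Longrightarrow> b \<in> carrier (braid_group n)"
  by (simp add: braid_level_def)

text \<open>The braid group maps to both factors. The kernel is the intersection of the levels
  \<open>2 ^ k\<close> and \<open>m\<close>, which is the level of their product; surjectivity is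
  \<open>braid_image_crt\<close>.\<close>

lemma braid_quot_iso_product:
  assumes "odd m" "0 < n"
  shows "braid_quot n (2 ^ k * m) \<cong> braid_quot n (2 ^ k) \<times>\<times> Gamma_quot n m"
proof -
  let ?N = "braid_level n (2 ^ k)"
  let ?f = "\<lambda>b. (?N #>\<^bsub>braid_group n\<^esub> b, lcls n m (burau n b))"
  interpret N: normal ?N "braid_group n" by (rule braid_level_normal)
  have grp: "group (braid_quot n (2 ^ k) \<times>\<times> Gamma_quot n m)"
    by (intro DirProd_group N.factorgroup_is_group group_Gamma_quot)
  have f_hom: "?f \<in> hom (braid_group n) (braid_quot n (2 ^ k) \<times>\<times> Gamma_quot n m)"
    using N.r_coset_hom_Mod lcls_burau_hom[of n m] by (auto simp: hom_def)
  interpret group_hom "braid_group n" "braid_quot n (2 ^ k) \<times>\<times> Gamma_quot n m" ?f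
    by (intro group_hom.intro group_hom_axioms.intro group_braid_group grp f_hom)
  have cop: "coprime (2 ^ k) (int m)" using assms(1) by simp
  have level: "b \<in> braid_level n (2 ^ k * m) \<longleftrightarrow> b \<in> ?N \<and> b \<in> braid_level n m" if "b \<in> carrier (braid_group n)" for b
  proof -
    note mb = braid_level_iff[OF that]
    have ints: "int (2 ^ k * m) = 2 ^ k * int m" "int (2 ^ k) = 2 ^ k" by simp_all
    have "mcong n (2 ^ k * int m) (burau n b) (1\<^sub>m n) \<Longrightarrow> mcong n (2 ^ k) (burau n b) (1\<^sub>m n)"
      "mcong n (2 ^ k * int m) (burau n b) (1\<^sub>m n) \<Longrightarrow> mcong n (int m) (burau n b) (1\<^sub>m n)"
      by (erule mcong_dvd, simp)+
    then show ?thesis unfolding mb ints using mcong_coprime[OF _ _ cop] by blast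
  qed
  have "?f b = \<one>\<^bsub>braid_quot n (2 ^ k) \<times>\<times> Gamma_quot n m\<^esub> \<longleftrightarrow> b \<in> braid_level n (2 ^ k * m)"
    if b: "b \<in> carrier (braid_group n)" for b
  proof -
    have "?N #>\<^bsub>braid_group n\<^esub> b = ?N \<longleftrightarrow> b \<in> ?N"
      using b N.coset_join1[OF _ b N.subgroup_axioms] N.coset_join2[OF b N.subgroup_axioms] by blast
    moreover have "lcls n m (burau n b) = Gamma_level n m \<longleftrightarrow> b \<in> braid_level n m"
      using b lcls_burau_kernel[of n m] by (auto simp: kernel_def set_eq_iff)
    ultimately show ?thesis unfolding level[OF b] by simp
  qed
  then have ker: "kernel (braid_group n) (braid_quot n (2 ^ k) \<times>\<times> Gamma_quot n m) ?f = braid_level n (2 ^ k * m)"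
    unfolding kernel_def using braid_level_carrier by blast
  have "carrier (braid_quot n (2 ^ k) \<times>\<times> Gamma_quot n m) \<subseteq> ?f ` carrier (braid_group n)"
  proof
    fix Z assume "Z \<in> carrier (braid_quot n (2 ^ k) \<times>\<times> Gamma_quot n m)"
    then obtain b A where b: "b \<in> carrier (braid_group n)" and A: "A \<in> carrier (Gamma n)"
      and Z: "Z = (?N #>\<^bsub>braid_group n\<^esub> b, lcls n m A)"
      by (auto simp: carrier_FactGroup[of "braid_group n"] carrier_Gamma_quot)
    have "burau n b \<in> braid_image n" using b burau_image by blast
    then obtain C where C: "C \<in> braid_image n" "mcong n (2 ^ k) C (burau n b)" "mcong n (int m) C A"
      using braid_image_crt[OF assms A, of "burau n b" k] by blast
    then obtain c where c: "c \<in> carrier (braid_group n)" "C = burau n c" using burau_image by blast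
    have cb: "c \<otimes>\<^bsub>braid_group n\<^esub> inv\<^bsub>braid_group n\<^esub> b \<in> carrier (braid_group n)" using b c by simp
    have "burau n (c \<otimes>\<^bsub>braid_group n\<^esub> inv\<^bsub>braid_group n\<^esub> b) * burau n b = burau n c"
      using b c cb burau_mult[OF cb b] by (simp add: N.m_assoc)
    moreover have "burau n b * inv\<^bsub>Gamma n\<^esub> (burau n b) = 1\<^sub>m n" using b by simp
    ultimately have eq: "burau n (c \<otimes>\<^bsub>braid_group n\<^esub> inv\<^bsub>braid_group n\<^esub> b) = burau n c * inv\<^bsub>Gamma n\<^esub> (burau n b)"
      using Gamma_assoc[OF burau_Gamma[OF cb] burau_Gamma[OF b] Gamma.inv_closed[OF burau_Gamma[OF b]]]
        right_mult_one_mat[OF Gamma_carrier_mat[OF burau_Gamma[OF cb]]] by simp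
    have "mcong n (2 ^ k) (burau n c * inv\<^bsub>Gamma n\<^esub> (burau n b)) (burau n b * inv\<^bsub>Gamma n\<^esub> (burau n b))"
      using C(2) b c by (intro mcong_mult) auto
    then have "c \<otimes>\<^bsub>braid_group n\<^esub> inv\<^bsub>braid_group n\<^esub> b \<in> ?N"
      using b unfolding braid_level_iff[OF cb] eq by simp
    then have "?N #>\<^bsub>braid_group n\<^esub> c = ?N #>\<^bsub>braid_group n\<^esub> b"
      using N.repr_independence[OF _ b N.subgroup_axioms, of c] b c
      by (metis N.rcos_module_rev N.subgroup_axioms N.is_group)
    moreover have "lcls n m (burau n c) = lcls n m A" using C(3) c A by (simp add: lcls_eq_iff)
    ultimately show "Z \<in> ?f ` carrier (braid_group n)" using Z c(1) by (intro image_eqI[of _ _ c]) simp_all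
  qed
  then have "?f ` carrier (braid_group n) = carrier (braid_quot n (2 ^ k) \<times>\<times> Gamma_quot n m)"
    using hom_carrier[OF f_hom] by blast
  from FactGroup_iso[OF this] show ?thesis unfolding ker .
qed

lemma braid_quot_trivial: "trivial_group (braid_quot n 1)"
proof -
  have full: "carrier (braid_group n) \<subseteq> braid_level n 1"
    by (auto simp: braid_level_def cong_one_mat_def)
  interpret N: normal "braid_level n 1" "braid_group n" by (rule braid_level_normal)
  have "braid_level n 1 #>\<^bsub>braid_group n\<^esub> b = braid_level n 1" if "b \<in> carrier (braid_group n)" for b
    using subsetD[OF full that] by (rule N.coset_join2[OF that N.subgroup_axioms])
  then have "(\<lambda>b. braid_level n 1 #>\<^bsub>braid_group n\<^esub> b) ` carrier (braid_group n)
      = (\<lambda>_. braid_level n 1) ` carrier (braid_group n)" by (rule image_cong[OF HOL.refl])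
  also have "\<dots> = {braid_level n 1}" by (rule image_constant[OF N.one_closed])
  finally have "carrier (braid_quot n 1) = {braid_level n 1}" unfolding carrier_FactGroup .
  then show ?thesis unfolding trivial_group_def using N.factorgroup_is_group by simp
qed

text \<open>
  An involution \<open>A\<close> modulo 4 satisfies \<open>\<langle>A x, x\<rangle> \<equiv> \<langle>x, A x\<rangle> = - \<langle>A x, x\<rangle>\<close> modulo 4, so
  \<open>\<langle>A x, x\<rangle>\<close> is even. For the transvection along \<open>c\<^sub>0\<close> and \<open>x = e\<^sub>0\<close> it is odd.
\<close>

lemma no_involution_lift:
  assumes "A \<in> carrier (Gamma n)" "2 \<le> n" "mcong n 4 (A * A) (1\<^sub>m n)"
    "mcong n 2 A (transv n 1 (cvec n 0))"
  shows False
proof -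
  let ?e = "fvec n 0" and ?c = "cvec n 0"
  have n: "Suc 0 < n" using assms(2) by simp
  have Ae: "A *\<^sub>v ?e \<in> carrier_vec n" using assms(1) by (rule Gamma_act) simp
  have "vcong n 4 (A *\<^sub>v (A *\<^sub>v ?e)) ?e"
    using assms(1,3) unfolding mcong_def by (metis Gamma_act_mult fvec_carrier one_mult_mat_vec)
  then have "[alt_form n (A *\<^sub>v (A *\<^sub>v ?e)) (A *\<^sub>v ?e) = alt_form n ?e (A *\<^sub>v ?e)] (mod 4)"
    by (rule alt_form_vcong) simp
  then have "[alt_form n (A *\<^sub>v ?e) ?e = - alt_form n (A *\<^sub>v ?e) ?e] (mod 4)"
    using Gamma_form[OF assms(1) Ae, of ?e] alt_form_swap[of n ?e "A *\<^sub>v ?e"] by simp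
  then have "even (alt_form n (A *\<^sub>v ?e) ?e)"
    unfolding cong_iff_dvd_diff by presburger
  moreover have "vcong n 2 (A *\<^sub>v ?e) (transv n 1 ?c *\<^sub>v ?e)"
    using assms(4) unfolding mcong_def by simp
  then have "[alt_form n (A *\<^sub>v ?e) ?e = alt_form n (transv n 1 ?c *\<^sub>v ?e) ?e] (mod 2)"
    by (rule alt_form_vcong) simp
  moreover have "alt_form n (transv n 1 ?c *\<^sub>v ?e) ?e = -1"
    using n by (simp add: transv_action alt_form_fvec_cvec)
  ultimately show False by (simp add: cong_iff_dvd_diff)
qed

section \<open>The extension of the symmetric group\<close>

lemma Sn_projection_props:
  assumes emb: "Sn_embedding n \<iota>" and k: "1 \<le> k" and X: "X \<in> carrier (Sn_preimage n \<iota> (2 ^ k))"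
  shows "Sn_projection n \<iota> X \<in> carrier (sym_group n)" "\<iota> (Sn_projection n \<iota> X) = Gamma_reduce n 2 X"
proof -
  have "Gamma_reduce n 2 X \<in> \<iota> ` carrier (sym_group n)" using X by (simp add: Sn_preimage_def)
  then show "Sn_projection n \<iota> X \<in> carrier (sym_group n)" "\<iota> (Sn_projection n \<iota> X) = Gamma_reduce n 2 X"
    unfolding Sn_projection_def by (rule inv_into_into, rule f_inv_into_f)
qed

lemma Sn_preimage_cases:
  assumes "Sn_embedding n \<iota>" "1 \<le> k" "X \<in> carrier (Sn_preimage n \<iota> (2 ^ k))"
  obtains A where "A \<in> carrier (Gamma n)" "X = lcls n (2 ^ k) A" "Gamma_reduce n 2 X = lcls n 2 A"
proof -
  obtain A where A: "A \<in> carrier (Gamma n)" "X = lcls n (2 ^ k) A"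
    using assms(3) by (auto simp: Sn_preimage_def carrier_Gamma_quot)
  then show thesis using that Gamma_reduce_lcls[OF A(1), of 2 "2 ^ k"] assms(2) by simp
qed

text \<open>Multiplicativity is checked after applying the injective \<open>\<iota>\<close>, where
  the projection becomes reduction modulo 2. Surjectivity holds because the image of
  \<open>\<iota>\<close> consists of classes of braids.\<close>

lemma Sn_projection_epi:
  assumes emb: "Sn_embedding n \<iota>" and k: "1 \<le> k"
  shows "Sn_projection n \<iota> \<in> epi (Sn_preimage n \<iota> (2 ^ k)) (sym_group n)"
proof -
  let ?E = "Sn_preimage n \<iota> (2 ^ k)"
  note proj = Sn_projection_props[OF emb k]
  have mon: "\<iota> \<in> hom (sym_group n) (Gamma_quot n 2)" "inj_on \<iota> (carrier (sym_group n))"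
    using emb by (auto simp: Sn_embedding_def mon_def)
  interpret E: group ?E
    unfolding Sn_preimage_eq[OF emb k] using group_hom_burau group_hom.axioms(2) by blast
  interpret S: group "sym_group n" by (rule sym_group_is_group)
  have hom: "Sn_projection n \<iota> \<in> hom ?E (sym_group n)"
  proof (rule homI)
    fix X Y assume X: "X \<in> carrier ?E" and Y: "Y \<in> carrier ?E"
    then have XY: "X \<otimes>\<^bsub>?E\<^esub> Y \<in> carrier ?E" by simp
    obtain A where A: "A \<in> carrier (Gamma n)" "X = lcls n (2 ^ k) A" "Gamma_reduce n 2 X = lcls n 2 A"
      using Sn_preimage_cases[OF emb k X] by blast
    obtain B where B: "B \<in> carrier (Gamma n)" "Y = lcls n (2 ^ k) B" "Gamma_reduce n 2 Y = lcls n 2 B"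
      using Sn_preimage_cases[OF emb k Y] by blast
    have "X \<otimes>\<^bsub>?E\<^esub> Y = lcls n (2 ^ k) (A * B)" using A B by (simp add: Sn_preimage_def lcls_mult)
    then have "Gamma_reduce n 2 (X \<otimes>\<^bsub>?E\<^esub> Y) = lcls n 2 (A * B)"
      using A B k by (simp add: Gamma_reduce_lcls)
    also have "\<dots> = \<iota> (Sn_projection n \<iota> X) \<otimes>\<^bsub>Gamma_quot n 2\<^esub> \<iota> (Sn_projection n \<iota> Y)"
      unfolding proj(2)[OF X] proj(2)[OF Y] A(3) B(3) by (simp add: lcls_mult A(1) B(1))
    also have "\<dots> = \<iota> (Sn_projection n \<iota> X \<otimes>\<^bsub>sym_group n\<^esub> Sn_projection n \<iota> Y)"
      using hom_mult[OF mon(1) proj(1)[OF X] proj(1)[OF Y]] by simp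
    finally have "\<iota> (Sn_projection n \<iota> (X \<otimes>\<^bsub>?E\<^esub> Y)) = \<iota> (Sn_projection n \<iota> X \<otimes>\<^bsub>sym_group n\<^esub> Sn_projection n \<iota> Y)"
      by (simp add: proj(2)[OF XY])
    then show "Sn_projection n \<iota> (X \<otimes>\<^bsub>?E\<^esub> Y) = Sn_projection n \<iota> X \<otimes>\<^bsub>sym_group n\<^esub> Sn_projection n \<iota> Y"
      using inj_onD[OF mon(2)] proj(1)[OF XY] proj(1)[OF X] proj(1)[OF Y] S.m_closed by blast
  qed (rule proj(1))
  moreover have "carrier (sym_group n) \<subseteq> Sn_projection n \<iota> ` carrier ?E"
  proof
    fix q assume q: "q \<in> carrier (sym_group n)"
    then have "\<iota> q \<in> (\<lambda>b. lcls n 2 (burau n b)) ` carrier (braid_group n)"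
      using emb unfolding Sn_embedding_def burau_cosets by blast
    then obtain b where b: "b \<in> carrier (braid_group n)" "\<iota> q = lcls n 2 (burau n b)" by blast
    let ?X = "lcls n (2 ^ k) (burau n b)"
    have X: "?X \<in> carrier ?E" unfolding Sn_preimage_eq[OF emb k] burau_image_def using b(1) by simp
    have "\<iota> (Sn_projection n \<iota> ?X) = \<iota> q"
      using proj(2)[OF X] b k by (simp add: Gamma_reduce_lcls)
    then have "Sn_projection n \<iota> ?X = q" using inj_onD[OF mon(2)] proj(1)[OF X] q by blast
    then show "q \<in> Sn_projection n \<iota> ` carrier ?E" using X by blast
  qed
  ultimately show ?thesis by (simp add: epi_iff_subset)
qed

text \<open>A coset taken inside the level 2 subgroup is the same set of matrices as the coset taken
  in the whole group, so the inclusion of the kernel is literally the identity map.\<close>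

lemma Sn_group_extension:
  assumes emb: "Sn_embedding n \<iota>" and k: "1 \<le> k"
  shows "group_extension ((Gamma n)\<lparr>carrier := Gamma_level n 2\<rparr> Mod Gamma_level n (2 ^ k))
    (Sn_preimage n \<iota> (2 ^ k)) (sym_group n) (\<lambda>X. X) (Sn_projection n \<iota>)"
proof -
  let ?E = "Sn_preimage n \<iota> (2 ^ k)"
  let ?G2 = "(Gamma n)\<lparr>carrier := Gamma_level n 2\<rparr>"
  let ?K = "?G2 Mod Gamma_level n (2 ^ k)"
  note proj = Sn_projection_props[OF emb k]
  have mon: "\<iota> \<in> hom (sym_group n) (Gamma_quot n 2)" "inj_on \<iota> (carrier (sym_group n))"
    using emb by (auto simp: Sn_embedding_def mon_def)
  have dvd: "int 2 dvd int (2 ^ k)" using k by simp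
  have sub: "Gamma_level n (2 ^ k) \<subseteq> Gamma_level n 2"
    unfolding Gamma_level_lcls lcls_def using mcong_dvd[OF _ dvd] by blast
  have K: "group ?K"
    by (intro normal.factorgroup_is_group Gamma.normal_restrict_supergroup normal_imp_subgroup
      Gamma_level_normal sub)
  have E: "group ?E"
    unfolding Sn_preimage_eq[OF emb k] using group_hom_burau group_hom.axioms(2) by blast
  have one: "\<iota> (one (sym_group n)) = Gamma_level n 2"
    using hom_one[OF mon(1) sym_group_is_group group_Gamma_quot] by simp
  have onec: "one (sym_group n) \<in> carrier (sym_group n)"
    using group.is_monoid[OF sym_group_is_group] monoid.one_closed by blast
  have Kc: "carrier ?K = lcls n (2 ^ k) ` Gamma_level n 2"
  proof -
    have "Gamma_level n (2 ^ k) #>\<^bsub>?G2\<^esub> A = lcls n (2 ^ k) A" if "A \<in> Gamma_level n 2" for A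
      using Gamma_level_coset[of A n "2 ^ k"] that by (simp add: r_coset_def Gamma_level_def)
    then show ?thesis unfolding carrier_FactGroup by simp
  qed
  have ker: "kernel ?E (sym_group n) (Sn_projection n \<iota>) = carrier ?K"
  proof (intro equalityI subsetI)
    fix X assume "X \<in> kernel ?E (sym_group n) (Sn_projection n \<iota>)"
    then have X: "X \<in> carrier ?E" "Sn_projection n \<iota> X = one (sym_group n)" by (auto simp: kernel_def)
    obtain A where A: "A \<in> carrier (Gamma n)" "X = lcls n (2 ^ k) A" "Gamma_reduce n 2 X = lcls n 2 A"
      using Sn_preimage_cases[OF emb k X(1)] by blast
    have eq: "lcls n 2 A = Gamma_level n 2" using proj(2)[OF X(1)] X(2) A(3) one by simp
    have "A \<in> lcls n 2 A" using A(1) by (simp add: lcls_def)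
    then have "A \<in> Gamma_level n 2" unfolding eq .
    then show "X \<in> carrier ?K" using A(2) Kc by blast
  next
    fix X assume "X \<in> carrier ?K"
    then obtain A where A: "A \<in> Gamma_level n 2" "X = lcls n (2 ^ k) A" using Kc by blast
    then have A': "A \<in> carrier (Gamma n)" "mcong n (int 2) A (1\<^sub>m n)" by (auto simp: Gamma_level_lcls lcls_def)
    have red: "Gamma_reduce n 2 X = \<iota> (one (sym_group n))"
      using A A' k lcls_eq_iff[OF A'(1) Gamma_one, of 2] one by (simp add: Gamma_reduce_lcls Gamma_level_lcls)
    then have X: "X \<in> carrier ?E"
      using onec A(2) A'(1) by (simp add: Sn_preimage_def carrier_Gamma_quot)
    then have "Sn_projection n \<iota> X = one (sym_group n)"
      using inj_onD[OF mon(2)] proj[OF X] red onec by metis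
    then show "X \<in> kernel ?E (sym_group n) (Sn_projection n \<iota>)" using X by (simp add: kernel_def)
  qed
  have "(\<lambda>X. X) \<in> mon ?K ?E"
  proof -
    have "carrier ?K \<subseteq> carrier ?E" unfolding ker[symmetric] by (auto simp: kernel_def)
    then show ?thesis by (auto simp: mon_def hom_def Sn_preimage_def set_mult_def)
  qed
  then show ?thesis
    unfolding group_extension_def
    using K E sym_group_is_group Sn_projection_epi[OF emb k] ker by simp
qed

text \<open>A section would lift the involution belonging to the first braid generator to a class
  with trivial square modulo \<open>2 ^ k\<close>. For \<open>k \<ge> 2\<close> this is an
  involution modulo 4, which \<open>no_involution_lift\<close> excludes.\<close>

lemma Sn_extension_nonsplit:
  assumes emb: "Sn_embedding n \<iota>" and k: "2 \<le> k" and n: "2 \<le> n"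
  shows "\<not> splits (Sn_preimage n \<iota> (2 ^ k)) (sym_group n) (Sn_projection n \<iota>)"
proof
  let ?E = "Sn_preimage n \<iota> (2 ^ k)"
  let ?T = "transv n 1 (cvec n 0)"
  assume "splits ?E (sym_group n) (Sn_projection n \<iota>)"
  then obtain s where s: "s \<in> hom (sym_group n) ?E"
    "\<And>q. q \<in> carrier (sym_group n) \<Longrightarrow> Sn_projection n \<iota> (s q) = q" unfolding splits_def by blast
  have k1: "1 \<le> k" using k by simp
  have mon: "\<iota> \<in> hom (sym_group n) (Gamma_quot n 2)" "inj_on \<iota> (carrier (sym_group n))"
    using emb by (auto simp: Sn_embedding_def mon_def)
  interpret S: group "sym_group n" by (rule sym_group_is_group)
  have T: "?T \<in> braid_image n" "?T \<in> carrier (Gamma n)"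
    using n by (auto intro!: cvec_braid_image transv_Gamma cvec_wlat)
  \<comment> \<open>As \<open>\<iota>\<close> is arbitrary, the permutation \<open>q\<close> is
    found as a preimage of the class of the transvection; that it squares to the identity follows
    from injectivity.\<close>
  have "lcls n 2 ?T \<in> \<iota> ` carrier (sym_group n)"
    using emb T(1) unfolding Sn_embedding_def burau_cosets by (auto simp: burau_image[symmetric])
  then obtain q where q: "q \<in> carrier (sym_group n)" "\<iota> q = lcls n 2 ?T" by blast
  have E: "group ?E"
    unfolding Sn_preimage_eq[OF emb k1] using group_hom_burau group_hom.axioms(2) by blast
  have "mcong n 2 (transv n 2 (cvec n 0)) (transv n 0 (cvec n 0))"
    by (rule transv_mcong) (auto simp: cong_def)
  then have "mcong n 2 (?T * ?T) (1\<^sub>m n)" by (simp add: transv_mult)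
  then have "\<iota> (q \<otimes>\<^bsub>sym_group n\<^esub> q) = Gamma_level n 2"
    using hom_mult[OF mon(1) q(1) q(1)] q(2) T(2) lcls_eq_iff[of "?T * ?T" n "1\<^sub>m n" 2]
    by (simp add: lcls_mult Gamma_level_lcls)
  also have "\<dots> = \<iota> (one (sym_group n))"
    using hom_one[OF mon(1) S.is_group group_Gamma_quot] by simp
  finally have qq: "q \<otimes>\<^bsub>sym_group n\<^esub> q = one (sym_group n)"
    using inj_onD[OF mon(2)] q(1) by simp
  have X: "s q \<in> carrier ?E" using s(1) q(1) by (rule hom_in_carrier)
  obtain A where A: "A \<in> carrier (Gamma n)" "s q = lcls n (2 ^ k) A" "Gamma_reduce n 2 (s q) = lcls n 2 A"
    using Sn_preimage_cases[OF emb k1 X] by blast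
  have "lcls n 2 A = lcls n 2 ?T"
    using Sn_projection_props(2)[OF emb k1 X] s(2)[OF q(1)] q(2) A(3) by simp
  then have AT: "mcong n 2 A ?T" using lcls_eq_iff[OF A(1) T(2), of 2] by simp
  have "s q \<otimes>\<^bsub>?E\<^esub> s q = one ?E"
    using hom_mult[OF s(1) q(1) q(1)] hom_one[OF s(1) S.is_group E] qq by simp
  then have "lcls n (2 ^ k) (A * A) = lcls n (2 ^ k) (1\<^sub>m n)"
    using A by (simp add: Sn_preimage_def lcls_mult Gamma_level_lcls)
  then have "mcong n (int (2 ^ k)) (A * A) (1\<^sub>m n)" using A(1) by (subst (asm) lcls_eq_iff) auto
  moreover have "4 dvd int (2 ^ k)" using k le_imp_power_dvd[of 2 k "2 :: int"] by simp
  ultimately have "mcong n 4 (A * A) (1\<^sub>m n)" by (rule mcong_dvd)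
  then show False using no_involution_lift[OF A(1) n _ AT] by blast
qed

theorem theoremA:
  fixes n k m l :: nat
  assumes "n \<ge> 2" and "odd m" and "l = 2 ^ k * m"
  shows "(n \<in> {2, 3} \<longrightarrow> braid_quot n l \<cong> Gamma_quot n l) \<and>
    (n \<ge> 4 \<longrightarrow>
      braid_quot n l \<cong> braid_quot n (2 ^ k) \<times>\<times> Gamma_quot n m \<and>
      (k = 0 \<longrightarrow> trivial_group (braid_quot n (2 ^ k))) \<and>
      (k = 1 \<longrightarrow> braid_quot n (2 ^ k) \<cong> sym_group n) \<and>
      (k \<ge> 2 \<longrightarrow>
        (\<exists>\<iota>. Sn_embedding n \<iota>) \<and>
        (\<forall>\<iota>. Sn_embedding n \<iota> \<longrightarrow>
          burau_quot n (2 ^ k) \<in> iso (braid_quot n (2 ^ k)) (Sn_preimage n \<iota> (2 ^ k)) \<and>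
          group_extension
            ((Gamma n)\<lparr>carrier := Gamma_level n 2\<rparr> Mod Gamma_level n (2 ^ k))
            (Sn_preimage n \<iota> (2 ^ k)) (sym_group n)
            (\<lambda>X. X) (Sn_projection n \<iota>) \<and>
          \<not> splits (Sn_preimage n \<iota> (2 ^ k)) (sym_group n) (Sn_projection n \<iota>))))"
proof (intro conjI impI allI)
  have "0 < m" using assms(2) by (rule odd_pos)
  then show "braid_quot n l \<cong> Gamma_quot n l" if "n \<in> {2, 3}"
    using that assms(3) by (intro braid_quot_iso_small) simp_all
  show "braid_quot n l \<cong> braid_quot n (2 ^ k) \<times>\<times> Gamma_quot n m"
    unfolding assms(3) using assms(1,2) by (intro braid_quot_iso_product) simp_all
  show "trivial_group (braid_quot n (2 ^ k))" if "k = 0"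
    using that braid_quot_trivial by simp
  show "braid_quot n (2 ^ k) \<cong> sym_group n" if "k = 1"
    using that iso_trans[OF is_isoI[OF burau_quot_iso[of n 2]]
      group.iso_sym[OF sym_group_is_group sym_group_iso]] by simp
  show "\<exists>\<iota>. Sn_embedding n \<iota>" using Sn_embedding_perm_coset by blast
  fix \<iota> assume k: "2 \<le> k" and emb: "Sn_embedding n \<iota>"
  have k1: "1 \<le> k" using k by simp
  show "burau_quot n (2 ^ k) \<in> iso (braid_quot n (2 ^ k)) (Sn_preimage n \<iota> (2 ^ k))"
    unfolding Sn_preimage_eq[OF emb k1] by (rule burau_quot_iso)
  show "group_extension ((Gamma n)\<lparr>carrier := Gamma_level n 2\<rparr> Mod Gamma_level n (2 ^ k))
      (Sn_preimage n \<iota> (2 ^ k)) (sym_group n) (\<lambda>X. X) (Sn_projection n \<iota>)"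
    by (rule Sn_group_extension[OF emb k1])
  show "\<not> splits (Sn_preimage n \<iota> (2 ^ k)) (sym_group n) (Sn_projection n \<iota>)"
    by (rule Sn_extension_nonsplit[OF emb k assms(1)])
qed

end
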